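(* Consider the (ON/OFF-BMAP)/D/1/$K$ queue described in the context, and suppose: $\lambda>1$; there is a nonnegative random variable $Y\in\mathcal{S}$ with $\sum_{l=k+1}^\infty\boldsymbol{\alpha}(l)=O(\mathbb{P}(Y>k))$ and $\sum_{l=k+1}^\infty\boldsymbol{\Lambda}(l)=O(\mathbb{P}(Y>k))$ (entrywise); and $\mathbb{E}[A]<\mathbb{E}[I^{\rm off}]$. Further suppose (i) $I^{\rm on}\in\mathcal{C}$; (ii) $\mathbb{E}[I^{\rm on}]<\infty$; and (iii) $x\,\mathbb{P}(Y>x)=o(\mathbb{P}(I^{\rm on}>x))$. Then $$P_{\rm loss}^{(K)}\sim\frac{(\lambda-1)\mathbb{E}[I^{\rm on}]}{\mathbb{E}[A]+\mathbb{E}[I^{\rm on}]}\,\mathbb{P}\big(I^{\rm on}_{\rm e}>K/(\lambda-1)\big)\quad(K\to\infty).$$ If in addition (iv) for each $m\in\mathbb{Z}$ and all $n\ge0$, $\{I_m^{\rm on}\ge n+1\}$ is independent of $N_{m,n}$; and (v) $\boldsymbol{\alpha}(k)=\boldsymbol{\phi}\boldsymbol{\Lambda}(k)$ for $k\ge1$, then $P_{\rm loss}^{(K)}\sim\frac{\lambda-1}{\lambda}\mathbb{P}(I^{\rm on}_{\rm e}>K/(\lambda-1))$.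
   Context: Discrete time, slots $[n,n+1]$. ON/OFF-BMAP: on- and off-periods alternate, indexed by $m\in\mathbb{Z}$; no arrivals in off-slots. In the $m$th on-period, $N_{m,n}$ is the number of arrivals in its $n$th slot and $J_{m,n}\in\mathbb{D}=\{0,\dots,d-1\}$ a background state, with $\mathbb{P}(N_{m,0}=k,J_{m,0}=i)=\alpha_i(k)$ and $\mathbb{P}(N_{m,n}=k,J_{m,n}=j\mid J_{m,n-1}=i,\text{past})=\Lambda_{i,j}(k)$ ($k\ge1$, $n\ge1$); $\sum_k\boldsymbol{\alpha}(k)$ is a probability vector, $\sum_k\boldsymbol{\Lambda}(k)$ irreducible stochastic with stationary vector $\boldsymbol{\phi}$, $\lambda=\boldsymbol{\phi}\sum_kk\boldsymbol{\Lambda}(k)\mathbf{e}$. $I_m^{\rm on}\ge1$ is the $m$th on-period length (possibly dependent on the $m$th BMAP); the tuples $\{I_m^{\rm on},(N_{m,n},J_{m,n})_{0\le n<I_m^{\rm on}}\}$ are i.i.d. over $m$; off-period lengths $I_m^{\rm off}$ are i.i.d. (and independent of on-period data). $A_m=\sum_{n=0}^{I_m^{\rm on}-1}(N_{m,n}-1)$. Queue with capacity $K$, unit service times: $L_{m+1}^{(K)}=(\min(L_m^{(K)}+A_{m+1},K)-I_{m+1}^{\rm off})^+$; $P_{\rm loss}^{(K)}=\mathbb{E}[(L_{m-1}^{(K)}+A_m-K)^+]/\mathbb{E}[A_m+I_m^{\rm on}]$ in stationarity (long-run fraction of lost arrivals). $A,I^{\rm on},I^{\rm off}$ generic copies; equilibrium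 r.v. $X_{\rm e}$: $\mathbb{P}(X_{\rm e}\le x)=\frac1{\mathbb{E}X}\int_0^x\mathbb{P}(X>y)dy$. Classes: $\mathcal{S}$: positive tail and $\mathbb{P}(X_1+X_2>x)\sim2\mathbb{P}(X>x)$ for independent copies. $\mathcal{C}$: positive tail and $\lim_{v\downarrow1}\liminf_{x\to\infty}\mathbb{P}(X>vx)/\mathbb{P}(X>x)=1$. *)

theory Defs
  imports "HOL-Probability.Probability" "HOL-Library.Landau_Symbols"
begin

(* d x d matrices as functions nat => nat => real, indices < d *)
fun mat_pow :: "nat \<Rightarrow> (nat \<Rightarrow> nat \<Rightarrow> real) \<Rightarrow> nat \<Rightarrow> nat \<Rightarrow> nat \<Rightarrow> real" where
  "mat_pow d Q 0 i j = (if i = j then 1 else 0)"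
| "mat_pow d Q (Suc n) i j = (\<Sum>l<d. mat_pow d Q n i l * Q l j)"

definition irreducible_mat :: "nat \<Rightarrow> (nat \<Rightarrow> nat \<Rightarrow> real) \<Rightarrow> bool" where
  "irreducible_mat d Q \<longleftrightarrow> (\<forall>i<d. \<forall>j<d. \<exists>n. mat_pow d Q n i j > 0)"

definition stochastic_mat :: "nat \<Rightarrow> (nat \<Rightarrow> nat \<Rightarrow> real) \<Rightarrow> bool" where
  "stochastic_mat d Q \<longleftrightarrow> (\<forall>i<d. \<forall>j<d. Q i j \<ge> 0) \<and> (\<forall>i<d. (\<Sum>j<d. Q i j) = 1)"

definition prob_vector :: "nat \<Rightarrow> (nat \<Rightarrow> real) \<Rightarrow> bool" where
  "prob_vector d v \<longleftrightarrow> (\<forall>i<d. v i \<ge> 0) \<and> (\<Sum>i<d. v i) = 1"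

(* sum over k >= 1 of Lam(k): Lam k i j is the (i,j) entry of Lambda(k) *)
definition Lam_sum :: "(nat \<Rightarrow> nat \<Rightarrow> nat \<Rightarrow> real) \<Rightarrow> nat \<Rightarrow> nat \<Rightarrow> real" where
  "Lam_sum Lam i j = (\<Sum>k. Lam (Suc k) i j)"

definition arr_rate :: "nat \<Rightarrow> (nat \<Rightarrow> real) \<Rightarrow> (nat \<Rightarrow> nat \<Rightarrow> nat \<Rightarrow> real) \<Rightarrow> real" where
  "arr_rate d phi Lam = (\<Sum>i<d. \<Sum>j<d. phi i * (\<Sum>k. real (Suc k) * Lam (Suc k) i j))"

definition Aon :: "(int \<Rightarrow> nat \<Rightarrow> 'a \<Rightarrow> nat) \<Rightarrow> (int \<Rightarrow> 'a \<Rightarrow> nat) \<Rightarrow> int \<Rightarrow> 'a \<Rightarrow> int" where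
  "Aon N Ion m \<omega> = (\<Sum>n<Ion m \<omega>. int (N m n \<omega>) - 1)"

definition on_data :: "(int \<Rightarrow> nat \<Rightarrow> 'a \<Rightarrow> nat) \<Rightarrow> (int \<Rightarrow> nat \<Rightarrow> 'a \<Rightarrow> nat) \<Rightarrow> (int \<Rightarrow> 'a \<Rightarrow> nat)
    \<Rightarrow> int \<Rightarrow> 'a \<Rightarrow> nat \<times> (nat \<Rightarrow> nat \<times> nat)" where
  "on_data N J Ion m \<omega> = (Ion m \<omega>, (\<lambda>n. if n < Ion m \<omega> then (N m n \<omega>, J m n \<omega>) else (0, 0)))"

definition on_space :: "(nat \<times> (nat \<Rightarrow> nat \<times> nat)) measure" where
  "on_space = (count_space UNIV) \<Otimes>\<^sub>M (\<Pi>\<^sub>M n\<in>(UNIV::nat set). count_space UNIV)"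

(* one-step transition probability of the queue-length chain
   L' = (min(L + A, K) - I^off)^+  with (A, I^off) a generic pair *)
definition qtrans :: "'a measure \<Rightarrow> ('a \<Rightarrow> int) \<Rightarrow> ('a \<Rightarrow> nat) \<Rightarrow> nat \<Rightarrow> nat \<Rightarrow> nat \<Rightarrow> real" where
  "qtrans M A Ioff K l j =
     measure M {\<omega> \<in> space M. nat (min (int l + A \<omega>) (int K) - int (Ioff \<omega>)) = j}"

definition stat_dist :: "(nat \<Rightarrow> nat \<Rightarrow> real) \<Rightarrow> nat \<Rightarrow> (nat \<Rightarrow> real) \<Rightarrow> bool" where
  "stat_dist P K p \<longleftrightarrow> (\<forall>l\<le>K. p l \<ge> 0) \<and> (\<Sum>l\<le>K. p l) = 1
      \<and> (\<forall>j\<le>K. p j = (\<Sum>l\<le>K. p l * P l j))"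

(* P_loss^(K) = E[(L_{m-1} + A_m - K)^+] / E[A_m + I_m^on] in stationarity,
   where L_{m-1} ~ p is independent of A_m *)
definition ploss :: "'a measure \<Rightarrow> ('a \<Rightarrow> int) \<Rightarrow> ('a \<Rightarrow> nat) \<Rightarrow> nat \<Rightarrow> (nat \<Rightarrow> real) \<Rightarrow> real" where
  "ploss M A Ion K p =
     (\<Sum>l\<le>K. p l * (\<integral>\<omega>. real (nat (int l + A \<omega> - int K)) \<partial>M))
     / (\<integral>\<omega>. real_of_int (A \<omega>) + real (Ion \<omega>) \<partial>M)"

definition eq_tail :: "'a measure \<Rightarrow> ('a \<Rightarrow> real) \<Rightarrow> real \<Rightarrow> real" where
  "eq_tail M X x = 1 - (LBINT y=0..x. measure M {\<omega> \<in> space M. X \<omega> > y}) / (\<integral>\<omega>. X \<omega> \<partial>M)"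

definition subexp_law :: "real measure \<Rightarrow> bool" where
  "subexp_law mu \<longleftrightarrow> (\<forall>x. measure mu {x<..} > 0) \<and>
     ((\<lambda>x. measure (mu \<star> mu) {x<..}) \<sim>[at_top] (\<lambda>x. 2 * measure mu {x<..}))"

definition classC :: "'a measure \<Rightarrow> ('a \<Rightarrow> real) \<Rightarrow> bool" where
  "classC M X \<longleftrightarrow> (\<forall>x. measure M {\<omega> \<in> space M. X \<omega> > x} > 0) \<and>
     ((\<lambda>v. Liminf at_top (\<lambda>x::real. ereal (measure M {\<omega> \<in> space M. X \<omega> > v * x}
                                         / measure M {\<omega> \<in> space M. X \<omega> > x})))
        \<longlongrightarrow> (1::ereal)) (at_right 1)"

end

theory Submission
  imports Defs "HOL-Real_Asymp.Real_Asymp"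
begin

text \<open>
  Write \<open>T n = P(A > n)\<close> and \<open>G n = E(A - n)\<^sup>+\<close>, so that the numerator of the loss probability is
  \<open>\<Sum>\<^sub>l \<pi>(l) G(K - l) \<ge> G K\<close>. A matching upper bound needs only that \<open>T\<close> is dominatedly varying with
  finite mean: testing stationarity against the convex function with slope
  \<open>B G(K - j) min(j/l\<^sub>1, 1)\<close> (frozen near \<open>j = K\<close>) gives a drift of at most
  \<open>(1 + \<eta>) G K - G(K - l)\<close> from every level \<open>l\<close>, because \<open>\<Sum>\<^sub>s\<^sub><\<^sub>u G(u - s) T s \<sim> E A G u\<close> and
  \<open>E A < E I\<^sup>o\<^sup>f\<^sup>f\<close>.

  The tail \<open>T n \<sim> P((\<lambda> - 1) I\<^sup>o\<^sup>n > n)\<close> comes from large deviations of the Markov additive process. An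
  approximate solution of the Poisson equation gives exponential supermartingales for arbitrary
  increment weights. From below this yields exponentially small probabilities. From above, increments
  larger than \<open>\<delta> x\<close> are excluded at cost \<open>O(x P(Y > \<delta> x)) = o(P(I\<^sup>o\<^sup>n > x))\<close>, and the truncated walk at
  exponent \<open>c ln x / x\<close> contributes any prescribed negative power of \<open>x\<close>, whereas class \<open>C\<close> tails
  decay at most polynomially.
\<close>

section \<open>Overflow of a finite buffer with a dominatedly varying input\<close>

text \<open>Three obstacles shape the argument. The period length may depend on the arrivals, so the
  walk is never conditioned on it. Its partial sums are nondecreasing, and comparing the period
  length with one deterministic slot count \<open>k\<close> traps the event of a large net input
  between events on the period length alone, up to a deviation event for \<open>S k\<close>. Such
  deviations only have to be small against the tail of the period length. In the drift argument the
  gap between the mean off-period and the mean input, multiplied by a large \<open>B\<close>, pays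
  for the expected overflow at high levels. Near the empty buffer an off-period cannot be used up in
  full, and the ramp of the slope to 0 makes this loss harmless; what the ramp costs is a small
  multiple of \<open>G K\<close> once \<open>l1\<close> is large. The freezing near the full buffer
  is there because the estimates on \<open>G\<close> hold only for large arguments. The background
  chain may be periodic, so iterates of its transition matrix need not converge; Cesaro means
  replace them, and an error of order \<open>e\<close> in the Poisson equation is absorbed by the
  margin of the deviation bounds.\<close>

definition tailsum :: "(nat \<Rightarrow> real) \<Rightarrow> nat \<Rightarrow> real" where
  "tailsum T n = (\<Sum>k. T (n + k))"

locale dominated_tail =
  fixes T :: "nat \<Rightarrow> real"
  assumes T_pos: "\<And>n. T n > 0"
    and T_anti: "antimono T"
    and T_summable: "summable T"
    and T_dom: "\<exists>C. eventually (\<lambda>n. T n \<le> C * T (2 * n)) sequentially"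
begin

abbreviation "G \<equiv> tailsum T"

lemma T_mono: "m \<le> n \<Longrightarrow> T n \<le> T m"
  using T_anti by (auto simp: antimono_def)

lemma summable_shift: "summable (\<lambda>k. T (n + k))"
  using summable_ignore_initial_segment[OF T_summable, of n] by (simp add: add.commute)

lemma G_split: "G n = (\<Sum>k<j. T (n + k)) + G (n + j)"
  unfolding tailsum_def
  using suminf_split_initial_segment[OF summable_shift[of n], of j] by (simp add: ac_simps)

lemma G_0: "G 0 = suminf T"
  by (simp add: tailsum_def)

lemma G_pos: "G n > 0"
  unfolding tailsum_def by (rule suminf_pos[OF summable_shift T_pos])

lemma G_mono: "m \<le> n \<Longrightarrow> G n \<le> G m"
  unfolding tailsum_def by (rule suminf_le) (auto intro!: T_mono summable_shift)

lemma G_tendsto_0: "G \<longlonglongrightarrow> 0"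
proof -
  have "G n = suminf T - (\<Sum>k<n. T k)" for n
    using G_split[of 0 n] by (simp add: G_0)
  moreover have "(\<lambda>n. suminf T - (\<Sum>k<n. T k)) \<longlonglongrightarrow> suminf T - suminf T"
    by (intro tendsto_intros summable_LIMSEQ T_summable)
  moreover have "G = (\<lambda>n. suminf T - (\<Sum>k<n. T k))" using calculation(1) by (rule ext)
  ultimately show ?thesis by simp
qed

text \<open>The second bound follows termwise, since
  \<open>T (2 * (n + k)) \<le> T (2 * n + k)\<close>. For the third, the \<open>n\<close> terms of
  \<open>G n\<close> with index below \<open>2 * n\<close> are each at least
  \<open>T (2 * n)\<close>, hence at least \<open>T n / C\<close>.\<close>

lemma dom_const:
  obtains C n0 where "C \<ge> 1" "n0 \<ge> 1" "\<And>n. n \<ge> n0 \<Longrightarrow> T n \<le> C * T (2 * n)"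
    "\<And>n. n \<ge> n0 \<Longrightarrow> G n \<le> C * G (2 * n)" "\<And>n. n \<ge> n0 \<Longrightarrow> real n * T n \<le> C * G n"
proof -
  obtain C0 n0 where C0: "\<And>n. n \<ge> n0 \<Longrightarrow> T n \<le> C0 * T (2 * n)"
    using T_dom by (auto simp: eventually_sequentially)
  define C where "C = max C0 1"
  have T2: "T n \<le> C * T (2 * n)" if "n \<ge> n0" for n
  proof -
    have "C0 * T (2*n) \<le> C * T (2*n)"
      using T_pos[of "2*n"] by (intro mult_right_mono) (auto simp: C_def)
    with C0[OF that] show ?thesis by linarith
  qed
  have "C \<ge> 1" by (simp add: C_def)
  moreover have "G n \<le> C * G (2 * n)" if "n \<ge> n0" for n
  proof -
    have "T (n + k) \<le> C * T (2 * n + k)" for k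
      using T2[of "n+k"] that T_mono[of "2*n+k" "2*(n+k)"] \<open>C \<ge> 1\<close>
      by (smt (verit, best) add_leD2 le_add1 le_trans mult_2 mult_left_mono add_mult_distrib2 add_mono_thms_linordered_semiring(2))
    then have "(\<Sum>k. T (n + k)) \<le> (\<Sum>k. C * T (2 * n + k))"
      by (intro suminf_le summable_mult summable_shift) auto
    then show ?thesis
      by (simp add: tailsum_def suminf_mult[OF summable_shift])
  qed
  moreover have "real n * T n \<le> C * G n" if "n \<ge> n0" for n
  proof -
    have "real n * T (2 * n) \<le> (\<Sum>k<n. T (n + k))"
      using sum_bounded_below[of "{..<n}" "T (2*n)" "\<lambda>k. T (n+k)"] by (simp add: T_mono)
    also have "\<dots> \<le> G n"
      using G_split[of n n] G_pos[of "n+n"] by simp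
    finally have "C * (real n * T (2 * n)) \<le> C * G n"
      using \<open>C \<ge> 1\<close> by (intro mult_left_mono) auto
    moreover have "real n * T n \<le> real n * (C * T (2 * n))"
      using T2[OF that] by (intro mult_left_mono) auto
    ultimately show ?thesis by (simp add: ac_simps)
  qed
  ultimately show ?thesis
    using T2 by (intro that[of C "max n0 1"]) auto
qed

text \<open>Dominated variation makes \<open>n * T n\<close> at most a multiple of
  \<open>G n\<close>, so the tail is negligible against its integrated tail. Bounded shifts and
  rounding to integers therefore do not affect \<open>G\<close> asymptotically.\<close>

lemma T_small_G: assumes "e > 0" shows "eventually (\<lambda>n. T n \<le> e * G n) sequentially"
proof -
  obtain C n0 where C: "C \<ge> 1" "\<And>n. n \<ge> n0 \<Longrightarrow> real n * T n \<le> C * G n"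
    using dom_const by metis
  show ?thesis unfolding eventually_sequentially
  proof (intro exI allI impI)
    fix n assume n: "n \<ge> max (max n0 1) (nat \<lceil>C / e\<rceil>)"
    then have "C / e \<le> real n" by linarith
    then have "C \<le> e * real n" using assms by (simp add: field_simps)
    then have "C * G n \<le> e * real n * G n" using G_pos[of n] by (intro mult_right_mono) auto
    also have "e * real n * G n = real n * (e * G n)" by simp
    finally have "real n * T n \<le> real n * (e * G n)" using C(2)[of n] n by linarith
    moreover have "real n > 0" using n by simp
    ultimately show "T n \<le> e * G n" by (simp only: mult_le_cancel_left_pos)
  qed
qed

lemma G_shift:
  assumes "e > 0" shows "eventually (\<lambda>n. G n * (1 - e) \<le> G (n + j)) sequentially"
proof -
  have "e / (real j + 1) > 0" using assms by simp
  from T_small_G[OF this] show ?thesis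
  proof eventually_elim
    case (elim n)
    have "(\<Sum>k<j. T (n + k)) \<le> real j * T n"
      using sum_bounded_above[of "{..<j}" "\<lambda>k. T (n+k)" "T n"] by (simp add: T_mono)
    also have "\<dots> \<le> real j * (e / (real j + 1) * G n)"
      using elim by (intro mult_left_mono) auto
    also have "\<dots> = (real j / (real j + 1)) * (e * G n)" by simp
    also have "\<dots> \<le> 1 * (e * G n)"
      using assms G_pos[of n] by (intro mult_right_mono) auto
    finally show ?case using G_split[of n j] by (simp add: algebra_simps)
  qed
qed

text \<open>\<open>G\<close> tends to 0 but need not be summable, which would amount to a finite
  second moment of the input. A sublinear bound on its partial sums is enough for the last block in
  \<open>G_conv\<close>.\<close>

lemma G_cesaro:
  assumes "e > 0" shows "eventually (\<lambda>n. (\<Sum>j\<le>n. G j) \<le> e * real n) sequentially"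
proof -
  obtain j0 where j0: "\<And>j. j \<ge> j0 \<Longrightarrow> G j \<le> e / 3"
    using order_tendstoD(2)[OF G_tendsto_0, of "e/3"] assms
    by (auto simp: eventually_sequentially intro: less_imp_le)
  have bound: "(\<Sum>j\<le>n. G j) \<le> real j0 * G 0 + real (Suc n) * (e/3)" for n
  proof -
    have "(\<Sum>j\<le>n. G j) \<le> (\<Sum>j\<le>n. (if j < j0 then G 0 else 0) + e/3)"
      using j0 G_mono[of 0] assms G_pos[of 0] by (intro sum_mono) (auto simp: not_less intro: add_increasing2)
    also have "\<dots> = (\<Sum>j\<in>{..n} \<inter> {..<j0}. G 0) + real (Suc n) * (e/3)"
      by (simp add: sum.distrib sum.If_cases lessThan_def)
    also have "(\<Sum>j\<in>{..n} \<inter> {..<j0}. G 0) \<le> (\<Sum>j<j0. G 0)"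
      using G_pos[of 0] by (intro sum_mono2) auto
    finally show ?thesis by simp
  qed
  show ?thesis unfolding eventually_sequentially
  proof (intro exI allI impI)
    fix n assume n: "n \<ge> max 1 (nat \<lceil>3 * real j0 * G 0 / e\<rceil>)"
    then have "3 * real j0 * G 0 / e \<le> real n" by linarith
    then have "3 * real j0 * G 0 \<le> e * real n" using assms by (simp add: field_simps)
    moreover have "e \<le> e * real n" using n assms by auto
    moreover have "real (Suc n) * (e/3) = e * real n / 3 + e / 3" by (simp add: algebra_simps)
    ultimately show "(\<Sum>j\<le>n. G j) \<le> e * real n"
      using bound[of n] by linarith
  qed
qed

text \<open>Only small \<open>s\<close> matter. For \<open>s < s0\<close> the factor
  \<open>G (u - s)\<close> is close to \<open>G u\<close>; up to \<open>u / 2\<close> it is at most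
  \<open>C^2 * G u\<close>, while the remaining mass of \<open>T\<close> is small; beyond
  \<open>u / 2\<close> the factor \<open>T s\<close> is at most \<open>T h\<close>, and the
  sublinear sum of \<open>G\<close> is absorbed by
  \<open>real h * T h \<le> C * G h\<close>.\<close>

lemma G_conv:
  assumes "e > 0"
  shows "eventually (\<lambda>u. (\<Sum>s<u. G (u - s) * T s) \<le> (suminf T + e) * G u) sequentially"
proof -
  obtain C n0 where C: "C \<ge> 1" "n0 \<ge> 1" "\<And>n. n \<ge> n0 \<Longrightarrow> T n \<le> C * T (2 * n)"
    "\<And>n. n \<ge> n0 \<Longrightarrow> G n \<le> C * G (2 * n)" "\<And>n. n \<ge> n0 \<Longrightarrow> real n * T n \<le> C * G n"
    using dom_const by metis
  have sT: "suminf T > 0" using G_pos[of 0] by (simp add: G_0)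
  \<comment> \<open>\<open>C^2\<close> is the cost of passing from \<open>G h\<close> to
    \<open>G u\<close> in two doublings; the third power in \<open>e3\<close> comes from
    \<open>real h * T h \<le> C * G h\<close>. Each of the three blocks may contribute
    \<open>e/3\<close>.\<close>
  define e1 where "e1 = e / (3 * C^2)"
  have e1: "e1 > 0" using assms C by (simp add: e1_def)
  obtain s0 where s0: "G s0 \<le> e1"
    using order_tendstoD(2)[OF G_tendsto_0 e1] by (auto simp: eventually_sequentially intro: less_imp_le)
  define e2 where "e2 = min (1/2) (e / (6 * suminf T))"
  have e2: "e2 > 0" "e2 \<le> 1/2" "2 * e2 * suminf T \<le> e / 3"
    using assms sT by (auto simp: e2_def min_def field_simps)
  define e3 where "e3 = e / (6 * C^3)"
  have e3: "e3 > 0" using assms C by (simp add: e3_def)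
  obtain n1 where n1: "\<And>n. n \<ge> n1 \<Longrightarrow> G n * (1 - e2) \<le> G (n + s0)"
    using G_shift[OF e2(1)] by (auto simp: eventually_sequentially)
  obtain n2 where n2: "\<And>n. n \<ge> n2 \<Longrightarrow> (\<Sum>j\<le>n. G j) \<le> e3 * real n"
    using G_cesaro[OF e3] by (auto simp: eventually_sequentially)
  show ?thesis unfolding eventually_sequentially
  proof (intro exI allI impI)
    fix u assume u: "u \<ge> 2 * n0 + n1 + 2 * n2 + 2 * s0 + 4"
    define h where "h = u div 2"
    have h: "h \<ge> n0" "h \<ge> n2" "h \<ge> s0" "h \<ge> 1" "2 * h \<le> u" "u \<le> 2 * h + 1" "u - s0 \<ge> n1"
      using u unfolding h_def by auto
    have Gh: "G h \<le> C^2 * G u"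
    proof -
      have "G h \<le> C * G (2 * h)" using C h by auto
      also have "\<dots> \<le> C * (C * G (2 * (2 * h)))" using C(1) C(4)[of "2*h"] h by (intro mult_left_mono) linarith+
      also have "\<dots> \<le> C * (C * G u)" using C h by (intro mult_left_mono G_mono) auto
      finally show ?thesis by (simp add: power2_eq_square)
    qed
    have p1: "(\<Sum>s<s0. G (u - s) * T s) \<le> (suminf T + e/3) * G u"
    proof -
      have *: "G (u - s0) \<le> (1 + 2 * e2) * G u"
      proof -
        have "G (u - s0) * (1 - e2) \<le> G u" using n1[of "u - s0"] h by auto
        then have "(1 + 2 * e2) * (G (u - s0) * (1 - e2)) \<le> (1 + 2 * e2) * G u"
          using e2 by (intro mult_left_mono) auto
        moreover have "(1 + 2 * e2) * (1 - e2) \<ge> 1" using e2 by (simp add: algebra_simps mult_left_le_one_le mult_le_cancel_left2)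
        then have "G (u - s0) * 1 \<le> G (u - s0) * ((1 + 2 * e2) * (1 - e2))"
          using G_pos[of "u - s0"] by (intro mult_left_mono) auto
        ultimately show ?thesis by (simp add: ac_simps)
      qed
      have "(\<Sum>s<s0. G (u - s) * T s) \<le> (\<Sum>s<s0. G (u - s0) * T s)"
        using T_pos by (intro sum_mono mult_right_mono G_mono) (auto intro: less_imp_le)
      also have "\<dots> = G (u - s0) * (\<Sum>s<s0. T s)" by (simp add: sum_distrib_left)
      also have "\<dots> \<le> G (u - s0) * suminf T"
        using T_pos G_pos[of "u-s0"] by (intro mult_left_mono sum_le_suminf T_summable) (auto intro: less_imp_le)
      also have "\<dots> \<le> (1 + 2 * e2) * G u * suminf T"
        using * sT by (intro mult_right_mono) auto
      also have "\<dots> = (suminf T + 2 * e2 * suminf T) * G u" by (simp add: algebra_simps)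
      also have "\<dots> \<le> (suminf T + e/3) * G u"
        using e2 G_pos[of u] by (intro mult_right_mono) auto
      finally show ?thesis .
    qed
    have p2: "(\<Sum>s\<in>{s0..<h}. G (u - s) * T s) \<le> e/3 * G u"
    proof -
      have "(\<Sum>s\<in>{s0..<h}. G (u - s) * T s) \<le> (\<Sum>s\<in>{s0..<h}. G h * T s)"
        using T_pos h by (intro sum_mono mult_right_mono G_mono) (auto intro: less_imp_le)
      also have "\<dots> = G h * (\<Sum>s\<in>{s0..<h}. T s)" by (simp add: sum_distrib_left)
      also have "(\<Sum>s\<in>{s0..<h}. T s) = (\<Sum>k<h - s0. T (s0 + k))"
        using sum.atLeastLessThan_shift_0[of T s0 h] by (simp add: add.commute lessThan_atLeast0 comp_def)
      also have "\<dots> \<le> G s0"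
        using G_split[of s0 "h - s0"] G_pos[of "s0 + (h - s0)"] by auto
      also have "G h * G s0 \<le> C^2 * G u * e1"
        using Gh s0 G_pos[of h] G_pos[of s0] G_pos[of u] by (intro mult_mono) auto
      also have "\<dots> = e/3 * G u" using C by (simp add: e1_def)
      finally show ?thesis using G_pos[of h] by (simp add: mult_left_mono)
    qed
    have p3: "(\<Sum>s\<in>{h..<u}. G (u - s) * T s) \<le> e/3 * G u"
    proof -
      have "(\<Sum>s\<in>{h..<u}. G (u - s) * T s) \<le> (\<Sum>s\<in>{h..<u}. G (u - s) * T h)"
        using G_pos by (intro sum_mono mult_left_mono T_mono) (auto intro: less_imp_le)
      also have "\<dots> = (\<Sum>s\<in>{h..<u}. G (u - s)) * T h" by (simp add: sum_distrib_right)
      also have "(\<Sum>s\<in>{h..<u}. G (u - s)) = (\<Sum>j\<in>{1..u-h}. G j)"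
        by (rule sum.reindex_bij_witness[of _ "\<lambda>j. u - j" "\<lambda>s. u - s"]) auto
      also have "\<dots> \<le> (\<Sum>j\<le>h+1. G j)"
        using h G_pos by (intro sum_mono2) (auto intro: less_imp_le)
      also have "\<dots> \<le> e3 * real (h + 1)" using h by (intro n2) auto
      also have "\<dots> \<le> e3 * (2 * real h)" using h e3 by (intro mult_left_mono) auto
      finally have "(\<Sum>s\<in>{h..<u}. G (u - s) * T s) \<le> e3 * (2 * real h) * T h"
        using T_pos[of h] by (simp add: mult_right_mono)
      also have "\<dots> = 2 * e3 * (real h * T h)" by simp
      also have "\<dots> \<le> 2 * e3 * (C * (C^2 * G u))"
        using e3 C(5)[of h] h Gh C(1) by (intro mult_left_mono) (auto intro: order_trans[OF C(5)])
      also have "\<dots> = e/3 * G u" using C by (simp add: e3_def power2_eq_square power3_eq_cube)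
      finally show ?thesis .
    qed
    have "(\<Sum>s<u. G (u - s) * T s) = (\<Sum>s<s0. G (u - s) * T s) + (\<Sum>s\<in>{s0..<h}. G (u - s) * T s)
        + (\<Sum>s\<in>{h..<u}. G (u - s) * T s)"
      using h by (simp add: lessThan_atLeast0 sum.atLeastLessThan_concat)
    also have "\<dots> \<le> (suminf T + e) * G u"
      using p1 p2 p3 by (simp add: algebra_simps)
    finally show "(\<Sum>s<u. G (u - s) * T s) \<le> (suminf T + e) * G u" .
  qed
qed


text \<open>Here \<open>T\<close> and \<open>H\<close> are the tails of the input and of the
  off-period, and the difference of sums bounds the mean one-step increase, from level
  \<open>l\<close>, of the convex function with slopes \<open>g\<close>. Truncating at
  \<open>x0\<close> keeps the mean decrease finite when the off-period has infinite mean and leaves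
  only shifts of \<open>G\<close> by at most \<open>x0\<close> to control.\<close>

lemma lyapunov_slope:
  fixes H :: "nat \<Rightarrow> real"
  assumes H: "\<And>s. H s \<ge> 0" and x0: "suminf T < (\<Sum>s<x0. H s)" and eta: "eta > 0"
  shows "eventually (\<lambda>K. \<exists>g. mono g \<and> (\<forall>j. 0 \<le> g j) \<and>
    (\<forall>l\<le>K. (\<Sum>s<K-l. g (l + s) * T s) - (\<Sum>s<l. g (l - Suc s) * H s) \<le> (1 + eta) * G K - G (K - l)))
    sequentially"
proof -
  define a where "a = suminf T"
  have a: "a > 0" using G_pos[of 0] by (simp add: G_0 a_def)
  define D where "D = (\<Sum>s<x0. H s)"
  \<comment> \<open>The gap is spent in fifths: upward moves get rate \<open>a + d1\<close>,
    downward moves keep \<open>a + 4 * d1\<close> after shifting \<open>G\<close> and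
    \<open>a + 3 * d1\<close> after the loss on the ramp. The surplus \<open>2 * d1\<close> pays for
    the overflow.\<close>
  define d1 where "d1 = (D - a) / 5"
  have d1: "d1 > 0" "D = a + 5 * d1" using x0 by (simp_all add: d1_def D_def a_def field_simps)
  define d2 where "d2 = d1 / D"
  have d2: "d2 > 0" "d2 \<le> 1" "(1 - d2) * D = a + 4 * d1"
    using a d1 by (auto simp: d2_def field_simps)
  obtain u0 where u0: "\<And>u. u \<ge> u0 \<Longrightarrow> (\<Sum>s<u. G (u - s) * T s) \<le> (a + d1) * G u"
      "\<And>u. u \<ge> u0 \<Longrightarrow> G u * (1 - d2) \<le> G (u + x0)"
    using eventually_conj[OF G_conv[OF d1(1)] G_shift[OF d2(1), of x0]]
    unfolding eventually_sequentially a_def by blast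
  \<comment> \<open>With the argument kept at least \<open>u0\<close>, the convolution and shift
    estimates, valid only eventually for \<open>G\<close>, hold for every \<open>u\<close>.\<close>
  define Gm where "Gm u = G (max u u0)" for u
  have Gm_pos: "Gm u > 0" for u by (simp add: Gm_def G_pos)
  have Gm_mono: "Gm v \<le> Gm u" if "u \<le> v" for u v using that by (auto simp: Gm_def intro: G_mono)
  have Gm_le: "Gm u \<le> G u" for u by (auto simp: Gm_def intro: G_mono)
  have Gm_conv: "(\<Sum>s<u. Gm (u - s) * T s) \<le> (a + d1) * Gm u" for u
  proof (cases "u \<ge> u0")
    case True
    have "(\<Sum>s<u. Gm (u - s) * T s) \<le> (\<Sum>s<u. G (u - s) * T s)"
      using T_pos by (intro sum_mono mult_right_mono Gm_le) (auto intro: less_imp_le)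
    with u0(1)[OF True] True show ?thesis by (simp add: Gm_def max_def)
  next
    case False
    have "(\<Sum>s<u. Gm (u - s) * T s) \<le> (\<Sum>s<u. G u0 * T s)"
      using T_pos by (intro sum_mono mult_right_mono) (auto simp: Gm_def intro: less_imp_le G_mono)
    also have "\<dots> = G u0 * (\<Sum>s<u. T s)" by (simp add: sum_distrib_left)
    also have "\<dots> \<le> G u0 * (a + d1)"
      using G_pos[of u0] T_pos d1 sum_le_suminf[OF T_summable, of "{..<u}"]
      by (intro mult_left_mono) (auto simp: a_def intro: less_imp_le add_increasing2)
    finally show ?thesis using False by (simp add: Gm_def max_def mult.commute)
  qed
  have Gm_shift: "Gm u * (1 - d2) \<le> Gm (u + x0)" for u
  proof -
    have "Gm u * (1 - d2) \<le> G (max u u0 + x0)" unfolding Gm_def by (intro u0(2)) auto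
    also have "\<dots> \<le> Gm (u + x0)" unfolding Gm_def by (intro G_mono) auto
    finally show ?thesis .
  qed
  \<comment> \<open>Chosen so that \<open>B * d1 * Gm u\<close> dominates \<open>G u\<close>
    everywhere: the summand 1 serves \<open>u \<ge> u0\<close>, where \<open>Gm u = G u\<close>; the
    summand \<open>a / G u0\<close> serves \<open>u < u0\<close>, where
    \<open>G u \<le> G 0 = a\<close> and \<open>Gm u = G u0\<close>.\<close>
  define B where "B = 2 / d1 * (1 + a / G u0)"
  have B: "B > 0" using d1 a G_pos[of u0] by (simp add: B_def add_pos_pos)
  have B_G: "G u \<le> B * d1 * Gm u" for u
  proof (cases "u \<ge> u0")
    case True
    have "1 * G u \<le> B * d1 * G u"
      using d1 a G_pos[of u0] G_pos[of u] by (intro mult_right_mono) (auto simp: B_def intro: add_increasing2)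
    with True show ?thesis by (simp add: Gm_def max_def)
  next
    case False
    have "G u \<le> G 0" by (simp add: G_mono)
    also have "\<dots> \<le> 2 * (1 + a / G u0) * G u0"
      using a G_pos[of u0] by (simp add: G_0 a_def field_simps)
    also have "\<dots> = B * d1 * Gm u" using False d1 by (simp add: B_def Gm_def max_def)
    finally show ?thesis .
  qed
  define e where "e = min eta 1"
  have e: "e > 0" "e \<le> 1" "e \<le> eta" using eta by (auto simp: e_def)
  define eps where "eps = e / (12 * B)"
  have eps: "eps > 0" using e B by (simp add: eps_def)
  obtain m where m: "G m \<le> eps"
    using order_tendstoD(2)[OF G_tendsto_0 eps] by (auto simp: eventually_sequentially intro: less_imp_le)
  obtain u2 where u2: "\<And>u. u \<ge> u2 \<Longrightarrow> (\<Sum>s<u. G (u - s) * T s) \<le> (a + eps) * G u"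
    using G_conv[OF eps] unfolding eventually_sequentially a_def by blast
  \<comment> \<open>\<open>c / real l1\<close> is the total error due to the ramp: jumps shorter
    than \<open>m\<close> climb by at most \<open>m / l1\<close>, and drops of at most
    \<open>x0\<close> lose at most \<open>x0 / l1\<close>.\<close>
  define c where "c = real m * (a + d1) + real x0 * (a + 4 * d1)"
  have c: "c \<ge> 0" using a d1 by (simp add: c_def)
  obtain l1 :: nat where l1: "real l1 > 1 + c * (6 * B / e) + c / d1"
    using reals_Archimedean2 by blast
  have t1: "c * (6 * B / e) \<ge> 0" "c / d1 \<ge> 0" using c B e d1 by auto
  have l1': "real l1 > 0" "c / real l1 \<le> e / (6 * B)" "real x0 * (a + 4 * d1) / real l1 \<le> d1"
  proof -
    show l1p: "real l1 > 0" using l1 t1 by linarith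
    have "c * (6 * B / e) \<le> real l1" using l1 t1 by linarith
    then show "c / real l1 \<le> e / (6 * B)" using l1p B e by (simp add: field_simps)
    have "c / d1 \<le> real l1" using l1 t1 by linarith
    then have "c \<le> d1 * real l1" using d1 by (simp add: field_simps)
    moreover have "real x0 * (a + 4 * d1) \<le> c" using a d1 by (simp add: c_def)
    ultimately show "real x0 * (a + 4 * d1) / real l1 \<le> d1" using l1p by (simp add: field_simps)
  qed
  obtain u3 where u3: "\<And>u. u \<ge> u3 \<Longrightarrow> G u * (1 - e / 6) \<le> G (u + l1)"
    using G_shift[of "e/6" l1] e unfolding eventually_sequentially by auto
  \<comment> \<open>The ramp is concave and vanishes at 0, hence subadditive. This lets the slope at
    \<open>l + s\<close> be split into a part compensated by the off-period and a part due to the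
    jump alone.\<close>
  define th where "th j = min (real j / real l1) 1" for j :: nat
  have th: "th j \<ge> 0" "th j \<le> 1" "th j \<le> real j / real l1" for j by (auto simp: th_def)
  have th0: "th 0 = 0" by (simp add: th_def)
  have th_mono: "th i \<le> th j" if "i \<le> j" for i j
    using that by (auto simp: th_def min_le_iff_disj divide_right_mono)
  have th_add: "th (i + j) \<le> th i + th j" for i j
  proof -
    have "real i / real l1 \<ge> 0" "real j / real l1 \<ge> 0" by auto
    then show ?thesis unfolding th_def of_nat_add add_divide_distrib by linarith
  qed
  have th_diff: "th l - real x0 / real l1 \<le> th (l - s)" if "s \<le> x0" for l s
  proof -
    have "th l \<le> th (l - s) + th s"
      using th_add[of "l - s" s] th_mono[of l "l - s + s"] by linarith
    moreover have "th s \<le> real x0 / real l1"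
      using th(3)[of s] that l1'(1) divide_right_mono[of "real s" "real x0" "real l1"] by simp
    ultimately show ?thesis by linarith
  qed
  show ?thesis unfolding eventually_sequentially
  proof (intro exI[of _ "u0 + u2 + u3 + l1 + m"] allI impI)
    fix K assume K: "K \<ge> u0 + u2 + u3 + l1 + m"
    define g where "g j = B * Gm (K - j) * th j" for j
    have g0: "g j \<ge> 0" for j using B Gm_pos[of "K - j"] th by (simp add: g_def)
    have "mono g"
    proof (rule monoI)
      fix i j :: nat assume "i \<le> j"
      then show "g i \<le> g j" unfolding g_def using B th Gm_pos
        by (intro mult_mono Gm_mono th_mono) (auto intro: less_imp_le diff_le_mono2)
    qed
    moreover have "(\<Sum>s<K-l. g (l + s) * T s) - (\<Sum>s<l. g (l - Suc s) * H s) \<le> (1 + eta) * G K - G (K - l)"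
      if l: "l \<le> K" for l
    proof -
      define u where "u = K - l"
      have down: "B * Gm u * (th l - real x0 / real l1) * (a + 4 * d1) \<le> (\<Sum>s<l. g (l - Suc s) * H s)"
      proof -
        have *: "B * Gm u * (th l - real x0 / real l1) * (1 - d2) \<le> g (l - Suc s)" if "s < x0" for s
        proof (cases "th l - real x0 / real l1 \<ge> 0")
          case True
          have "Gm u * (1 - d2) \<le> Gm (K - (l - Suc s))"
            using Gm_shift[of u] Gm_mono[of "K - (l - Suc s)" "u + x0"] that l by (force simp: u_def)
          then have "B * (Gm u * (1 - d2)) * (th l - real x0 / real l1) \<le> g (l - Suc s)"
            unfolding g_def using B True th_diff[of "Suc s" l] that Gm_pos[of "K - (l - Suc s)"]
            by (intro mult_mono mult_left_mono) auto
          then show ?thesis by (simp add: ac_simps)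
        next
          case False
          then have "(B * Gm u * (1 - d2)) * (th l - real x0 / real l1) \<le> 0"
            using B Gm_pos[of u] d2 by (intro mult_nonneg_nonpos) auto
          then show ?thesis using g0[of "l - Suc s"] by (simp add: ac_simps)
        qed
        have "B * Gm u * (th l - real x0 / real l1) * (a + 4 * d1)
            = (\<Sum>s<x0. B * Gm u * (th l - real x0 / real l1) * (1 - d2) * H s)"
          unfolding d2(3)[symmetric] D_def by (simp add: sum_distrib_left ac_simps)
        also have "\<dots> \<le> (\<Sum>s<x0. g (l - Suc s) * H s)"
          using * H by (intro sum_mono mult_right_mono) auto
        \<comment> \<open>For \<open>l \<le> s\<close> the truncated difference
          \<open>l - Suc s\<close> is 0, and the slope is 0 there. So the sum over
          \<open>s < x0\<close> loses nothing when it is cut off at the empty buffer.\<close>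
        also have "\<dots> = (\<Sum>s\<in>{..<x0} \<inter> {..<l}. g (l - Suc s) * H s)"
        proof (rule sum.mono_neutral_right)
          have "g (l - Suc s) = 0" if "l \<le> s" for s using that by (simp add: g_def th0)
          then show "\<forall>s\<in>{..<x0} - {..<x0} \<inter> {..<l}. g (l - Suc s) * H s = 0"
            by (metis DiffE IntI lessThan_iff mult_zero_left not_less)
        qed auto
        also have "\<dots> \<le> (\<Sum>s<l. g (l - Suc s) * H s)"
          using g0 H by (intro sum_mono2) auto
        finally show ?thesis .
      qed
      have up: "(\<Sum>s<K-l. g (l + s) * T s) = B * (\<Sum>s<u. Gm (u - s) * T s * th (l + s))"
        unfolding u_def sum_distrib_left g_def by (intro sum.cong) auto
      show ?thesis
      proof (cases "l \<ge> l1")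
        \<comment> \<open>At full slope the drift is at most \<open>- 2 * B * d1 * Gm u\<close>,
          which is below \<open>- G u\<close> by the choice of \<open>B\<close>.\<close>
        case True
        then have thl: "th l = 1" using l1'(1) by (simp add: th_def)
        have "(\<Sum>s<u. Gm (u - s) * T s * th (l + s)) \<le> (\<Sum>s<u. Gm (u - s) * T s * 1)"
          using Gm_pos T_pos th by (intro sum_mono mult_left_mono) (auto intro!: mult_nonneg_nonneg less_imp_le)
        also have "\<dots> \<le> (a + d1) * Gm u" using Gm_conv[of u] by simp
        finally have "(\<Sum>s<K-l. g (l + s) * T s) \<le> B * ((a + d1) * Gm u)"
          unfolding up using B by (intro mult_left_mono) auto
        moreover have "B * Gm u * (a + 3 * d1) \<le> B * Gm u * (th l - real x0 / real l1) * (a + 4 * d1)"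
        proof -
          have "(1 - real x0 / real l1) * (a + 4 * d1) = (a + 4 * d1) - real x0 * (a + 4 * d1) / real l1"
            by (simp add: algebra_simps add_divide_distrib)
          moreover have "a + 3 * d1 \<le> (a + 4 * d1) - q" if "q \<le> d1" for q using that by simp
          from this[OF l1'(3)] have "a + 3 * d1 \<le> (a + 4 * d1) - real x0 * (a + 4 * d1) / real l1" .
          ultimately have "a + 3 * d1 \<le> (1 - real x0 / real l1) * (a + 4 * d1)" by (simp only:)
          then have "B * Gm u * (a + 3 * d1) \<le> B * Gm u * ((1 - real x0 / real l1) * (a + 4 * d1))"
            using B Gm_pos[of u] by (intro mult_left_mono) auto
          then show ?thesis by (simp add: thl ac_simps)
        qed
        ultimately have "(\<Sum>s<K-l. g (l + s) * T s) - (\<Sum>s<l. g (l - Suc s) * H s)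
            \<le> B * ((a + d1) * Gm u) - B * Gm u * (a + 3 * d1)" using down by linarith
        also have "\<dots> = - (2 * (B * d1 * Gm u))" by (simp add: algebra_simps)
        also have "\<dots> \<le> - G u" using B_G[of u] G_pos[of u] by linarith
        also have "\<dots> \<le> (1 + eta) * G K - G u" using eta G_pos[of K] by simp
        finally show ?thesis by (simp add: u_def)
      next
        case False
        then have u: "u \<ge> u0" "u \<ge> u2" "u \<ge> m" "K - l1 \<ge> u3" "u \<ge> K - l1" "K - l1 + l1 = K" using K by (auto simp: u_def)
        have Gmu: "Gm u = G u" using u by (simp add: Gm_def max_def)
        \<comment> \<open>The whole convolution is at most \<open>(a + eps) * G u\<close>, and its
          first \<open>m\<close> terms already account for \<open>(a - eps) * G u\<close>, because
          \<open>G (u - s) \<ge> G u\<close> and \<open>T\<close> has mass at most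
          \<open>eps\<close> beyond \<open>m\<close>.\<close>
        have s1: "(\<Sum>s\<in>{m..<u}. G (u - s) * T s) \<le> 2 * eps * G u"
        proof -
          have "G u * (a - eps) \<le> G u * (\<Sum>s<m. T s)"
            using G_split[of 0 m] m G_pos[of u] by (intro mult_left_mono) (auto simp: G_0 a_def)
          also have "\<dots> \<le> (\<Sum>s<m. G (u - s) * T s)"
            unfolding sum_distrib_left using T_pos
            by (intro sum_mono mult_right_mono G_mono) (auto intro: less_imp_le)
          finally have "G u * (a - eps) \<le> (\<Sum>s<m. G (u - s) * T s)" .
          moreover have "(\<Sum>s<u. G (u - s) * T s) = (\<Sum>s<m. G (u - s) * T s) + (\<Sum>s\<in>{m..<u}. G (u - s) * T s)"
            using u by (simp add: lessThan_atLeast0 sum.atLeastLessThan_concat)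
          ultimately show ?thesis using u2[OF u(2)] by (simp add: algebra_simps)
        qed
        have s2: "(\<Sum>s<u. Gm (u - s) * T s * th s) \<le> real m / real l1 * ((a + d1) * G u) + 2 * eps * G u"
        proof -
          have "(\<Sum>s<u. Gm (u - s) * T s * th s) \<le>
              (\<Sum>s<u. real m / real l1 * (G (u - s) * T s) + (if s < m then 0 else G (u - s) * T s))"
          proof (rule sum_mono)
            fix s
            have p: "G (u - s) * T s \<ge> 0" using G_pos[of "u-s"] T_pos[of s] by simp
            have "Gm (u - s) * T s * th s \<le> G (u - s) * T s * th s"
              using T_pos[of s] th[of s] Gm_le[of "u-s"] by (intro mult_right_mono) auto
            also have "\<dots> \<le> real m / real l1 * (G (u - s) * T s) + (if s < m then 0 else G (u - s) * T s)"
            proof (cases "s < m")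
              case True
              have "th s \<le> real m / real l1"
                using th(3)[of s] True l1'(1) divide_right_mono[of "real s" "real m" "real l1"] by simp
              then have "G (u - s) * T s * th s \<le> G (u - s) * T s * (real m / real l1)"
                using p by (intro mult_left_mono) auto
              then show ?thesis using True by (simp add: ac_simps)
            next
              case False
              have "G (u - s) * T s * th s \<le> G (u - s) * T s * 1"
                using p th[of s] by (intro mult_left_mono) auto
              moreover have "real m / real l1 * (G (u - s) * T s) \<ge> 0" using p by auto
              ultimately show ?thesis using False by simp
            qed
            finally show "Gm (u - s) * T s * th s \<le> real m / real l1 * (G (u - s) * T s) + (if s < m then 0 else G (u - s) * T s)" .
          qed
          also have "\<dots> = real m / real l1 * (\<Sum>s<u. G (u - s) * T s) + (\<Sum>s<u. if s < m then 0 else G (u - s) * T s)"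
            by (simp add: sum.distrib sum_distrib_left)
          also have "(\<Sum>s<u. if s < m then 0 else G (u - s) * T s) = (\<Sum>s\<in>{m..<u}. G (u - s) * T s)"
            by (rule sum.mono_neutral_cong_right) auto
          also have "real m / real l1 * (\<Sum>s<u. G (u - s) * T s) \<le> real m / real l1 * ((a + d1) * G u)"
            using u0(1)[OF u(1)] by (intro mult_left_mono) auto
          finally show ?thesis using s1 by linarith
        qed
        \<comment> \<open>The \<open>th l\<close> part is outweighed by the downward drift at the
          same level. The \<open>th s\<close> part is small: short jumps have small
          \<open>th s\<close>, and long ones are covered by \<open>s1\<close>.\<close>
        have "(\<Sum>s<u. Gm (u - s) * T s * th (l + s)) \<le> (\<Sum>s<u. Gm (u - s) * T s * (th l + th s))"
          using Gm_pos T_pos th_add by (intro sum_mono mult_left_mono) (auto intro!: mult_nonneg_nonneg less_imp_le)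
        also have "\<dots> = th l * (\<Sum>s<u. Gm (u - s) * T s) + (\<Sum>s<u. Gm (u - s) * T s * th s)"
          by (simp add: distrib_left sum.distrib sum_distrib_left ac_simps)
        also have "\<dots> \<le> th l * ((a + d1) * Gm u) + (real m / real l1 * ((a + d1) * G u) + 2 * eps * G u)"
          using s2 Gm_conv[of u] th[of l] by (intro add_mono mult_left_mono) auto
        finally have "(\<Sum>s<K-l. g (l + s) * T s) \<le>
            B * (th l * ((a + d1) * G u) + (real m / real l1 * ((a + d1) * G u) + 2 * eps * G u))"
          unfolding up Gmu using B by (intro mult_left_mono) auto
        then have "(\<Sum>s<K-l. g (l + s) * T s) - (\<Sum>s<l. g (l - Suc s) * H s) \<le>
            B * (th l * ((a + d1) * G u) + (real m / real l1 * ((a + d1) * G u) + 2 * eps * G u))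
            - B * G u * (th l - real x0 / real l1) * (a + 4 * d1)"
          using down unfolding Gmu by linarith
        also have "\<dots> = B * G u * (c / real l1 + 2 * eps) - B * G u * th l * (3 * d1)"
          by (simp add: c_def algebra_simps add_divide_distrib)
        also have "\<dots> \<le> B * G u * (e / (6 * B) + 2 * eps)"
        proof -
          have "B * G u * (c / real l1 + 2 * eps) \<le> B * G u * (e / (6 * B) + 2 * eps)"
            using B G_pos[of u] l1'(2) by (intro mult_left_mono) auto
          moreover have "B * G u * th l * (3 * d1) \<ge> 0" using B G_pos[of u] th[of l] d1 by simp
          ultimately show ?thesis by linarith
        qed
        also have "\<dots> = e / 3 * G u" using B by (simp add: eps_def field_simps)
        finally have main: "(\<Sum>s<K-l. g (l + s) * T s) - (\<Sum>s<l. g (l - Suc s) * H s) \<le> e / 3 * G u" .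
        have "G u \<le> (1 + e / 3) * G K"
        proof -
          have "G u * (1 - e/6) \<le> G (K - l1) * (1 - e/6)"
            using u e by (intro mult_right_mono G_mono) auto
          also have "\<dots> \<le> G K" using u3[OF u(4)] u(6) by simp
          finally have "(1 + e/3) * (G u * (1 - e/6)) \<le> (1 + e/3) * G K"
            using e by (intro mult_left_mono) auto
          moreover have "(1 + e/3) * (1 - e/6) \<ge> 1"
          proof -
            have "e * e \<le> e" using e by (simp add: mult_left_le)
            then show ?thesis using e by (simp add: algebra_simps)
          qed
          then have "G u * 1 \<le> G u * ((1 + e/3) * (1 - e/6))" using G_pos[of u] by (intro mult_left_mono) auto
          ultimately show ?thesis by (simp add: ac_simps)
        qed
        then have "(1 + e/3) * G u \<le> (1 + e/3) * ((1 + e/3) * G K)" using e by (intro mult_left_mono) auto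
        also have "\<dots> \<le> (1 + eta) * G K"
        proof -
          have "e * e \<le> e" using e by (simp add: mult_left_le)
          moreover have "(1 + e/3) * (1 + e/3) = 1 + 2 * e / 3 + e * e / 9" by (simp add: algebra_simps)
          ultimately have "(1 + e/3) * (1 + e/3) \<le> 1 + eta" using e by linarith
          then have "(1 + e/3) * (1 + e/3) * G K \<le> (1 + eta) * G K" using G_pos[of K] by (intro mult_right_mono) auto
          then show ?thesis by (simp add: ac_simps)
        qed
        finally have "(1 + e/3) * G u \<le> (1 + eta) * G K" .
        with main show ?thesis unfolding u_def[symmetric] by (simp add: algebra_simps)
      qed
    qed
    ultimately show "\<exists>g. mono g \<and> (\<forall>j. 0 \<le> g j) \<and> (\<forall>l\<le>K. (\<Sum>s<K-l. g (l + s) * T s)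
        - (\<Sum>s<l. g (l - Suc s) * H s) \<le> (1 + eta) * G K - G (K - l))"
      using g0 by blast
  qed
qed

end

section \<open>Integer-valued variables and the stationary finite-buffer chain\<close>

context prob_space begin

definition tail_prob :: "('a \<Rightarrow> nat) \<Rightarrow> nat \<Rightarrow> real" where
  "tail_prob X n = prob {\<omega> \<in> space M. n < X \<omega>}"

lemma tail_prob_sums:
  assumes [measurable]: "X \<in> measurable M (count_space UNIV)"
    and int: "integrable M (\<lambda>\<omega>. real (X \<omega>))"
  shows "(\<lambda>k. tail_prob X (n + k)) sums (\<integral>\<omega>. real (X \<omega> - n) \<partial>M)"
proof -
  have i: "integrable M (\<lambda>\<omega>. real (X \<omega> - n))"
    by (rule Bochner_Integration.integrable_bound[OF int]) auto
  have "ennreal (\<integral>\<omega>. real (X \<omega> - n) \<partial>M) = (\<integral>\<^sup>+\<omega>. ennreal (real (X \<omega> - n)) \<partial>M)"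
    by (rule nn_integral_eq_integral[symmetric, OF i]) auto
  also have "\<dots> = (\<integral>\<^sup>+\<omega>. of_nat (X \<omega> - n) \<partial>M)" by (simp add: ennreal_of_nat_eq_real_of_nat)
  also have "\<dots> = (\<Sum>t. emeasure M {\<omega> \<in> space M. t < X \<omega> - n})"
    by (rule nn_integral_nat_function) measurable
  also have "\<dots> = (\<Sum>t. ennreal (tail_prob X (n + t)))"
    by (intro suminf_cong) (auto simp: tail_prob_def emeasure_eq_measure intro!: arg_cong[where f = prob])
  finally have "(\<Sum>t. ennreal (tail_prob X (n + t))) = ennreal (\<integral>\<omega>. real (X \<omega> - n) \<partial>M)" by simp
  note eq = this
  have nn: "tail_prob X k \<ge> 0" for k by (simp add: tail_prob_def)
  have sm: "summable (\<lambda>k. tail_prob X (n + k))"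
    by (rule summable_suminf_not_top) (use nn eq in auto)
  have "ennreal (\<Sum>k. tail_prob X (n + k)) = ennreal (\<integral>\<omega>. real (X \<omega> - n) \<partial>M)"
    using suminf_ennreal2[OF nn sm] eq by simp
  then have "(\<Sum>k. tail_prob X (n + k)) = (\<integral>\<omega>. real (X \<omega> - n) \<partial>M)"
    by (subst (asm) ennreal_inj) (auto intro!: suminf_nonneg sm nn)
  with sm show ?thesis by (simp add: sums_iff)
qed

lemma tailsum_tail_prob:
  assumes "X \<in> measurable M (count_space UNIV)" "integrable M (\<lambda>\<omega>. real (X \<omega>))"
  shows "tailsum (tail_prob X) n = (\<integral>\<omega>. real (X \<omega> - n) \<partial>M)"
  unfolding tailsum_def using tail_prob_sums[OF assms, of n] by (rule sums_unique[symmetric])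

lemma tail_prob_antimono: "X \<in> measurable M (count_space UNIV) \<Longrightarrow> m \<le> n \<Longrightarrow> tail_prob X n \<le> tail_prob X m"
  unfolding tail_prob_def by (intro finite_measure_mono) (auto simp: pred_def)

text \<open>The mean may be infinite, so it enters as a nonnegative integral. The lemma supplies the
  level at which the off-period can be truncated while its mean still exceeds that of the
  input.\<close>

lemma tail_prob_partial_sum:
  assumes [measurable]: "X \<in> measurable M (count_space UNIV)"
    and less: "ennreal c < (\<integral>\<^sup>+\<omega>. ennreal (real (X \<omega>)) \<partial>M)"
  shows "\<exists>n. c < (\<Sum>s<n. tail_prob X s)"
proof (rule ccontr)
  assume "\<not> ?thesis"
  then have le: "(\<Sum>s<n. tail_prob X s) \<le> c" for n by (auto simp: not_less)
  have "(\<integral>\<^sup>+\<omega>. ennreal (real (X \<omega>)) \<partial>M) = (\<integral>\<^sup>+\<omega>. of_nat (X \<omega>) \<partial>M)"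
    by (simp add: ennreal_of_nat_eq_real_of_nat)
  also have "\<dots> = (\<Sum>t. emeasure M {\<omega> \<in> space M. t < X \<omega>})"
    by (rule nn_integral_nat_function) measurable
  also have "\<dots> = (\<Sum>t. ennreal (tail_prob X t))"
    by (intro suminf_cong) (auto simp: tail_prob_def emeasure_eq_measure)
  finally have "(\<integral>\<^sup>+\<omega>. ennreal (real (X \<omega>)) \<partial>M) = (\<Sum>t. ennreal (tail_prob X t))" .
  also have "(\<Sum>t. ennreal (tail_prob X t)) \<le> ennreal c"
  proof (rule suminf_le_const)
    fix n show "(\<Sum>t<n. ennreal (tail_prob X t)) \<le> ennreal c"
      using le[of n] by (subst sum_ennreal) (auto simp: tail_prob_def intro: ennreal_leI)
  qed auto
  finally show False using less by simp
qed

end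

text \<open>The test function with prescribed increments; it is convex exactly when \<open>g\<close>
  is monotone.\<close>

definition slope_fun :: "(nat \<Rightarrow> real) \<Rightarrow> nat \<Rightarrow> real" where "slope_fun g l = (\<Sum>j<l. g j)"

lemma slope_fun_add: "slope_fun g (l + n) = slope_fun g l + (\<Sum>s<n. g (l + s))"
  by (induction n) (simp_all add: slope_fun_def)

lemma slope_fun_diff: "n \<le> l \<Longrightarrow> slope_fun g l = slope_fun g (l - n) + (\<Sum>s<n. g (l - Suc s))"
proof (induction n)
  case (Suc n)
  have "slope_fun g (l - n) = slope_fun g (Suc (l - Suc n))" using Suc.prems by (simp add: Suc_diff_Suc)
  with Suc show ?case by (simp add: slope_fun_def)
qed simp

text \<open>The drop of an off-period starts from \<open>min (l + a) K\<close>, which is at least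
  \<open>l\<close>. By convexity the slopes met from there are at least those met from
  \<open>l\<close>, and starting higher only lets more of the off-period be used. The resulting
  bound separates the input from the off-period, so only their marginal tails enter the
  expectation.\<close>

lemma slope_fun_step:
  assumes g: "mono g" "\<And>j. 0 \<le> g j" and l: "l \<le> K"
  shows "slope_fun g (min (l + a) K - i) - slope_fun g l
     \<le> (\<Sum>s<K-l. g (l + s) * of_bool (s < a)) - (\<Sum>s<l. g (l - Suc s) * of_bool (s < i))"
proof -
  define y where "y = min (l + a) K"
  have y: "y = l + min a (K - l)" using l by (auto simp: y_def)
  have b: "(\<Sum>s<n. h s * of_bool (s < k)) = (\<Sum>s<min k n. h s)" for h :: "nat \<Rightarrow> real" and n k
    by (rule sum.mono_neutral_cong_right) auto
  have "slope_fun g (y - i) = slope_fun g y - (\<Sum>s<min i y. g (y - Suc s))"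
    using slope_fun_diff[of "min i y" y g] by (simp add: min_def split: if_splits)
  moreover have "(\<Sum>s<min i l. g (l - Suc s)) \<le> (\<Sum>s<min i y. g (y - Suc s))"
  proof -
    have "(\<Sum>s<min i l. g (l - Suc s)) \<le> (\<Sum>s<min i l. g (y - Suc s))"
      using y by (intro sum_mono monoD[OF g(1)]) auto
    also have "\<dots> \<le> (\<Sum>s<min i y. g (y - Suc s))"
      using y g by (intro sum_mono2) auto
    finally show ?thesis .
  qed
  moreover have "slope_fun g y = slope_fun g l + (\<Sum>s<min a (K - l). g (l + s))"
    unfolding y by (rule slope_fun_add)
  ultimately show ?thesis unfolding y_def[symmetric] b by linarith
qed

context prob_space begin

text \<open>Under the stationary law the mean increment of any function on \<open>{..K}\<close> is
  0; each conditional increment is then replaced by its upper bound.\<close>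

lemma stationary_drift:
  fixes X I :: "'a \<Rightarrow> nat"
  assumes [measurable]: "X \<in> measurable M (count_space UNIV)" "I \<in> measurable M (count_space UNIV)"
    and st: "stat_dist (qtrans M (\<lambda>\<omega>. int (X \<omega>)) I K) K p"
    and g: "mono g" "\<And>j. 0 \<le> g j"
  shows "0 \<le> (\<Sum>l\<le>K. p l * ((\<Sum>s<K-l. g (l + s) * tail_prob X s) - (\<Sum>s<l. g (l - Suc s) * tail_prob I s)))"
proof -
  define f where "f = slope_fun g"
  define nx where "nx l \<omega> = min (l + X \<omega>) K - I \<omega>" for l \<omega>
  have [measurable]: "nx l \<in> measurable M (count_space UNIV)" for l unfolding nx_def by measurable
  have P: "qtrans M (\<lambda>\<omega>. int (X \<omega>)) I K l j = prob {\<omega> \<in> space M. nx l \<omega> = j}" for l j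
  proof -
    have "nat (min (int l + int (X \<omega>)) (int K) - int (I \<omega>)) = nx l \<omega>" for \<omega>
      by (auto simp: nx_def min_def)
    then show ?thesis by (simp add: qtrans_def)
  qed
  have p: "\<And>l. l \<le> K \<Longrightarrow> p l \<ge> 0" "\<And>j. j \<le> K \<Longrightarrow> p j = (\<Sum>l\<le>K. p l * prob {\<omega> \<in> space M. nx l \<omega> = j})"
    using st unfolding stat_dist_def P by blast+
  have ind: "integrable M (\<lambda>\<omega>. of_bool (Q \<omega>) :: real)" "(\<integral>\<omega>. of_bool (Q \<omega>) \<partial>M) = prob {\<omega> \<in> space M. Q \<omega>}"
    if [measurable]: "Measurable.pred M Q" for Q
  proof -
    have *: "of_bool (Q \<omega>) = indicator {\<omega> \<in> space M. Q \<omega>} \<omega>" if "\<omega> \<in> space M" for \<omega>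
      using that by (auto simp: indicator_def)
    show "integrable M (\<lambda>\<omega>. of_bool (Q \<omega>) :: real)"
      by (subst Bochner_Integration.integrable_cong[OF refl *])
        (auto intro!: integrable_real_indicator simp: emeasure_eq_measure)
    show "(\<integral>\<omega>. of_bool (Q \<omega>) \<partial>M) = prob {\<omega> \<in> space M. Q \<omega>}"
      by (subst Bochner_Integration.integral_cong[OF refl *]) (auto intro!: arg_cong[where f = prob])
  qed
  have fx: "f (nx l \<omega>) = (\<Sum>j\<le>K. f j * of_bool (nx l \<omega> = j))" for l \<omega>
  proof -
    have "nx l \<omega> \<le> K" by (simp add: nx_def)
    then have "{j \<in> {..K}. nx l \<omega> = j} = {nx l \<omega>}" by auto
    then have "(\<Sum>j\<le>K. f j * of_bool (nx l \<omega> = j)) = (\<Sum>j\<in>{nx l \<omega>}. f j * of_bool (nx l \<omega> = j))"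
      by (intro sum.mono_neutral_right) auto
    then show ?thesis by simp
  qed
  have i1: "integrable M (\<lambda>\<omega>. f (nx l \<omega>))" for l
    unfolding fx by (intro Bochner_Integration.integrable_sum integrable_mult_right ind) measurable
  have e1: "(\<integral>\<omega>. f (nx l \<omega>) \<partial>M) = (\<Sum>j\<le>K. f j * prob {\<omega> \<in> space M. nx l \<omega> = j})" for l
    unfolding fx by (subst Bochner_Integration.integral_sum) (auto intro!: integrable_mult_right ind sum.cong simp: ind)
  have lin: "integrable M (\<lambda>\<omega>. \<Sum>s<n. h s * of_bool (s < Z \<omega>))"
     "(\<integral>\<omega>. (\<Sum>s<n. h s * of_bool (s < Z \<omega>)) \<partial>M) = (\<Sum>s<n. h s * tail_prob Z s)"
    if [measurable]: "Z \<in> measurable M (count_space UNIV)" for h :: "nat \<Rightarrow> real" and n Z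
  proof -
    have *: "integrable M (\<lambda>\<omega>. h s * of_bool (s < Z \<omega>))" for s
      by (intro integrable_mult_right ind) measurable
    then show "integrable M (\<lambda>\<omega>. \<Sum>s<n. h s * of_bool (s < Z \<omega>))"
      by (rule Bochner_Integration.integrable_sum)
    have "(\<integral>\<omega>. of_bool (s < Z \<omega>) \<partial>M) = tail_prob Z s" for s
      unfolding tail_prob_def by (rule ind(2)) measurable
    then show "(\<integral>\<omega>. (\<Sum>s<n. h s * of_bool (s < Z \<omega>)) \<partial>M) = (\<Sum>s<n. h s * tail_prob Z s)"
      by (subst Bochner_Integration.integral_sum[OF *]) simp
  qed
  have step: "(\<integral>\<omega>. f (nx l \<omega>) \<partial>M) - f l \<le>
      (\<Sum>s<K-l. g (l + s) * tail_prob X s) - (\<Sum>s<l. g (l - Suc s) * tail_prob I s)" if l: "l \<le> K" for l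
  proof -
    have "(\<integral>\<omega>. f (nx l \<omega>) \<partial>M) - f l = (\<integral>\<omega>. f (nx l \<omega>) - f l \<partial>M)"
      using i1 by (simp add: prob_space)
    also have "\<dots> \<le> (\<integral>\<omega>. (\<Sum>s<K-l. g (l + s) * of_bool (s < X \<omega>)) - (\<Sum>s<l. g (l - Suc s) * of_bool (s < I \<omega>)) \<partial>M)"
    proof (rule integral_mono)
      show "f (nx l \<omega>) - f l \<le> (\<Sum>s<K-l. g (l + s) * of_bool (s < X \<omega>)) - (\<Sum>s<l. g (l - Suc s) * of_bool (s < I \<omega>))" for \<omega>
        unfolding f_def nx_def by (rule slope_fun_step[OF g l])
    qed (intro Bochner_Integration.integrable_diff integrable_const lin i1 assms)+
    also have "\<dots> = (\<Sum>s<K-l. g (l + s) * tail_prob X s) - (\<Sum>s<l. g (l - Suc s) * tail_prob I s)"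
      unfolding Bochner_Integration.integral_diff[OF lin(1)[OF assms(1)] lin(1)[OF assms(2)]]
        lin(2)[OF assms(1)] lin(2)[OF assms(2)] ..
    finally show ?thesis .
  qed
  have "(\<Sum>l\<le>K. p l * (\<integral>\<omega>. f (nx l \<omega>) \<partial>M)) = (\<Sum>j\<le>K. f j * (\<Sum>l\<le>K. p l * prob {\<omega> \<in> space M. nx l \<omega> = j}))"
    unfolding e1 sum_distrib_left by (subst sum.swap) (simp add: ac_simps)
  also have "\<dots> = (\<Sum>j\<le>K. f j * p j)" using p(2) by simp
  finally have "0 = (\<Sum>l\<le>K. p l * ((\<integral>\<omega>. f (nx l \<omega>) \<partial>M) - f l))"
    by (simp add: right_diff_distrib sum_subtractf mult.commute)
  also have "\<dots> \<le> (\<Sum>l\<le>K. p l * ((\<Sum>s<K-l. g (l + s) * tail_prob X s) - (\<Sum>s<l. g (l - Suc s) * tail_prob I s)))"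
    using p(1) step by (intro sum_mono mult_left_mono) auto
  finally show ?thesis .
qed

theorem overflow_asymp:
  fixes X I :: "'a \<Rightarrow> nat"
  assumes meas[measurable]: "X \<in> measurable M (count_space UNIV)" "I \<in> measurable M (count_space UNIV)"
    and int: "integrable M (\<lambda>\<omega>. real (X \<omega>))"
    and less: "(\<integral>\<^sup>+\<omega>. ennreal (real (X \<omega>)) \<partial>M) < (\<integral>\<^sup>+\<omega>. ennreal (real (I \<omega>)) \<partial>M)"
    and st: "\<And>K. stat_dist (qtrans M (\<lambda>\<omega>. int (X \<omega>)) I K) K (p K)"
    and pos: "\<And>n. tail_prob X n > 0"
    and dom: "\<exists>C. eventually (\<lambda>n. tail_prob X n \<le> C * tail_prob X (2 * n)) sequentially"
  shows "(\<lambda>K. \<Sum>l\<le>K. p K l * tailsum (tail_prob X) (K - l)) \<sim>[at_top] tailsum (tail_prob X)"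
proof -
  interpret dominated_tail "tail_prob X"
    using pos dom tail_prob_sums[OF meas(1) int, of 0] tail_prob_antimono[OF meas(1)]
    by unfold_locales (auto simp: antimono_def summable_def)
  let ?R = "\<lambda>K. \<Sum>l\<le>K. p K l * G (K - l)"
  have p: "\<And>K l. l \<le> K \<Longrightarrow> p K l \<ge> 0" "\<And>K. (\<Sum>l\<le>K. p K l) = 1"
    using st unfolding stat_dist_def by blast+
  have lower: "G K \<le> ?R K" for K
  proof -
    have "G K = (\<Sum>l\<le>K. p K l) * G K" by (simp add: p)
    also have "\<dots> \<le> ?R K" unfolding sum_distrib_right
      using p by (intro sum_mono mult_left_mono G_mono) auto
    finally show ?thesis .
  qed
  have mean: "suminf (tail_prob X) = (\<integral>\<omega>. real (X \<omega>) \<partial>M)"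
    using tail_prob_sums[OF meas(1) int, of 0] by (simp add: sums_iff)
  \<comment> \<open>The strict inequality between the means survives truncation of the off-period at
    some finite \<open>x0\<close>.\<close>
  have "ennreal (suminf (tail_prob X)) < (\<integral>\<^sup>+\<omega>. ennreal (real (I \<omega>)) \<partial>M)"
    using less nn_integral_eq_integral[OF int] unfolding mean by simp
  from tail_prob_partial_sum[OF meas(2) this] obtain x0 where x0: "suminf (tail_prob X) < (\<Sum>s<x0. tail_prob I s)" by blast
  have up: "eventually (\<lambda>K. ?R K \<le> (1 + eta) * G K) sequentially" if "eta > 0" for eta
  proof -
    have "\<And>s. tail_prob I s \<ge> 0" by (simp add: tail_prob_def)
    from lyapunov_slope[OF this x0 that] show ?thesis
    proof eventually_elim
      case (elim K)
      then obtain g where g: "mono g" "\<And>j. 0 \<le> g j" and dr: "\<And>l. l \<le> K \<Longrightarrow> (\<Sum>s<K-l. g (l + s) * tail_prob X s)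
         - (\<Sum>s<l. g (l - Suc s) * tail_prob I s) \<le> (1 + eta) * G K - G (K - l)" by blast
      have "0 \<le> (\<Sum>l\<le>K. p K l * ((\<Sum>s<K-l. g (l + s) * tail_prob X s) - (\<Sum>s<l. g (l - Suc s) * tail_prob I s)))"
        by (rule stationary_drift[OF meas st g])
      also have "\<dots> \<le> (\<Sum>l\<le>K. p K l * ((1 + eta) * G K - G (K - l)))"
        using p dr by (intro sum_mono mult_left_mono) auto
      also have "\<dots> = (\<Sum>l\<le>K. p K l) * ((1 + eta) * G K) - ?R K"
        by (simp add: right_diff_distrib sum_subtractf sum_distrib_right)
      finally show ?case using p by simp
    qed
  qed
  have "(\<lambda>K. ?R K / G K) \<longlonglongrightarrow> 1"
  proof (rule order_tendstoI)
    fix y :: real assume "y < 1"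
    have "1 \<le> ?R K / G K" for K using lower[of K] G_pos[of K] by simp
    with \<open>y < 1\<close> show "eventually (\<lambda>K. y < ?R K / G K) sequentially"
      by (intro always_eventually) (auto intro: less_le_trans)
  next
    fix y :: real assume "1 < y"
    then have "(y - 1) / 2 > 0" by simp
    from up[OF this] show "eventually (\<lambda>K. ?R K / G K < y) sequentially"
    proof eventually_elim
      case (elim K)
      then have "?R K / G K \<le> 1 + (y - 1) / 2" using G_pos[of K] by (simp add: field_simps)
      with \<open>1 < y\<close> show ?case by (simp add: field_simps)
    qed
  qed
  then show ?thesis by (rule asymp_equivI')
qed

end

section \<open>Approximate Poisson equation for a finite chain\<close>

locale finite_chain =
  fixes d :: nat and Q :: "nat \<Rightarrow> nat \<Rightarrow> real" and phi :: "nat \<Rightarrow> real"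
  assumes stoch: "stochastic_mat d Q" and irr: "irreducible_mat d Q"
    and phi_prob: "prob_vector d phi"
    and phi_stat: "\<And>j. j < d \<Longrightarrow> phi j = (\<Sum>i<d. phi i * Q i j)"
begin

definition avg :: "(nat \<Rightarrow> real) \<Rightarrow> nat \<Rightarrow> real" where
  "avg f i = (\<Sum>j<d. Q i j * f j)"

lemma Q_nonneg: "i < d \<Longrightarrow> j < d \<Longrightarrow> Q i j \<ge> 0"
  and Q_sum: "i < d \<Longrightarrow> (\<Sum>j<d. Q i j) = 1"
  using stoch by (auto simp: stochastic_mat_def)

lemma phi_nonneg: "i < d \<Longrightarrow> phi i \<ge> 0" and phi_sum: "(\<Sum>i<d. phi i) = 1"
  using phi_prob by (auto simp: prob_vector_def)

lemma avg_sum: "avg (\<lambda>j. \<Sum>k<m. f k j) i = (\<Sum>k<m. avg (f k) i)"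
  unfolding avg_def by (subst sum.swap) (simp add: sum_distrib_left)

lemma avg_mult: "avg (\<lambda>j. c * f j) i = c * avg f i"
  by (simp add: avg_def sum_distrib_left ac_simps)

lemma avg_bound:
  assumes "i < d" "\<And>j. j < d \<Longrightarrow> \<bar>f j\<bar> \<le> R" shows "\<bar>avg f i\<bar> \<le> R"
proof -
  have "\<bar>avg f i\<bar> \<le> (\<Sum>j<d. \<bar>Q i j * f j\<bar>)" unfolding avg_def by (rule sum_abs)
  also have "\<dots> \<le> (\<Sum>j<d. Q i j * R)"
    using assms Q_nonneg by (intro sum_mono) (auto simp: abs_mult intro!: mult_left_mono)
  also have "\<dots> = R" using Q_sum[OF assms(1)] by (simp add: sum_distrib_right[symmetric])
  finally show ?thesis .
qed

lemma avg_pow_bound: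
  assumes "i < d" "\<And>j. j < d \<Longrightarrow> \<bar>f j\<bar> \<le> R" shows "\<bar>(avg ^^ n) f i\<bar> \<le> R"
  using assms(1) by (induction n arbitrary: i) (auto intro: assms(2) avg_bound)

lemma avg_diff: "avg (\<lambda>j. f j - g j) i = avg f i - avg g i"
  by (simp add: avg_def right_diff_distrib sum_subtractf)

lemma avg_pow_diff: "(avg ^^ n) (\<lambda>j. f j - g j) i = (avg ^^ n) f i - (avg ^^ n) g i"
proof (induction n arbitrary: i)
  case (Suc n)
  then have "(avg ^^ n) (\<lambda>j. f j - g j) = (\<lambda>i. (avg ^^ n) f i - (avg ^^ n) g i)" by auto
  then show ?case by (simp add: avg_diff)
qed simp

lemma phi_avg: "(\<Sum>i<d. phi i * avg f i) = (\<Sum>i<d. phi i * f i)"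
proof -
  have "(\<Sum>i<d. phi i * avg f i) = (\<Sum>j<d. \<Sum>i<d. phi i * Q i j * f j)"
    unfolding avg_def sum_distrib_left by (subst sum.swap) (simp add: ac_simps)
  also have "\<dots> = (\<Sum>j<d. phi j * f j)"
    using phi_stat by (intro sum.cong) (auto simp: sum_distrib_right[symmetric])
  finally show ?thesis .
qed

lemma phi_avg_pow: "(\<Sum>i<d. phi i * (avg ^^ n) f i) = (\<Sum>i<d. phi i * f i)"
  by (induction n) (auto simp: phi_avg)

lemma avg_pow_mat: "i < d \<Longrightarrow> (avg ^^ n) f i = (\<Sum>l<d. mat_pow d Q n i l * f l)"
proof (induction n arbitrary: f)
  case 0
  then show ?case by (simp add: if_distrib[where f = "\<lambda>x. x * _"] cong: if_cong)
next
  case (Suc n)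
  have "(avg ^^ Suc n) f i = (\<Sum>l<d. mat_pow d Q n i l * avg f l)"
    using Suc.IH[OF Suc.prems] by (simp add: funpow_swap1)
  also have "\<dots> = (\<Sum>j<d. \<Sum>l<d. mat_pow d Q n i l * Q l j * f j)"
    unfolding avg_def sum_distrib_left by (subst sum.swap) (simp add: ac_simps)
  also have "\<dots> = (\<Sum>j<d. mat_pow d Q (Suc n) i j * f j)"
    by (simp add: sum_distrib_right)
  finally show ?case .
qed

lemma mat_pow_nonneg: "i < d \<Longrightarrow> j < d \<Longrightarrow> mat_pow d Q n i j \<ge> 0"
  by (induction n arbitrary: j) (auto intro!: sum_nonneg mult_nonneg_nonneg Q_nonneg)

lemma mat_pow_sum: "i < d \<Longrightarrow> (\<Sum>j<d. mat_pow d Q n i j) = 1"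
proof (induction n)
  case (Suc n)
  have "(\<Sum>j<d. mat_pow d Q (Suc n) i j) = (\<Sum>l<d. mat_pow d Q n i l * (\<Sum>j<d. Q l j))"
    unfolding mat_pow.simps sum_distrib_left by (rule sum.swap)
  also have "\<dots> = 1" using Suc by (simp add: Q_sum)
  finally show ?case .
qed simp

text \<open>Averaging does not increase the supremum norm, so each of the \<open>n\<close>
  telescoping differences is at most \<open>\<delta>\<close>.\<close>

lemma almost_harmonic:
  assumes b: "\<And>i. i < d \<Longrightarrow> \<bar>avg b i - b i\<bar> \<le> \<delta>"
  shows "i < d \<Longrightarrow> \<bar>(avg ^^ n) b i - b i\<bar> \<le> real n * \<delta>"
proof (induction n)
  case (Suc n)
  have "(avg ^^ Suc n) b i - (avg ^^ n) b i = (avg ^^ n) (\<lambda>j. avg b j - b j) i"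
    by (simp add: avg_pow_diff funpow_swap1)
  then have "\<bar>(avg ^^ Suc n) b i - (avg ^^ n) b i\<bar> \<le> \<delta>"
    using avg_pow_bound[where n = n, OF Suc.prems b] by simp
  with Suc show ?case by (simp add: algebra_simps)
qed simp

text \<open>A quantitative maximum principle: the value at a maximiser exceeds its own average by a
  fixed proportion of its excess over any other value.\<close>
lemma almost_harmonic_almost_const:
  obtains C where "C \<ge> 0"
    "\<And>b \<delta> j. (\<And>i. i < d \<Longrightarrow> \<bar>avg b i - b i\<bar> \<le> \<delta>) \<Longrightarrow> j < d \<Longrightarrow> \<bar>b j - (\<Sum>i<d. phi i * b i)\<bar> \<le> C * \<delta>"
proof -
  \<comment> \<open>The number of steps may differ from pair to pair; no common power of the matrix
    has to be positive, so a periodic chain causes no difficulty.\<close>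
  obtain n where n: "\<And>i j. i < d \<Longrightarrow> j < d \<Longrightarrow> mat_pow d Q (n i j) i j > 0"
    using irr unfolding irreducible_mat_def by metis
  define c where "c i j = real (n i j) / mat_pow d Q (n i j) i j" for i j
  have c: "c i j \<ge> 0" if "i < d" "j < d" for i j using n[OF that] by (simp add: c_def)
  define C where "C = (\<Sum>i<d. \<Sum>j<d. c i j)"
  have C: "C \<ge> 0" unfolding C_def using c by (auto intro!: sum_nonneg)
  have cC: "c i j \<le> C" if "i < d" "j < d" for i j
  proof -
    have "c i j \<le> (\<Sum>j<d. c i j)" using that c by (intro member_le_sum) auto
    also have "\<dots> \<le> C" unfolding C_def using that c by (intro member_le_sum sum_nonneg) auto
    finally show ?thesis .
  qed
  have "\<bar>b j - (\<Sum>i<d. phi i * b i)\<bar> \<le> C * \<delta>"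
    if b: "\<And>i. i < d \<Longrightarrow> \<bar>avg b i - b i\<bar> \<le> \<delta>" and j: "j < d" for b \<delta> j
  proof -
    have "finite (b ` {..<d})" "b ` {..<d} \<noteq> {}" using j by auto
    then have "Max (b ` {..<d}) \<in> b ` {..<d}" by (rule Max_in)
    then obtain k where k: "k < d" "b k = Max (b ` {..<d})" by auto
    have mx: "b l \<le> b k" if "l < d" for l using that k by simp
    have \<delta>: "\<delta> \<ge> 0" using b[OF j] by linarith
    have close: "b k - b l \<le> C * \<delta>" if l: "l < d" for l
    proof -
      let ?P = "mat_pow d Q (n k l) k"
      have "?P l * (b k - b l) \<le> (\<Sum>m<d. ?P m * (b k - b m))"
        using l k(1) mx by (intro member_le_sum) (auto intro!: mult_nonneg_nonneg mat_pow_nonneg)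
      also have "\<dots> = b k - (avg ^^ n k l) b k"
        using k(1) by (simp add: avg_pow_mat right_diff_distrib sum_subtractf sum_distrib_right[symmetric] mat_pow_sum)
      also have "\<dots> \<le> real (n k l) * \<delta>"
        using almost_harmonic[where n = "n k l", OF b k(1)] by linarith
      finally have "b k - b l \<le> c k l * \<delta>"
        using n[OF k(1) l] by (simp add: c_def field_simps)
      also have "\<dots> \<le> C * \<delta>" using cC[OF k(1) l] \<delta> by (rule mult_right_mono)
      finally show ?thesis .
    qed
    have "(\<Sum>i<d. phi i * b i) \<le> (\<Sum>i<d. phi i * b k)"
      using mx phi_nonneg by (intro sum_mono mult_left_mono) auto
    moreover have "(\<Sum>i<d. phi i * (b k - C * \<delta>)) \<le> (\<Sum>i<d. phi i * b i)"
      using close phi_nonneg by (intro sum_mono mult_left_mono) (auto simp: algebra_simps)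
    moreover have "(\<Sum>i<d. phi i * x) = x" for x by (simp add: sum_distrib_right[symmetric] phi_sum)
    ultimately show ?thesis using mx[OF j] close[OF j] by (simp add: abs_le_iff)
  qed
  with C show ?thesis using that by blast
qed

text \<open>The Cesaro mean \<open>b\<close> of the iterates of \<open>r\<close> changes by at most
  \<open>2 * R / m\<close> under one averaging step, hence is nearly constant. Stationarity of
  \<open>phi\<close> identifies the constant as the \<open>phi\<close>-mean of
  \<open>r\<close>.\<close>

lemma approx_poisson:
  assumes e: "e > 0"
  shows "\<exists>v. \<forall>i<d. \<bar>r i + avg v i - v i - (\<Sum>i<d. phi i * r i)\<bar> \<le> e"
proof -
  obtain C where C: "C \<ge> 0"
    "\<And>b \<delta> j. (\<And>i. i < d \<Longrightarrow> \<bar>avg b i - b i\<bar> \<le> \<delta>) \<Longrightarrow> j < d \<Longrightarrow> \<bar>b j - (\<Sum>i<d. phi i * b i)\<bar> \<le> C * \<delta>"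
    by (rule almost_harmonic_almost_const) blast
  define R where "R = (\<Sum>i<d. \<bar>r i\<bar>)"
  have R: "\<bar>r i\<bar> \<le> R" if "i < d" for i unfolding R_def using that by (intro member_le_sum) auto
  have R0: "R \<ge> 0" by (simp add: R_def sum_nonneg)
  obtain m :: nat where m: "real m > 1 + C * (2 * R) / e" using reals_Archimedean2 by blast
  have "C * (2 * R) / e \<ge> 0" using C R0 e by simp
  with m have m0: "real m > 0" "C * (2 * R) / e \<le> real m" by linarith+
  define S where "S k j = (\<Sum>n<k. (avg ^^ n) r j)" for k j
  have avgS: "avg (S k) i - S k i = (avg ^^ k) r i - r i" for k i
  proof -
    have "avg (S k) i = (\<Sum>n<k. (avg ^^ Suc n) r i)"
      unfolding S_def by (subst avg_sum) simp
    then show ?thesis unfolding S_def using sum_lessThan_telescope[of "\<lambda>n. (avg ^^ n) r i" k]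
      by (simp add: sum_subtractf)
  qed
  define b where "b j = 1 / real m * S m j" for j
  \<comment> \<open>Since \<open>avg (S k) - S k\<close> telescopes to the \<open>k\<close>-th
    iterate minus \<open>r\<close>, averaging over \<open>k < m\<close> turns
    \<open>r + avg v - v\<close> into exactly \<open>b\<close>.\<close>
  define v where "v j = 1 / real m * (\<Sum>k<m. S k j)" for j
  have v: "r i + avg v i - v i = b i" for i
  proof -
    have "avg v i - v i = 1 / real m * (\<Sum>k<m. avg (S k) i - S k i)"
      unfolding v_def avg_mult avg_sum by (simp add: sum_subtractf right_diff_distrib)
    also have "\<dots> = 1 / real m * (S m i - real m * r i)"
      unfolding avgS by (simp add: sum_subtractf S_def)
    also have "\<dots> = b i - r i" using m0 by (simp add: b_def right_diff_distrib)
    finally show ?thesis by simp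
  qed
  have "\<bar>avg b i - b i\<bar> \<le> 2 * R / real m" if "i < d" for i
  proof -
    have "avg b i - b i = 1 / real m * ((avg ^^ m) r i - r i)"
      unfolding b_def avg_mult unfolding right_diff_distrib[symmetric] avgS by simp
    moreover have "\<bar>(avg ^^ m) r i - r i\<bar> \<le> 2 * R"
      using avg_pow_bound[where n = m and f = r, OF that R] R[OF that] by linarith
    ultimately show ?thesis using m0 by (simp add: abs_mult divide_right_mono)
  qed
  from C(2)[OF this] have *: "\<bar>b j - (\<Sum>i<d. phi i * b i)\<bar> \<le> C * (2 * R / real m)" if "j < d" for j
    using that by blast
  have "(\<Sum>i<d. phi i * S m i) = (\<Sum>n<m. \<Sum>i<d. phi i * (avg ^^ n) r i)"
    unfolding S_def sum_distrib_left by (rule sum.swap)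
  also have "\<dots> = real m * (\<Sum>i<d. phi i * r i)" by (simp add: phi_avg_pow)
  finally have phib: "(\<Sum>i<d. phi i * b i) = (\<Sum>i<d. phi i * r i)"
    using m0 by (simp add: b_def sum_divide_distrib[symmetric])
  have "C * (2 * R / real m) \<le> e" using m0 e by (simp add: field_simps)
  with * have "\<forall>i<d. \<bar>r i + avg v i - v i - (\<Sum>i<d. phi i * r i)\<bar> \<le> e"
    unfolding v phib by force
  then show ?thesis by blast
qed

end

section \<open>Markov additive arrivals\<close>

text \<open>Decomposition over the atoms of a countably valued variable. It takes the place of
  conditional expectations given the past of the chain.\<close>

lemma nn_integral_partition:
  fixes X :: "'a \<Rightarrow> 'b::countable"
  assumes [measurable]: "X \<in> measurable M (count_space UNIV)" "f \<in> borel_measurable M"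
  shows "(\<integral>\<^sup>+\<omega>. f \<omega> \<partial>M) = (\<integral>\<^sup>+x. (\<integral>\<^sup>+\<omega>. f \<omega> * indicator {\<omega>. X \<omega> = x} \<omega> \<partial>M) \<partial>count_space UNIV)"
proof -
  let ?A = "\<lambda>x. {\<omega> \<in> space M. X \<omega> = x}"
  have "(\<integral>\<^sup>+\<omega>. f \<omega> \<partial>M) = emeasure (density M f) (\<Union>x. ?A x)"
    by (subst emeasure_density) (auto intro!: nn_integral_cong simp: indicator_def)
  also have "\<dots> = (\<integral>\<^sup>+x. emeasure (density M f) (?A x) \<partial>count_space UNIV)"
    by (rule emeasure_UN_countable) (auto simp: disjoint_family_on_def)
  also have "\<dots> = (\<integral>\<^sup>+x. (\<integral>\<^sup>+\<omega>. f \<omega> * indicator {\<omega>. X \<omega> = x} \<omega> \<partial>M) \<partial>count_space UNIV)"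
    by (intro nn_integral_cong) (auto simp: emeasure_density indicator_def intro!: nn_integral_cong)
  finally show ?thesis .
qed

lemma suminf_tail_of_bool:
  fixes f :: "nat \<Rightarrow> real"
  assumes "\<And>k. 0 \<le> f k" "summable (\<lambda>k. f (Suc k))"
  shows "(\<Sum>m. ennreal (f (Suc m)) * of_bool (k < Suc m)) = ennreal (\<Sum>l. f (l + k + 1))"
    and "0 \<le> (\<Sum>l. f (l + k + 1))"
proof -
  have s: "summable (\<lambda>l. f (l + k + 1))"
    using summable_ignore_initial_segment[OF assms(2), of k] by simp
  have "(\<Sum>m. ennreal (f (Suc m)) * of_bool (k < Suc m))
    = (\<Sum>l. ennreal (f (Suc (l + k))) * of_bool (k < Suc (l + k))) + (\<Sum>m<k. ennreal (f (Suc m)) * of_bool (k < Suc m))"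
    by (rule suminf_offset) simp
  also have "\<dots> = (\<Sum>l. ennreal (f (l + k + 1)))" by simp
  also have "\<dots> = ennreal (\<Sum>l. f (l + k + 1))"
    using s assms(1) by (intro suminf_ennreal2) auto
  finally show "(\<Sum>m. ennreal (f (Suc m)) * of_bool (k < Suc m)) = ennreal (\<Sum>l. f (l + k + 1))" .
  show "0 \<le> (\<Sum>l. f (l + k + 1))" using assms(1) by (intro suminf_nonneg s)
qed

text \<open>The arrivals of a single period, with the period index fixed. The sequences run over all
  slots, including those after the end of the period, so that partial sums at deterministic times
  make sense.\<close>

locale bmap = prob_space M for M :: "'a measure" +
  fixes d :: nat and Lam :: "nat \<Rightarrow> nat \<Rightarrow> nat \<Rightarrow> real" and N J :: "nat \<Rightarrow> 'a \<Rightarrow> nat"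
  assumes meas_N[measurable]: "\<And>n. N n \<in> measurable M (count_space UNIV)"
    and meas_J[measurable]: "\<And>n. J n \<in> measurable M (count_space UNIV)"
    and J_range: "\<And>n \<omega>. J n \<omega> < d"
    and N_pos: "\<And>n \<omega>. N n \<omega> \<ge> 1"
    and Lam_nonneg: "\<And>k i j. Lam k i j \<ge> 0"
    and NJ_step: "\<And>n ks js k j. n \<ge> 1 \<Longrightarrow> k \<ge> 1 \<Longrightarrow> j < d \<Longrightarrow> js (n - 1) < d \<Longrightarrow>
        measure M {\<omega> \<in> space M. (\<forall>l<n. N l \<omega> = ks l \<and> J l \<omega> = js l) \<and> N n \<omega> = k \<and> J n \<omega> = j}
        = Lam k (js (n - 1)) j * measure M {\<omega> \<in> space M. \<forall>l<n. N l \<omega> = ks l \<and> J l \<omega> = js l}"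
begin

definition path :: "nat \<Rightarrow> 'a \<Rightarrow> (nat \<times> nat) list" where
  "path n \<omega> = map (\<lambda>l. (N l \<omega>, J l \<omega>)) [0..<n]"

lemma path_Suc: "path (Suc n) \<omega> = path n \<omega> @ [(N n \<omega>, J n \<omega>)]"
  by (simp add: path_def)

lemma path_measurable[measurable]: "path n \<in> measurable M (count_space UNIV)"
proof (induction n)
  case 0
  then show ?case by (simp add: path_def)
next
  case (Suc n)
  note [measurable] = Suc
  show ?case unfolding path_Suc[abs_def] by measurable
qed

lemma path_eq_iff: "path n \<omega> = xs \<longleftrightarrow> length xs = n \<and> (\<forall>l<n. N l \<omega> = fst (xs ! l) \<and> J l \<omega> = snd (xs ! l))"
  by (auto simp: path_def list_eq_iff_nth_eq prod_eq_iff)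

definition kern :: "nat \<Rightarrow> nat \<times> nat \<Rightarrow> ennreal" where
  "kern i kj = (if 1 \<le> fst kj \<and> snd kj < d then ennreal (Lam (fst kj) i (snd kj)) else 0)"

text \<open>The conditional expectation of \<open>h (N n) (J n)\<close> given
  \<open>J (n - 1) = i\<close>. Its values are in \<open>ennreal\<close>, so no integrability has to
  be checked for exponential weights.\<close>

definition step :: "(nat \<Rightarrow> nat \<Rightarrow> ennreal) \<Rightarrow> nat \<Rightarrow> ennreal" where
  "step h i = (\<Sum>j<d. \<Sum>k. ennreal (Lam (Suc k) i j) * h (Suc k) j)"

lemma step_altdef: "step h i = (\<integral>\<^sup>+kj. kern i kj * h (fst kj) (snd kj) \<partial>count_space UNIV)"
proof -
  have "(\<integral>\<^sup>+kj. kern i kj * h (fst kj) (snd kj) \<partial>count_space UNIV)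
      = (\<integral>\<^sup>+j. (\<integral>\<^sup>+k. kern i (k, j) * h k j \<partial>count_space UNIV) \<partial>count_space UNIV)"
    by (subst nn_integral_snd_count_space[symmetric]) simp
  also have "\<dots> = (\<integral>\<^sup>+j. (if j < d then (\<Sum>k. ennreal (Lam (Suc k) i j) * h (Suc k) j) else 0) \<partial>count_space UNIV)"
  proof (intro nn_integral_cong)
    fix j
    have "(\<integral>\<^sup>+k. kern i (k, j) * h k j \<partial>count_space UNIV) = (\<Sum>k. kern i (k, j) * h k j)"
      by (rule nn_integral_count_space_nat)
    also have "\<dots> = (\<Sum>k. kern i (Suc k, j) * h (Suc k) j)"
      using suminf_offset[of "\<lambda>k. kern i (k, j) * h k j" 1] by (simp add: kern_def)
    also have "\<dots> = (if j < d then (\<Sum>k. ennreal (Lam (Suc k) i j) * h (Suc k) j) else 0)"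
      by (simp add: kern_def)
    finally show "(\<integral>\<^sup>+k. kern i (k, j) * h k j \<partial>count_space UNIV) = \<dots>" .
  qed
  also have "\<dots> = step h i"
    unfolding step_def nn_integral_count_space_nat
    by (subst suminf_finite[of "{..<d}"]) auto
  finally show ?thesis ..
qed

text \<open>Off the range covered by \<open>NJ_step\<close> both sides vanish: either
  \<open>xs\<close> is not a possible path, or \<open>kj\<close> is not a possible value and its
  kernel entry is 0.\<close>

lemma emeasure_step:
  assumes n: "n \<ge> 1"
  shows "emeasure M {\<omega> \<in> space M. path n \<omega> = xs \<and> (N n \<omega>, J n \<omega>) = kj}
    = kern (snd (xs ! (n - 1))) kj * emeasure M {\<omega> \<in> space M. path n \<omega> = xs}"
proof (cases "length xs = n \<and> snd (xs ! (n - 1)) < d \<and> 1 \<le> fst kj \<and> snd kj < d")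
  case True
  have "{\<omega> \<in> space M. path n \<omega> = xs \<and> (N n \<omega>, J n \<omega>) = kj} = {\<omega> \<in> space M. (\<forall>l<n. N l \<omega> = fst (xs ! l) \<and> J l \<omega> = snd (xs ! l)) \<and> N n \<omega> = fst kj \<and> J n \<omega> = snd kj}"
    using True by (auto simp: path_eq_iff)
  moreover have "{\<omega> \<in> space M. path n \<omega> = xs} = {\<omega> \<in> space M. \<forall>l<n. N l \<omega> = fst (xs ! l) \<and> J l \<omega> = snd (xs ! l)}"
    using True by (auto simp: path_eq_iff)
  ultimately show ?thesis
    using NJ_step[of n "fst kj" "snd kj" "\<lambda>l. snd (xs ! l)" "\<lambda>l. fst (xs ! l)"] n True
    by (simp add: emeasure_eq_measure kern_def ennreal_mult Lam_nonneg)
next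
  case False
  show ?thesis
  proof (cases "1 \<le> fst kj \<and> snd kj < d")
    case True
    have "path n \<omega> \<noteq> xs" for \<omega>
    proof
      assume p: "path n \<omega> = xs"
      moreover have "n - 1 < n" using n by simp
      ultimately have "length xs = n" "J (n - 1) \<omega> = snd (xs ! (n - 1))" by (simp_all add: path_eq_iff)
      with True False J_range[of "n - 1" \<omega>] show False by simp
    qed
    then show ?thesis by simp
  next
    case False
    then have "{\<omega> \<in> space M. path n \<omega> = xs \<and> (N n \<omega>, J n \<omega>) = kj} = {}"
      using N_pos[of n] J_range[of n] by auto
    then have "emeasure M {\<omega> \<in> space M. path n \<omega> = xs \<and> (N n \<omega>, J n \<omega>) = kj} = 0"
      by (simp only: emeasure_empty)
    then show ?thesis using False by (simp only: kern_def if_False mult_zero_left)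
  qed
qed

lemma pair_function_measurable[measurable]: "(\<lambda>\<omega>. h (N n \<omega>) (J n \<omega>) :: ennreal) \<in> borel_measurable M"
  by (rule measurable_compose[where g = "\<lambda>kj. h (fst kj) (snd kj)" and f = "\<lambda>\<omega>. (N n \<omega>, J n \<omega>)" and N = "count_space UNIV", simplified]) measurable

lemma nn_integral_pair_indicator:
  assumes [measurable]: "Measurable.pred M P"
  shows "(\<integral>\<^sup>+\<omega>. h (N n \<omega>) (J n \<omega>) * indicator {\<omega>. P \<omega>} \<omega> \<partial>M)
    = (\<integral>\<^sup>+kj. h (fst kj) (snd kj) * emeasure M {\<omega> \<in> space M. P \<omega> \<and> (N n \<omega>, J n \<omega>) = kj} \<partial>count_space UNIV)"
proof -
  have [measurable]: "(\<lambda>\<omega>. (N n \<omega>, J n \<omega>)) \<in> measurable M (count_space UNIV)" by measurable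
  have "(\<integral>\<^sup>+\<omega>. h (N n \<omega>) (J n \<omega>) * indicator {\<omega>. P \<omega>} \<omega> * indicator {\<omega>. (N n \<omega>, J n \<omega>) = kj} \<omega> \<partial>M)
    = h (fst kj) (snd kj) * emeasure M {\<omega> \<in> space M. P \<omega> \<and> (N n \<omega>, J n \<omega>) = kj}" for kj
    by (subst nn_integral_cmult_indicator[symmetric], measurable)
      (auto intro!: nn_integral_cong simp: indicator_def)
  then show ?thesis
    by (subst nn_integral_partition[of "\<lambda>\<omega>. (N n \<omega>, J n \<omega>)"]) simp_all
qed

text \<open>The Markov property in integrated form. On each atom of the path the factor
  \<open>F\<close> is constant and the last state is known.\<close>

lemma nn_integral_step:
  assumes n: "n \<ge> 1"
  shows "(\<integral>\<^sup>+\<omega>. F (path n \<omega>) * h (N n \<omega>) (J n \<omega>) \<partial>M) = (\<integral>\<^sup>+\<omega>. F (path n \<omega>) * step h (J (n - 1) \<omega>) \<partial>M)"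
proof -
  have [measurable]: "(\<lambda>\<omega>. F (path n \<omega>)) \<in> borel_measurable M"
    by (rule measurable_compose[OF path_measurable]) simp
  have [measurable]: "(\<lambda>\<omega>. step h (J (n - 1) \<omega>)) \<in> borel_measurable M"
    by (rule measurable_compose[OF meas_J]) simp
  have "(\<integral>\<^sup>+\<omega>. F (path n \<omega>) * h (N n \<omega>) (J n \<omega>) * indicator {\<omega>. path n \<omega> = xs} \<omega> \<partial>M)
     = (\<integral>\<^sup>+\<omega>. F (path n \<omega>) * step h (J (n - 1) \<omega>) * indicator {\<omega>. path n \<omega> = xs} \<omega> \<partial>M)" for xs
  proof -
    let ?i = "snd (xs ! (n - 1))"
    have "(\<integral>\<^sup>+\<omega>. h (N n \<omega>) (J n \<omega>) * indicator {\<omega>. path n \<omega> = xs} \<omega> \<partial>M)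
      = (\<integral>\<^sup>+kj. h (fst kj) (snd kj) * emeasure M {\<omega> \<in> space M. path n \<omega> = xs \<and> (N n \<omega>, J n \<omega>) = kj} \<partial>count_space UNIV)"
      by (rule nn_integral_pair_indicator) measurable
    also have "\<dots> = (\<integral>\<^sup>+kj. (kern ?i kj * h (fst kj) (snd kj)) * emeasure M {\<omega> \<in> space M. path n \<omega> = xs} \<partial>count_space UNIV)"
      unfolding emeasure_step[OF n] by (simp add: ac_simps)
    also have "\<dots> = step h ?i * emeasure M {\<omega> \<in> space M. path n \<omega> = xs}"
      unfolding step_altdef by (rule nn_integral_multc) simp
    also have "\<dots> = (\<integral>\<^sup>+\<omega>. step h ?i * indicator {\<omega> \<in> space M. path n \<omega> = xs} \<omega> \<partial>M)"
      by (rule nn_integral_cmult_indicator[symmetric]) measurable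
    also have "\<dots> = (\<integral>\<^sup>+\<omega>. step h (J (n - 1) \<omega>) * indicator {\<omega>. path n \<omega> = xs} \<omega> \<partial>M)"
      using n by (intro nn_integral_cong) (auto simp: indicator_def path_eq_iff)
    finally have *: "(\<integral>\<^sup>+\<omega>. h (N n \<omega>) (J n \<omega>) * indicator {\<omega>. path n \<omega> = xs} \<omega> \<partial>M)
        = (\<integral>\<^sup>+\<omega>. step h (J (n - 1) \<omega>) * indicator {\<omega>. path n \<omega> = xs} \<omega> \<partial>M)" .
    have "(\<integral>\<^sup>+\<omega>. F (path n \<omega>) * g \<omega> * indicator {\<omega>. path n \<omega> = xs} \<omega> \<partial>M)
      = F xs * (\<integral>\<^sup>+\<omega>. g \<omega> * indicator {\<omega>. path n \<omega> = xs} \<omega> \<partial>M)" if [measurable]: "g \<in> borel_measurable M" for g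
    proof -
      have "(\<integral>\<^sup>+\<omega>. F (path n \<omega>) * g \<omega> * indicator {\<omega>. path n \<omega> = xs} \<omega> \<partial>M)
        = (\<integral>\<^sup>+\<omega>. F xs * (g \<omega> * indicator {\<omega>. path n \<omega> = xs} \<omega>) \<partial>M)"
        by (intro nn_integral_cong) (auto simp: indicator_def)
      also have "\<dots> = F xs * (\<integral>\<^sup>+\<omega>. g \<omega> * indicator {\<omega>. path n \<omega> = xs} \<omega> \<partial>M)"
        by (rule nn_integral_cmult) measurable
      finally show ?thesis .
    qed
    then show ?thesis using * by simp
  qed
  then show ?thesis
    by (subst (1 2) nn_integral_partition[OF path_measurable[of n]]) (auto intro!: nn_integral_cong)
qed

text \<open>If \<open>u\<close> is superharmonic up to the factor \<open>\<rho>\<close> for the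
  weighted kernel, then the weighted products times \<open>u\<close>, divided by
  \<open>\<rho> ^ n\<close>, form a supermartingale. Slot 0 stays outside because it follows the
  initial law and not the kernel.\<close>

lemma product_bound:
  fixes w u :: "nat \<Rightarrow> ennreal"
  assumes sup: "\<And>i. i < d \<Longrightarrow> step (\<lambda>k j. w k * u j) i \<le> \<rho> * u i"
  shows "(\<integral>\<^sup>+\<omega>. (\<Prod>l<Suc n. w (N l \<omega>)) * u (J n \<omega>) \<partial>M) \<le> \<rho> ^ n * (\<integral>\<^sup>+\<omega>. w (N 0 \<omega>) * u (J 0 \<omega>) \<partial>M)"
proof (induction n)
  case (Suc n)
  have P: "(\<Prod>l<m. w (N l \<omega>)) = prod_list (map (\<lambda>x. w (fst x)) (path m \<omega>))" for m \<omega>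
    by (induction m) (auto simp: path_Suc, simp add: path_def)
  have "(\<integral>\<^sup>+\<omega>. (\<Prod>l<Suc (Suc n). w (N l \<omega>)) * u (J (Suc n) \<omega>) \<partial>M)
    = (\<integral>\<^sup>+\<omega>. prod_list (map (\<lambda>x. w (fst x)) (path (Suc n) \<omega>)) * (w (N (Suc n) \<omega>) * u (J (Suc n) \<omega>)) \<partial>M)"
    by (simp only: P[symmetric]) (simp add: ac_simps)
  also have "\<dots> = (\<integral>\<^sup>+\<omega>. prod_list (map (\<lambda>x. w (fst x)) (path (Suc n) \<omega>)) * step (\<lambda>k j. w k * u j) (J n \<omega>) \<partial>M)"
    using nn_integral_step[of "Suc n" "\<lambda>xs. prod_list (map (\<lambda>x. w (fst x)) xs)" "\<lambda>k j. w k * u j"] by simp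
  also have "\<dots> \<le> (\<integral>\<^sup>+\<omega>. \<rho> * ((\<Prod>l<Suc n. w (N l \<omega>)) * u (J n \<omega>)) \<partial>M)"
  proof (rule nn_integral_mono)
    fix \<omega>
    have "(\<Prod>l<Suc n. w (N l \<omega>)) * step (\<lambda>k j. w k * u j) (J n \<omega>) \<le> (\<Prod>l<Suc n. w (N l \<omega>)) * (\<rho> * u (J n \<omega>))"
      using sup[OF J_range] by (rule mult_left_mono) simp
    then show "prod_list (map (\<lambda>x. w (fst x)) (path (Suc n) \<omega>)) * step (\<lambda>k j. w k * u j) (J n \<omega>) \<le> \<rho> * ((\<Prod>l<Suc n. w (N l \<omega>)) * u (J n \<omega>))"
      by (simp only: P[symmetric]) (simp only: ac_simps)
  qed
  also have "\<dots> = \<rho> * (\<integral>\<^sup>+\<omega>. (\<Prod>l<Suc n. w (N l \<omega>)) * u (J n \<omega>) \<partial>M)"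
  proof (rule nn_integral_cmult)
    have [measurable]: "(\<lambda>\<omega>. w (N l \<omega>)) \<in> borel_measurable M" "(\<lambda>\<omega>. u (J l \<omega>)) \<in> borel_measurable M" for l
      by (rule measurable_compose[OF meas_N], simp) (rule measurable_compose[OF meas_J], simp)
    show "(\<lambda>\<omega>. (\<Prod>l<Suc n. w (N l \<omega>)) * u (J n \<omega>)) \<in> borel_measurable M" by measurable
  qed
  also have "\<dots> \<le> \<rho> * (\<rho> ^ n * (\<integral>\<^sup>+\<omega>. w (N 0 \<omega>) * u (J 0 \<omega>) \<partial>M))"
    using Suc.IH by (rule mult_left_mono) simp
  finally show ?case by (simp add: ac_simps)
qed simp

end

section \<open>Exponential weights and perturbed eigenvectors\<close>

lemma exp_quadratic_nonpos:
  fixes t :: real assumes "t \<le> 0" shows "exp t \<le> 1 + t + t\<^sup>2 / 2"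
proof -
  obtain s where s: "exp t = (\<Sum>m<3. t ^ m / fact m) + exp s / fact 3 * t ^ 3"
    using Maclaurin_exp_le[of t 3] by blast
  have "exp s / fact 3 * t ^ 3 \<le> 0" using assms
    by (intro mult_nonneg_nonpos) (auto simp: power3_eq_cube mult_nonneg_nonpos mult_nonpos_nonpos)
  then show ?thesis using s by (simp add: eval_nat_numeral fact_numeral)
qed

text \<open>Taylor expansion with the second derivative bounded by \<open>exp b\<close> on the
  interval. That factor is the price of a truncated positive exponent.\<close>

lemma exp_quadratic_nonneg:
  fixes t :: real assumes "0 \<le> t" "t \<le> b" shows "exp t \<le> 1 + t + t\<^sup>2 * exp b"
proof -
  obtain s where s: "\<bar>s\<bar> \<le> \<bar>t\<bar>" "exp t = (\<Sum>m<2. t ^ m / fact m) + exp s / fact 2 * t ^ 2"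
    using Maclaurin_exp_le[of t 2] by blast
  have "exp s \<le> exp b" using s(1) assms by simp
  moreover have "exp b > 0" by simp
  ultimately have "exp s / 2 \<le> exp b" by linarith
  then have "exp s / 2 * t^2 \<le> exp b * t^2" by (rule mult_right_mono) simp
  then show ?thesis using s(2) by (simp add: eval_nat_numeral algebra_simps)
qed

locale ergodic_bmap = bmap M d Lam N J + finite_chain d "Lam_sum Lam" phi
  for M :: "'a measure" and d Lam N J phi +
  assumes Lam_summable: "\<And>i j. summable (\<lambda>k. Lam (Suc k) i j)"
    and Lam_mean_summable: "\<And>i j. summable (\<lambda>k. real (Suc k) * Lam (Suc k) i j)"
    and Lam_sq_summable: "\<And>i j. i < d \<Longrightarrow> j < d \<Longrightarrow> summable (\<lambda>k. (real k)\<^sup>2 * Lam (Suc k) i j)"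
begin

abbreviation weight_mean :: "(nat \<Rightarrow> real) \<Rightarrow> nat \<Rightarrow> ennreal" where
  "weight_mean w k \<equiv> \<integral>\<^sup>+\<omega>. (\<Prod>l<k. ennreal (w (N l \<omega> - 1))) \<partial>M"

text \<open>The long-run mean of \<open>N l - 1\<close> per slot, that is, the speed at which the
  net input grows.\<close>

definition excess :: real where "excess = arr_rate d phi Lam - 1"

definition m1 :: "nat \<Rightarrow> nat \<Rightarrow> real" where "m1 i j = (\<Sum>k. real k * Lam (Suc k) i j)"
definition m2 :: "nat \<Rightarrow> nat \<Rightarrow> real" where "m2 i j = (\<Sum>k. (real k)\<^sup>2 * Lam (Suc k) i j)"

lemma m1_summable: "summable (\<lambda>k. real k * Lam (Suc k) i j)"
  using summable_diff[OF Lam_mean_summable[of i j] Lam_summable[of i j]] by (simp add: algebra_simps)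

lemma m1_nonneg: "m1 i j \<ge> 0"
  unfolding m1_def by (intro suminf_nonneg m1_summable) (simp add: Lam_nonneg)

lemma m2_nonneg: "i < d \<Longrightarrow> j < d \<Longrightarrow> m2 i j \<ge> 0"
  unfolding m2_def by (intro suminf_nonneg Lam_sq_summable) (simp_all add: Lam_nonneg)

lemma mean_eq: "(\<Sum>k. real (Suc k) * Lam (Suc k) i j) = m1 i j + Lam_sum Lam i j"
  unfolding m1_def Lam_sum_def suminf_add[OF m1_summable Lam_summable]
  by (simp add: algebra_simps)

lemma excess_eq: "excess = (\<Sum>i<d. phi i * (\<Sum>j<d. m1 i j))"
proof -
  have "arr_rate d phi Lam = (\<Sum>i<d. phi i * (\<Sum>j<d. m1 i j) + phi i * (\<Sum>j<d. Lam_sum Lam i j))"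
    unfolding arr_rate_def mean_eq by (simp add: sum_distrib_left distrib_left sum.distrib)
  also have "\<dots> = (\<Sum>i<d. phi i * (\<Sum>j<d. m1 i j)) + (\<Sum>i<d. phi i)"
    by (simp add: sum.distrib Q_sum)
  finally show ?thesis by (simp add: excess_def phi_sum)
qed

lemma step_weight:
  assumes w: "\<And>k. 0 \<le> w k" "\<And>k. w k \<le> 1 + z * real k + c * (real k)\<^sup>2" and u: "\<And>j. j < d \<Longrightarrow> 0 \<le> u j"
    and i: "i < d"
  shows "step (\<lambda>k j. ennreal (w (k - 1)) * ennreal (u j)) i
    \<le> ennreal (\<Sum>j<d. u j * (Lam_sum Lam i j + z * m1 i j + c * m2 i j))"
proof -
  have pos: "0 \<le> 1 + z * real k + c * (real k)\<^sup>2" for k using w[of k] by linarith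
  have "(\<Sum>k. ennreal (Lam (Suc k) i j) * (ennreal (w (Suc k - 1)) * ennreal (u j)))
      \<le> ennreal (u j * (Lam_sum Lam i j + z * m1 i j + c * m2 i j))" if j: "j < d" for j
  proof -
    let ?f = "\<lambda>k. u j * (Lam (Suc k) i j + z * (real k * Lam (Suc k) i j) + c * ((real k)\<^sup>2 * Lam (Suc k) i j))"
    have f_eq: "?f k = u j * (Lam (Suc k) i j * (1 + z * real k + c * (real k)\<^sup>2))" for k
      by (simp add: algebra_simps)
    have f0: "?f k \<ge> 0" for k unfolding f_eq using u[OF j] pos[of k] Lam_nonneg by simp
    have f_sums: "?f sums (u j * (Lam_sum Lam i j + z * m1 i j + c * m2 i j))"
      unfolding Lam_sum_def m1_def m2_def
      by (intro sums_mult sums_add summable_sums Lam_summable m1_summable Lam_sq_summable i j)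
    have "(\<Sum>k. ennreal (Lam (Suc k) i j) * (ennreal (w (Suc k - 1)) * ennreal (u j))) \<le> (\<Sum>k. ennreal (?f k))"
    proof (intro suminf_le)
      fix k
      have "Lam (Suc k) i j * (w k * u j) \<le> Lam (Suc k) i j * ((1 + z * real k + c * (real k)\<^sup>2) * u j)"
        using Lam_nonneg w u[OF j] by (intro mult_left_mono mult_right_mono) auto
      also have "\<dots> = ?f k" unfolding f_eq by (simp only: ac_simps)
      finally show "ennreal (Lam (Suc k) i j) * (ennreal (w (Suc k - 1)) * ennreal (u j)) \<le> ennreal (?f k)"
        using Lam_nonneg[of "Suc k" i j] w(1)[of k] u[OF j] by (simp add: ennreal_mult[symmetric] ennreal_leI)
    qed auto
    also have "\<dots> = ennreal (\<Sum>k. ?f k)" using f0 f_sums by (intro suminf_ennreal2) (auto simp: sums_iff)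
    also have "(\<Sum>k. ?f k) = u j * (Lam_sum Lam i j + z * m1 i j + c * m2 i j)" using f_sums by (simp add: sums_iff)
    finally show ?thesis .
  qed
  moreover have "0 \<le> u j * (Lam_sum Lam i j + z * m1 i j + c * m2 i j)" if j: "j < d" for j
  proof -
    have s: "(\<lambda>k. Lam (Suc k) i j + z * (real k * Lam (Suc k) i j) + c * ((real k)\<^sup>2 * Lam (Suc k) i j)) sums
      (Lam_sum Lam i j + z * m1 i j + c * m2 i j)"
      unfolding Lam_sum_def m1_def m2_def
      by (intro sums_mult sums_add summable_sums Lam_summable m1_summable Lam_sq_summable i j)
    have "0 \<le> Lam (Suc k) i j + z * (real k * Lam (Suc k) i j) + c * ((real k)\<^sup>2 * Lam (Suc k) i j)" for k
    proof -
      have "0 \<le> Lam (Suc k) i j * (1 + z * real k + c * (real k)\<^sup>2)" using pos[of k] Lam_nonneg by simp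
      then show ?thesis by (simp add: algebra_simps)
    qed
    from sums_le[OF this sums_zero s] have "0 \<le> Lam_sum Lam i j + z * m1 i j + c * m2 i j" .
    then show ?thesis using u[OF j] by simp
  qed
  ultimately show ?thesis unfolding step_def
    by (subst sum_ennreal[symmetric]) (auto intro!: sum_mono)
qed

text \<open>The vector \<open>u = 1 + z * v\<close>, with \<open>v\<close> an approximate Poisson
  solution for the conditional means, is to first order in \<open>z\<close> an eigenvector of the
  weighted kernel with eigenvalue \<open>1 + z * excess\<close>. Requiring only a quadratic majorant
  of the weight covers decaying exponentials (\<open>z < 0\<close>) and truncated growing ones
  (\<open>z > 0\<close>) at once, with constants uniform in \<open>z\<close>, \<open>c\<close> and
  \<open>w\<close>.\<close>

lemma exp_product_bound:
  assumes e: "e > 0"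
  obtains C z0 where "C > 0" "z0 > 0"
    "\<And>z c w n. \<bar>z\<bar> \<le> z0 \<Longrightarrow> 0 \<le> c \<Longrightarrow> (\<And>k. 0 \<le> w k) \<Longrightarrow> (\<And>k. w k \<le> 1 + z * real k + c * (real k)\<^sup>2) \<Longrightarrow>
      weight_mean w (Suc n)
      \<le> ennreal (4 * exp (real n * (z * excess + \<bar>z\<bar> * e + C * (c + z\<^sup>2)))) * (\<integral>\<^sup>+\<omega>. ennreal (w (N 0 \<omega> - 1)) \<partial>M)"
proof -
  define r where "r i = (\<Sum>j<d. m1 i j)" for i
  have ex: "excess = (\<Sum>i<d. phi i * r i)" unfolding excess_eq r_def ..
  \<comment> \<open>Half of \<open>e\<close> is used because the margin in the exponent gets
    multiplied by \<open>u i\<close>, which may be as small as \<open>1/2\<close>.\<close>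
  have "e / 2 > 0" using e by simp
  from approx_poisson[OF this, of r] obtain v where
    v: "\<And>i. i < d \<Longrightarrow> \<bar>r i + avg v i - v i - excess\<bar> \<le> e / 2"
    unfolding ex by blast
  define V where "V = (\<Sum>i<d. \<bar>v i\<bar>)"
  have V: "\<bar>v i\<bar> \<le> V" if "i < d" for i unfolding V_def using that by (intro member_le_sum) auto
  have V0: "V \<ge> 0" by (simp add: V_def sum_nonneg)
  define M1 where "M1 = (\<Sum>i<d. r i)"
  have r0: "r i \<ge> 0" for i unfolding r_def by (intro sum_nonneg m1_nonneg)
  have M1: "r i \<le> M1" if "i < d" for i unfolding M1_def using that r0 by (intro member_le_sum) auto
  define M2 where "M2 = (\<Sum>i<d. \<Sum>j<d. m2 i j)"
  have M2: "(\<Sum>j<d. m2 i j) \<le> M2" if "i < d" for i unfolding M2_def using that m2_nonneg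
    by (intro member_le_sum[of i "{..<d}" "\<lambda>i. \<Sum>j<d. m2 i j"] sum_nonneg) auto
  have M20: "M2 \<ge> 0" unfolding M2_def by (intro sum_nonneg m2_nonneg) auto
  have M10: "M1 \<ge> 0" unfolding M1_def by (intro sum_nonneg r0)
  \<comment> \<open>It collects the second-order terms: \<open>V * \<bar>excess\<bar>\<close> from
    comparing with \<open>(1 + x) * u i\<close>, \<open>V * M1\<close> from the product of
    \<open>z * v j\<close> with the mean jump, and \<open>2 * M2\<close> from the quadratic part of
    the weight. The factor 2 again makes up for \<open>u i \<ge> 1 / 2\<close>.\<close>
  define C where "C = 2 * (V * \<bar>excess\<bar> + V * M1 + 2 * M2) + 1"
  have C: "C > 0" using V0 M10 M20 by (simp add: C_def add_nonneg_pos)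
  \<comment> \<open>Small enough to give \<open>\<bar>z * v j\<bar> \<le> 1 / 2\<close>, so that
    \<open>u\<close> lies between \<open>1/2\<close> and \<open>3/2\<close>.\<close>
  define z0 where "z0 = 1 / (2 * V + 2)"
  have z0: "z0 > 0" using V0 by (simp add: z0_def)
  have "weight_mean w (Suc n)
      \<le> ennreal (4 * exp (real n * (z * excess + \<bar>z\<bar> * e + C * (c + z\<^sup>2)))) * (\<integral>\<^sup>+\<omega>. ennreal (w (N 0 \<omega> - 1)) \<partial>M)"
    if z: "\<bar>z\<bar> \<le> z0" and c: "0 \<le> c" and w: "\<And>k. 0 \<le> w k" "\<And>k. w k \<le> 1 + z * real k + c * (real k)\<^sup>2"
    for z c w n
  proof -
    define u where "u j = 1 + z * v j" for j
    have zV: "\<bar>z * v j\<bar> \<le> 1 / 2" if "j < d" for j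
    proof -
      have "\<bar>z * v j\<bar> \<le> z0 * V" unfolding abs_mult using z V[OF that] z0 by (intro mult_mono) auto
      also have "\<dots> \<le> 1 / 2" using V0 by (simp add: z0_def field_simps)
      finally show ?thesis .
    qed
    have u: "1 / 2 \<le> u j" "u j \<le> 3 / 2" if "j < d" for j using zV[OF that] unfolding u_def by linarith+
    define x where "x = z * excess + \<bar>z\<bar> * e + C * (c + z\<^sup>2)"
    have key: "(\<Sum>j<d. u j * (Lam_sum Lam i j + z * m1 i j + c * m2 i j)) \<le> exp x * u i" if i: "i < d" for i
    proof -
      have split: "(\<Sum>j<d. u j * (Lam_sum Lam i j + z * m1 i j + c * m2 i j))
        = 1 + z * (r i + avg v i) + z\<^sup>2 * (\<Sum>j<d. v j * m1 i j) + c * (\<Sum>j<d. u j * m2 i j)"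
      proof -
        have "u j * (Lam_sum Lam i j + z * m1 i j + c * m2 i j) = Lam_sum Lam i j + z * m1 i j
          + z * (Lam_sum Lam i j * v j) + z\<^sup>2 * (v j * m1 i j) + c * (u j * m2 i j)" for j
          by (simp add: u_def algebra_simps power2_eq_square)
        then have "(\<Sum>j<d. u j * (Lam_sum Lam i j + z * m1 i j + c * m2 i j)) = (\<Sum>j<d. Lam_sum Lam i j + z * m1 i j
          + z * (Lam_sum Lam i j * v j) + z\<^sup>2 * (v j * m1 i j) + c * (u j * m2 i j))" by simp
        also have "\<dots> = (\<Sum>j<d. Lam_sum Lam i j) + z * (\<Sum>j<d. m1 i j) + z * (\<Sum>j<d. Lam_sum Lam i j * v j)
          + z\<^sup>2 * (\<Sum>j<d. v j * m1 i j) + c * (\<Sum>j<d. u j * m2 i j)"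
          by (simp only: sum.distrib sum_distrib_left)
        finally show ?thesis
          unfolding Q_sum[OF i] avg_def[symmetric] r_def by (simp add: distrib_left)
      qed
      have "(\<Sum>j<d. v j * m1 i j) \<le> (\<Sum>j<d. V * m1 i j)"
        using V m1_nonneg by (intro sum_mono mult_right_mono) (auto simp: abs_le_iff)
      also have "\<dots> = V * r i" by (simp add: r_def sum_distrib_left)
      also have "\<dots> \<le> V * M1" using V0 M1[OF i] by (rule mult_left_mono[rotated])
      finally have a: "z\<^sup>2 * (\<Sum>j<d. v j * m1 i j) \<le> z\<^sup>2 * (V * M1)" by (rule mult_left_mono) simp
      have "(\<Sum>j<d. u j * m2 i j) \<le> (\<Sum>j<d. 2 * m2 i j)"
        using u m2_nonneg[OF i] by (intro sum_mono mult_right_mono) force+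
      also have "\<dots> \<le> 2 * M2" using M2[OF i] by (simp add: sum_distrib_left[symmetric])
      finally have b: "c * (\<Sum>j<d. u j * m2 i j) \<le> c * (2 * M2)" using c by (rule mult_left_mono)
      have "z * (r i + avg v i) = z * v i + z * excess + z * (r i + avg v i - v i - excess)" by (simp add: algebra_simps)
      moreover have "z * (r i + avg v i - v i - excess) \<le> \<bar>z\<bar> * (e / 2)"
        using mult_left_mono[OF v[OF i], of "\<bar>z\<bar>"] by (simp only: abs_mult[symmetric]) (auto intro: order_trans[OF abs_ge_self])
      ultimately have lhs: "(\<Sum>j<d. u j * (Lam_sum Lam i j + z * m1 i j + c * m2 i j))
          \<le> u i + z * excess + \<bar>z\<bar> * (e / 2) + z\<^sup>2 * (V * M1) + c * (2 * M2)"
        unfolding split using a b by (simp add: u_def)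
      have "(1 + x) * u i \<le> exp x * u i"
        using u[OF i] exp_ge_add_one_self[of x] by (intro mult_right_mono) auto
      moreover have "(1 + x) * u i = u i + z * excess + z\<^sup>2 * (v i * excess) + (\<bar>z\<bar> * e + C * (c + z\<^sup>2)) * u i"
        by (simp add: x_def u_def algebra_simps power2_eq_square)
      moreover have "(\<bar>z\<bar> * e + C * (c + z\<^sup>2)) * (1 / 2) \<le> (\<bar>z\<bar> * e + C * (c + z\<^sup>2)) * u i"
        using u[OF i] e C c by (intro mult_left_mono) (auto intro!: add_nonneg_nonneg mult_nonneg_nonneg)
      moreover have "- (z\<^sup>2 * (V * \<bar>excess\<bar>)) \<le> z\<^sup>2 * (v i * excess)"
      proof -
        have "\<bar>v i * excess\<bar> \<le> V * \<bar>excess\<bar>" unfolding abs_mult using V[OF i] by (intro mult_right_mono) auto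
        then have "- (V * \<bar>excess\<bar>) \<le> v i * excess" by linarith
        from mult_left_mono[OF this, of "z\<^sup>2"] show ?thesis by simp
      qed
      moreover have "C * (c + z\<^sup>2) * (1/2) \<ge> z\<^sup>2 * (V * M1) + c * (2 * M2) + z\<^sup>2 * (V * \<bar>excess\<bar>)"
      proof -
        have "C * (c + z\<^sup>2) * (1/2) - (z\<^sup>2 * (V * M1) + c * (2 * M2) + z\<^sup>2 * (V * \<bar>excess\<bar>))
          = c * (V * \<bar>excess\<bar> + V * M1) + z\<^sup>2 * (2 * M2) + (c + z\<^sup>2) / 2"
          by (simp add: C_def algebra_simps)
        also have "\<dots> \<ge> 0" using c V0 M10 M20 by (intro add_nonneg_nonneg mult_nonneg_nonneg) auto
        finally show ?thesis by simp
      qed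
      ultimately show ?thesis using lhs by (simp add: distrib_right)
    qed
    have sup: "step (\<lambda>k j. ennreal (w (k - 1)) * ennreal (u j)) i \<le> ennreal (exp x) * ennreal (u i)" if "i < d" for i
    proof -
      have "step (\<lambda>k j. ennreal (w (k - 1)) * ennreal (u j)) i
        \<le> ennreal (\<Sum>j<d. u j * (Lam_sum Lam i j + z * m1 i j + c * m2 i j))"
        using u(1) by (intro step_weight w that) force
      also have "\<dots> \<le> ennreal (exp x * u i)" using key[OF that] by (rule ennreal_leI)
      finally show ?thesis using u[OF that] by (simp add: ennreal_mult)
    qed
    have m[measurable]: "(\<lambda>\<omega>. ennreal (w (N l \<omega> - 1))) \<in> borel_measurable M" "(\<lambda>\<omega>. ennreal (u (J l \<omega>))) \<in> borel_measurable M" for l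
      by (rule measurable_compose[OF meas_N], simp) (rule measurable_compose[OF meas_J], simp)
    \<comment> \<open>The factor 4 is \<open>2 * 2\<close>: inserting \<open>u\<close> at the last
      state costs 2, and removing it at the initial state costs another 2.\<close>
    have "weight_mean w (Suc n)
      \<le> (\<integral>\<^sup>+\<omega>. ennreal 2 * ((\<Prod>l<Suc n. ennreal (w (N l \<omega> - 1))) * ennreal (u (J n \<omega>))) \<partial>M)"
    proof (rule nn_integral_mono)
      fix \<omega>
      let ?P = "\<Prod>l<Suc n. ennreal (w (N l \<omega> - 1))"
      have "ennreal 1 \<le> ennreal (2 * u (J n \<omega>))" using u(1)[OF J_range[of n \<omega>]] by (intro ennreal_leI) simp
      also have "ennreal (2 * u (J n \<omega>)) = ennreal 2 * ennreal (u (J n \<omega>))"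
        using u(1)[OF J_range[of n \<omega>]] by (intro ennreal_mult) auto
      finally have "?P * ennreal 1 \<le> ?P * (ennreal 2 * ennreal (u (J n \<omega>)))"
        by (rule mult_left_mono) simp
      then show "?P \<le> ennreal 2 * (?P * ennreal (u (J n \<omega>)))"
        by (simp only: ennreal_1 mult_1_right mult.left_commute)
    qed
    also have "\<dots> = ennreal 2 * (\<integral>\<^sup>+\<omega>. (\<Prod>l<Suc n. ennreal (w (N l \<omega> - 1))) * ennreal (u (J n \<omega>)) \<partial>M)"
      by (rule nn_integral_cmult) measurable
    also have "\<dots> \<le> ennreal 2 * (ennreal (exp x) ^ n * (\<integral>\<^sup>+\<omega>. ennreal (w (N 0 \<omega> - 1)) * ennreal (u (J 0 \<omega>)) \<partial>M))"
      by (intro mult_left_mono product_bound[where w = "\<lambda>k. ennreal (w (k - 1))" and u = "\<lambda>j. ennreal (u j)"] sup) auto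
    also have "(\<integral>\<^sup>+\<omega>. ennreal (w (N 0 \<omega> - 1)) * ennreal (u (J 0 \<omega>)) \<partial>M)
       \<le> (\<integral>\<^sup>+\<omega>. ennreal (w (N 0 \<omega> - 1)) * ennreal 2 \<partial>M)"
    proof (intro nn_integral_mono mult_left_mono ennreal_leI)
      show "u (J 0 \<omega>) \<le> 2" for \<omega> using u(2)[OF J_range[of 0 \<omega>]] by linarith
    qed simp
    also have "\<dots> = (\<integral>\<^sup>+\<omega>. ennreal (w (N 0 \<omega> - 1)) \<partial>M) * ennreal 2"
      by (rule nn_integral_multc) measurable
    also have "ennreal 2 * (ennreal (exp x) ^ n * ((\<integral>\<^sup>+\<omega>. ennreal (w (N 0 \<omega> - 1)) \<partial>M) * ennreal 2))
      = (ennreal 2 * ennreal 2 * ennreal (exp x) ^ n) * (\<integral>\<^sup>+\<omega>. ennreal (w (N 0 \<omega> - 1)) \<partial>M)"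
      by (simp only: ac_simps)
    also have "ennreal 2 * ennreal 2 * ennreal (exp x) ^ n = ennreal (4 * exp (real n * x))"
      by (simp add: ennreal_mult[symmetric] ennreal_power exp_of_nat_mult del: ennreal_numeral)
    finally show ?thesis by (simp add: x_def mult_left_mono)
  qed
  with C z0 show ?thesis by (rule that)
qed

end

section \<open>Large deviations of the partial sums at deterministic times\<close>

context ergodic_bmap begin

definition S :: "nat \<Rightarrow> 'a \<Rightarrow> nat" where "S k \<omega> = (\<Sum>l<k. N l \<omega> - 1)"

lemma S_measurable[measurable]: "S k \<in> measurable M (count_space UNIV)"
  unfolding S_def by measurable

lemma S_mono: "k \<le> k' \<Longrightarrow> S k \<omega> \<le> S k' \<omega>"
  unfolding S_def by (intro sum_mono2) auto

lemma prod_exp: "(\<Prod>l<k. exp (h * real (N l \<omega> - 1))) = exp (h * real (S k \<omega>))"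
  by (simp add: S_def exp_sum[symmetric] sum_distrib_left)

lemma prob_le_integral:
  assumes [measurable]: "Measurable.pred M P" and le: "\<And>\<omega>. P \<omega> \<Longrightarrow> 1 \<le> g \<omega>" and int: "(\<integral>\<^sup>+\<omega>. g \<omega> \<partial>M) \<le> ennreal c" and c: "c \<ge> 0"
  shows "prob {\<omega> \<in> space M. P \<omega>} \<le> c"
proof -
  have "ennreal (prob {\<omega> \<in> space M. P \<omega>}) = (\<integral>\<^sup>+\<omega>. indicator {\<omega> \<in> space M. P \<omega>} \<omega> \<partial>M)"
    by (simp add: emeasure_eq_measure)
  also have "\<dots> \<le> (\<integral>\<^sup>+\<omega>. g \<omega> \<partial>M)" using le by (intro nn_integral_mono) (auto simp: indicator_def)
  also note int
  finally show ?thesis using c by (simp add: ennreal_le_iff)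
qed

lemma prob_le_weight_mean:
  fixes w :: "nat \<Rightarrow> real"
  assumes P: "Measurable.pred M P" and w: "\<And>k. 0 \<le> w k" and c: "0 \<le> c" "0 \<le> b"
    and le: "\<And>\<omega>. P \<omega> \<Longrightarrow> 1 \<le> c * (\<Prod>l<k. w (N l \<omega> - 1))" and m: "weight_mean w k \<le> ennreal b"
  shows "prob {\<omega> \<in> space M. P \<omega>} \<le> c * b"
proof (rule prob_le_integral[OF P])
  have [measurable]: "(\<lambda>\<omega>. ennreal (w (N l \<omega> - 1))) \<in> borel_measurable M" for l
    by (rule measurable_compose[OF meas_N]) simp
  have "(\<integral>\<^sup>+\<omega>. ennreal c * (\<Prod>l<k. ennreal (w (N l \<omega> - 1))) \<partial>M) = ennreal c * weight_mean w k"
    by (rule nn_integral_cmult) measurable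
  also have "\<dots> \<le> ennreal c * ennreal b"
    using m by (rule mult_left_mono) simp
  finally show "(\<integral>\<^sup>+\<omega>. ennreal c * (\<Prod>l<k. ennreal (w (N l \<omega> - 1))) \<partial>M) \<le> ennreal (c * b)"
    using c by (simp add: ennreal_mult)
  fix \<omega> assume "P \<omega>"
  then have "ennreal 1 \<le> ennreal (c * (\<Prod>l<k. w (N l \<omega> - 1)))" by (intro ennreal_leI le)
  then show "1 \<le> ennreal c * (\<Prod>l<k. ennreal (w (N l \<omega> - 1)))"
    using w c by (simp add: ennreal_mult prod_nonneg prod_ennreal)
qed (use c in simp)

text \<open>A Chernoff bound with a fixed negative exponent. The increments are nonnegative, so
  \<open>exp (- h * k)\<close> has a quadratic majorant whatever the jump tail is.\<close>

lemma lower_deviation: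
  assumes ex: "excess > 0" and eps: "eps > 0"
  obtains c C where "c > 0"
    "\<And>x k. k \<ge> 1 \<Longrightarrow> (1 + eps) * x / excess \<le> real k \<Longrightarrow> prob {\<omega> \<in> space M. real (S k \<omega>) \<le> x} \<le> C * exp (- c * x)"
proof -
  \<comment> \<open>Chosen so that the reduced speed \<open>excess - 2 * e\<close>, over
    \<open>(1 + eps) * x / excess\<close> slots, still covers
    \<open>(1 + eps / 2) * x\<close>.\<close>
  define e where "e = excess * eps / (4 * (1 + eps))"
  have e: "e > 0" using ex eps by (simp add: e_def)
  have e2: "(excess - 2 * e) * ((1 + eps) / excess) = 1 + eps / 2" "excess - 2 * e > 0"
  proof -
    have *: "excess * eps / (4 * s) / excess * s = eps / 4" if "s \<noteq> 0" for s using ex that by simp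
    have q: "e / excess * (1 + eps) = eps / 4" unfolding e_def by (rule *) (use eps in simp)
    have "(excess - 2 * e) * ((1 + eps) / excess) = excess / excess * (1 + eps) - 2 * (e / excess * (1 + eps))"
      by (simp add: left_diff_distrib diff_divide_distrib)
    then show *: "(excess - 2 * e) * ((1 + eps) / excess) = 1 + eps / 2" using ex unfolding q by simp
    show "excess - 2 * e > 0"
    proof (rule ccontr)
      assume "\<not> excess - 2 * e > 0"
      then have "(excess - 2 * e) * ((1 + eps) / excess) \<le> 0" using ex eps by (intro mult_nonpos_nonneg) auto
      with * eps show False by simp
    qed
  qed
  obtain C0 z0 where C0: "C0 > 0" "z0 > 0"
    and B: "\<And>z c w n. \<bar>z\<bar> \<le> z0 \<Longrightarrow> 0 \<le> c \<Longrightarrow> (\<And>k. 0 \<le> w k) \<Longrightarrow> (\<And>k. w k \<le> 1 + z * real k + c * (real k)\<^sup>2) \<Longrightarrow>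
      weight_mean w (Suc n)
      \<le> ennreal (4 * exp (real n * (z * excess + \<bar>z\<bar> * e + C0 * (c + z\<^sup>2)))) * (\<integral>\<^sup>+\<omega>. ennreal (w (N 0 \<omega> - 1)) \<partial>M)"
    by (rule exp_product_bound[OF e]) blast
  define h where "h = min z0 (e / (2 * C0))"
  have h: "h > 0" "h \<le> z0" "2 * C0 * h \<le> e" using C0 e by (auto simp: h_def min_def field_simps)
  define w where "w k = exp (- h * real k)" for k :: nat
  have w: "0 \<le> w k" "w k \<le> 1 + (- h) * real k + h\<^sup>2 * (real k)\<^sup>2" "w k \<le> 1" for k
  proof -
    have "w k \<le> 1 + (- h * real k) + (- h * real k)\<^sup>2 / 2"
      unfolding w_def using h by (intro exp_quadratic_nonpos) (simp add: mult_nonneg_nonneg)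
    moreover have "(- h * real k)\<^sup>2 = h\<^sup>2 * (real k)\<^sup>2" by (simp add: power_mult_distrib)
    moreover have "h\<^sup>2 * (real k)\<^sup>2 \<ge> 0" by simp
    ultimately show "w k \<le> 1 + (- h) * real k + h\<^sup>2 * (real k)\<^sup>2" by linarith
    show "0 \<le> w k" "w k \<le> 1" using h by (simp_all add: w_def)
  qed
  have "prob {\<omega> \<in> space M. real (S k \<omega>) \<le> x} \<le> (4 * exp (h * excess)) * exp (- (h * eps / 2) * x)"
    if k: "k \<ge> 1" "(1 + eps) * x / excess \<le> real k" for x k
  proof -
    obtain n where n: "k = Suc n" using k by (cases k) auto
    have i: "weight_mean w k \<le> ennreal (4 * exp (- (h * ((1 + eps / 2) * x - excess))))"
    proof -
      have "weight_mean w k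
        \<le> ennreal (4 * exp (real n * (- h * excess + \<bar>- h\<bar> * e + C0 * (h\<^sup>2 + (- h)\<^sup>2)))) * (\<integral>\<^sup>+\<omega>. ennreal (w (N 0 \<omega> - 1)) \<partial>M)"
        unfolding n using h w(1,2) by (intro B) auto
      also have "\<dots> \<le> ennreal (4 * exp (real n * (- h * excess + \<bar>- h\<bar> * e + C0 * (h\<^sup>2 + (- h)\<^sup>2)))) * (\<integral>\<^sup>+\<omega>. 1 \<partial>M)"
        using w(3) by (intro mult_left_mono nn_integral_mono) (auto simp flip: ennreal_1 intro!: ennreal_leI)
      also have "\<dots> \<le> ennreal (4 * exp (- (h * ((1 + eps / 2) * x - excess))))"
      proof -
        have "h * (2 * C0 * h) \<le> h * e" using h by (intro mult_left_mono) auto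
        then have "- h * excess + \<bar>- h\<bar> * e + C0 * (h\<^sup>2 + (- h)\<^sup>2) \<le> - (h * (excess - 2 * e))"
          using h by (simp add: algebra_simps power2_eq_square)
        then have "real n * (- h * excess + \<bar>- h\<bar> * e + C0 * (h\<^sup>2 + (- h)\<^sup>2)) \<le> real n * - (h * (excess - 2 * e))"
          by (rule mult_left_mono) simp
        also have "\<dots> = - (h * ((excess - 2 * e) * real n))" by simp
        \<comment> \<open>Only \<open>n = k - 1\<close> slots after the initial one contribute; the
          missing slot costs at most \<open>excess\<close>.\<close>
        also have "\<dots> \<le> - (h * ((1 + eps / 2) * x - excess))"
        proof -
          have "(excess - 2 * e) * ((1 + eps) * x / excess - 1) \<le> (excess - 2 * e) * real n"
            using k(2) e2(2) by (intro mult_left_mono) (auto simp: n)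
          moreover have "(excess - 2 * e) * ((1 + eps) * x / excess - 1) = (1 + eps / 2) * x - (excess - 2 * e)"
          proof -
            have "a * (s * x / m - 1) = (a * (s / m)) * x - a" for a s m :: real
              by (simp add: right_diff_distrib)
            then show ?thesis by (simp only: e2(1))
          qed
          ultimately have "(1 + eps / 2) * x - excess \<le> (excess - 2 * e) * real n" using e by linarith
          then show ?thesis using h by simp
        qed
        finally show ?thesis by (simp add: emeasure_space_1 ennreal_leI)
      qed
      finally show ?thesis .
    qed
    have "prob {\<omega> \<in> space M. real (S k \<omega>) \<le> x} \<le> exp (h * x) * (4 * exp (- (h * ((1 + eps / 2) * x - excess))))"
    proof (rule prob_le_weight_mean[OF _ w(1) _ _ _ i])
      fix \<omega> assume "real (S k \<omega>) \<le> x"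
      then have "h * real (S k \<omega>) \<le> h * x" using h by (intro mult_left_mono) auto
      then have "1 \<le> exp (h * x) * exp (- h * real (S k \<omega>))"
        by (simp add: exp_add[symmetric])
      also have "exp (- h * real (S k \<omega>)) = (\<Prod>l<k. w (N l \<omega> - 1))"
        unfolding w_def by (rule prod_exp[symmetric])
      finally show "1 \<le> exp (h * x) * (\<Prod>l<k. w (N l \<omega> - 1))" .
    qed simp_all
    also have "exp (h * x) * (4 * exp (- (h * ((1 + eps / 2) * x - excess)))) = (4 * exp (h * excess)) * exp (- (h * eps / 2) * x)"
      by (simp add: exp_add[symmetric] algebra_simps)
    finally show ?thesis .
  qed
  moreover have "h * eps / 2 > 0" using h eps by simp
  ultimately show ?thesis by (rule that[rotated])
qed

text \<open>Exponential moments need not exist, so the exponent must shrink with \<open>x\<close>.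
  With \<open>h = a * ln x / x\<close> and jumps cut at \<open>\<delta> * x\<close>, each factor
  \<open>exp (h * b)\<close> is only a fixed power of \<open>x\<close>, while the Chernoff gain
  \<open>exp (- (eps / 2) * h * x)\<close> is a power that \<open>a\<close> makes as negative as
  desired.\<close>

lemma upper_deviation:
  assumes ex: "excess > 0" and eps: "0 < eps" "eps < 1" and p: "p \<ge> 0"
  obtains \<delta> where "\<delta> > 0"
    "eventually (\<lambda>x. \<forall>k. real k \<le> (1 - eps) * x / excess \<longrightarrow> prob {\<omega> \<in> space M. x < real (S k \<omega>)}
       \<le> prob {\<omega> \<in> space M. \<exists>l<k. \<delta> * x < real (N l \<omega> - 1)} + 4 * x powr (- p)) at_top"
proof -
  define e where "e = excess * eps / 4"
  have e: "e > 0" using ex eps by (simp add: e_def)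
  obtain C0 z0 where C0: "C0 > 0" "z0 > 0"
    and B: "\<And>z c w n. \<bar>z\<bar> \<le> z0 \<Longrightarrow> 0 \<le> c \<Longrightarrow> (\<And>k. 0 \<le> w k) \<Longrightarrow> (\<And>k. w k \<le> 1 + z * real k + c * (real k)\<^sup>2) \<Longrightarrow>
      weight_mean w (Suc n)
      \<le> ennreal (4 * exp (real n * (z * excess + \<bar>z\<bar> * e + C0 * (c + z\<^sup>2)))) * (\<integral>\<^sup>+\<omega>. ennreal (w (N 0 \<omega> - 1)) \<partial>M)"
    by (rule exp_product_bound[OF e]) blast
  \<comment> \<open>With this choice \<open>eps / 2 * (h * x) = (p + 1) * ln x\<close>. The
    threshold \<open>\<delta> = 1 / (2 * a)\<close> gives \<open>h * b = ln x / 2\<close>, so the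
    truncated weight never exceeds the square root of \<open>x\<close>.\<close>
  define a where "a = 2 * (p + 1) / eps"
  have a: "a > 0" using eps p by (simp add: a_def)
  define \<delta> where "\<delta> = 1 / (2 * a)"
  have \<delta>: "\<delta> > 0" using a by (simp add: \<delta>_def)
  have "((\<lambda>x. a * (ln x / x)) \<longlongrightarrow> 0) at_top" by real_asymp
  from order_tendstoD(2)[OF this C0(2)] have ev1: "eventually (\<lambda>x. a * (ln x / x) < z0) at_top" .
  have "((\<lambda>x. 2 * C0 * (a * (ln x / x)) * x powr (1/2)) \<longlongrightarrow> 0) at_top" by real_asymp
  from order_tendstoD(2)[OF this e] have ev2: "eventually (\<lambda>x. 2 * C0 * (a * (ln x / x)) * x powr (1/2) < e) at_top" .
  have "eventually (\<lambda>x. \<forall>k. real k \<le> (1 - eps) * x / excess \<longrightarrow> prob {\<omega> \<in> space M. x < real (S k \<omega>)}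
       \<le> prob {\<omega> \<in> space M. \<exists>l<k. \<delta> * x < real (N l \<omega> - 1)} + 4 * x powr (- p)) at_top"
    using ev1 ev2 eventually_gt_at_top[of 1]
  proof eventually_elim
    case (elim x)
    define h where "h = a * (ln x / x)"
    define b where "b = \<delta> * x"
    have x: "x > 1" using elim by simp
    have h: "h > 0" using a x by (simp add: h_def)
    have b: "b \<ge> 0" using \<delta> x by (simp add: b_def)
    have hb: "h * b = ln x / 2" using a x by (simp add: h_def b_def \<delta>_def)
    have ehb: "exp (h * b) = x powr (1/2)" using x by (simp add: hb powr_def)
    have hx: "h * x = a * ln x" using x by (simp add: h_def)
    \<comment> \<open>The value 0 beyond \<open>b\<close> encodes the event that no jump exceeds
      \<open>b\<close>: the product of the weights vanishes as soon as one jump is larger.\<close>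
    define w where "w k = (if real k \<le> b then exp (h * real k) else 0)" for k :: nat
    define c where "c = h\<^sup>2 * exp (h * b)"
    have w: "0 \<le> w k" "w k \<le> 1 + h * real k + c * (real k)\<^sup>2" "w k \<le> exp (h * b)" for k
    proof -
      show "0 \<le> w k" by (simp add: w_def)
      show "w k \<le> exp (h * b)" using h by (simp add: w_def)
      show "w k \<le> 1 + h * real k + c * (real k)\<^sup>2"
      proof (cases "real k \<le> b")
        case True
        then have "w k \<le> 1 + h * real k + (h * real k)\<^sup>2 * exp (h * b)"
          using h unfolding w_def by (simp, intro exp_quadratic_nonneg) auto
        then show ?thesis by (simp add: c_def power_mult_distrib ac_simps)
      next
        case False
        then show ?thesis using h by (simp add: w_def c_def add_nonneg_nonneg)
      qed
    qed
    show ?case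
    proof (intro allI impI)
      fix k assume k: "real k \<le> (1 - eps) * x / excess"
      have "prob {\<omega> \<in> space M. x < real (S k \<omega>)} \<le> prob ({\<omega> \<in> space M. \<exists>l<k. \<delta> * x < real (N l \<omega> - 1)}
          \<union> {\<omega> \<in> space M. x < real (S k \<omega>) \<and> (\<forall>l<k. real (N l \<omega> - 1) \<le> b)})"
        by (intro finite_measure_mono) (auto simp: b_def not_less)
      also have "\<dots> \<le> prob {\<omega> \<in> space M. \<exists>l<k. \<delta> * x < real (N l \<omega> - 1)}
          + prob {\<omega> \<in> space M. x < real (S k \<omega>) \<and> (\<forall>l<k. real (N l \<omega> - 1) \<le> b)}"
        by (intro measure_Un_le) auto
      also have "prob {\<omega> \<in> space M. x < real (S k \<omega>) \<and> (\<forall>l<k. real (N l \<omega> - 1) \<le> b)} \<le> 4 * x powr (- p)"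
      proof (cases k)
        case 0
        then show ?thesis using x by (simp add: S_def)
      next
        case (Suc n)
        have i: "weight_mean w k \<le> ennreal (4 * exp ((1 - eps / 2) * (h * x)) * exp (h * b))"
        proof -
          have "weight_mean w k
            \<le> ennreal (4 * exp (real n * (h * excess + \<bar>h\<bar> * e + C0 * (c + h\<^sup>2)))) * (\<integral>\<^sup>+\<omega>. ennreal (w (N 0 \<omega> - 1)) \<partial>M)"
            unfolding Suc using h w(1,2) elim(1) by (intro B) (auto simp: h_def c_def)
          also have "\<dots> \<le> ennreal (4 * exp (real n * (h * excess + \<bar>h\<bar> * e + C0 * (c + h\<^sup>2)))) * (\<integral>\<^sup>+\<omega>. ennreal (exp (h * b)) \<partial>M)"
            using w(3) by (intro mult_left_mono nn_integral_mono) (auto intro!: ennreal_leI)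
          also have "\<dots> \<le> ennreal (4 * exp ((1 - eps / 2) * (h * x))) * (\<integral>\<^sup>+\<omega>. ennreal (exp (h * b)) \<partial>M)"
          proof (intro mult_right_mono ennreal_leI mult_left_mono)
            have "h\<^sup>2 * 1 \<le> c" unfolding c_def using h b by (intro mult_left_mono) auto
            then have "C0 * (c + h\<^sup>2) \<le> C0 * (2 * c)" using C0 by (intro mult_left_mono) auto
            also have "\<dots> = h * (2 * C0 * h * x powr (1/2))" by (simp add: c_def ehb power2_eq_square)
            \<comment> \<open>The second-order term is \<open>h\<close> times a constant multiple of
              \<open>ln x / x * x powr (1/2)\<close>, which tends to 0. A cut-off with
              \<open>h * b\<close> growing like \<open>ln x\<close> or faster would not give
              this.\<close>
            also have "\<dots> \<le> h * e" using h elim(2) unfolding h_def[symmetric] by (intro mult_left_mono) auto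
            finally have "real n * (h * excess + \<bar>h\<bar> * e + C0 * (c + h\<^sup>2)) \<le> real n * (h * (excess + 2 * e))"
              using h by (intro mult_left_mono) (auto simp: algebra_simps)
            also have "\<dots> \<le> ((1 - eps) * x / excess) * (h * (excess + 2 * e))"
              using k Suc h ex e by (intro mult_right_mono) auto
            also have "\<dots> = (1 - eps) * (1 + eps / 2) * (h * x)"
              using ex by (simp add: e_def field_simps)
            also have "\<dots> \<le> (1 - eps / 2) * (h * x)"
              using h x by (intro mult_right_mono) (auto simp: algebra_simps)
            finally show "exp (real n * (h * excess + \<bar>h\<bar> * e + C0 * (c + h\<^sup>2))) \<le> exp ((1 - eps / 2) * (h * x))"
              by simp
          qed auto
          finally show ?thesis by (simp add: emeasure_space_1 ennreal_mult)
        qed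
        have "prob {\<omega> \<in> space M. x < real (S k \<omega>) \<and> (\<forall>l<k. real (N l \<omega> - 1) \<le> b)}
            \<le> exp (- (h * x)) * (4 * exp ((1 - eps / 2) * (h * x)) * exp (h * b))"
        proof (rule prob_le_weight_mean[OF _ w(1) _ _ _ i])
          fix \<omega> assume A: "x < real (S k \<omega>) \<and> (\<forall>l<k. real (N l \<omega> - 1) \<le> b)"
          then have "h * x \<le> h * real (S k \<omega>)" using h by (intro mult_left_mono) auto
          then have "1 \<le> exp (- (h * x)) * exp (h * real (S k \<omega>))"
            by (simp add: exp_add[symmetric])
          also have "exp (h * real (S k \<omega>)) = (\<Prod>l<k. w (N l \<omega> - 1))"
            unfolding w_def prod_exp[symmetric] using A by (intro prod.cong) auto
          finally show "1 \<le> exp (- (h * x)) * (\<Prod>l<k. w (N l \<omega> - 1))" .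
        qed simp_all
        also have "exp (- (h * x)) * (4 * exp ((1 - eps / 2) * (h * x)) * exp (h * b)) = 4 * exp (- (eps / 2) * (h * x)) * exp (h * b)"
          by (simp add: exp_add[symmetric] algebra_simps)
        also have "- (eps / 2) * (h * x) = - (p + 1) * ln x" using eps by (simp add: hx a_def field_simps)
        also have "4 * exp (- (p + 1) * ln x) * exp (h * b) = 4 * (x powr (- (p + 1)) * x powr (1/2))"
          using x by (simp add: ehb powr_def)
        also have "x powr (- (p + 1)) * x powr (1/2) = x powr (- (p + 1) + 1/2)"
          by (rule powr_add[symmetric])
        \<comment> \<open>The spare power \<open>p + 1\<close> instead of \<open>p\<close> absorbs
          the square root of \<open>x\<close> contributed by the initial slot.\<close>
        also have "\<dots> \<le> x powr (- p)" using x by (intro powr_mono) auto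
        finally show ?thesis by simp
      qed
      finally show "prob {\<omega> \<in> space M. x < real (S k \<omega>)}
         \<le> prob {\<omega> \<in> space M. \<exists>l<k. \<delta> * x < real (N l \<omega> - 1)} + 4 * x powr (- p)" by simp
    qed
  qed
  with \<delta> show ?thesis by (rule that)
qed

section \<open>Laws of a single slot and of the stationary background chain\<close>

lemma N_tail:
  assumes n: "n \<ge> 1" and c: "\<And>i. i < d \<Longrightarrow> (\<Sum>j<d. \<Sum>l. Lam (l + k + 1) i j) \<le> c" "c \<ge> 0"
  shows "prob {\<omega> \<in> space M. k < N n \<omega>} \<le> c"
proof (rule prob_le_integral)
  let ?h = "\<lambda>m j. of_bool (k < m) :: ennreal"
  have st: "step ?h i \<le> ennreal c" if "i < d" for i
  proof -
    have "step ?h i = ennreal (\<Sum>j<d. \<Sum>l. Lam (l + k + 1) i j)"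
      unfolding step_def suminf_tail_of_bool(1)[where f = "\<lambda>k. Lam k i _", OF Lam_nonneg Lam_summable]
      by (intro sum_ennreal suminf_tail_of_bool(2) Lam_nonneg Lam_summable)
    then show ?thesis using c(1)[OF that] by (simp add: ennreal_leI)
  qed
  have "(\<integral>\<^sup>+\<omega>. of_bool (k < N n \<omega>) \<partial>M) = (\<integral>\<^sup>+\<omega>. step ?h (J (n - 1) \<omega>) \<partial>M)"
    using nn_integral_step[OF n, of "\<lambda>_. 1" ?h] by simp
  also have "\<dots> \<le> (\<integral>\<^sup>+\<omega>. ennreal c \<partial>M)" using st[OF J_range] by (rule nn_integral_mono)
  finally show "(\<integral>\<^sup>+\<omega>. of_bool (k < N n \<omega>) \<partial>M) \<le> ennreal c" by (simp add: emeasure_space_1)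
qed (use c in auto, measurable)

lemma nn_integral_state:
  assumes n: "n \<ge> 1"
  shows "(\<integral>\<^sup>+\<omega>. h (N n \<omega>) (J n \<omega>) \<partial>M) = (\<Sum>i<d. ennreal (prob {\<omega> \<in> space M. J (n - 1) \<omega> = i}) * step h i)"
proof -
  have "(\<integral>\<^sup>+\<omega>. h (N n \<omega>) (J n \<omega>) \<partial>M) = (\<integral>\<^sup>+\<omega>. step h (J (n - 1) \<omega>) \<partial>M)"
    using nn_integral_step[OF n, of "\<lambda>_. 1" h] by simp
  also have "\<dots> = (\<integral>\<^sup>+\<omega>. (\<Sum>i<d. step h i * indicator {\<omega> \<in> space M. J (n - 1) \<omega> = i} \<omega>) \<partial>M)"
  proof (rule nn_integral_cong)
    fix \<omega> assume "\<omega> \<in> space M"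
    then have "(\<Sum>i<d. step h i * indicator {\<omega> \<in> space M. J (n - 1) \<omega> = i} \<omega>)
      = (\<Sum>i\<in>{J (n - 1) \<omega>}. step h i * indicator {\<omega> \<in> space M. J (n - 1) \<omega> = i} \<omega>)"
      using J_range[of "n - 1" \<omega>] by (intro sum.mono_neutral_right) (auto simp: indicator_def)
    then show "step h (J (n - 1) \<omega>) = (\<Sum>i<d. step h i * indicator {\<omega> \<in> space M. J (n - 1) \<omega> = i} \<omega>)"
      using \<open>\<omega> \<in> space M\<close> by simp
  qed
  also have "\<dots> = (\<Sum>i<d. \<integral>\<^sup>+\<omega>. step h i * indicator {\<omega> \<in> space M. J (n - 1) \<omega> = i} \<omega> \<partial>M)"
    by (rule nn_integral_sum) measurable
  also have "\<dots> = (\<Sum>i<d. ennreal (prob {\<omega> \<in> space M. J (n - 1) \<omega> = i}) * step h i)"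
    by (subst nn_integral_cmult_indicator) (auto simp: emeasure_eq_measure mult.commute)
  finally show ?thesis .
qed

lemma stationary_states:
  assumes J0: "\<And>j. j < d \<Longrightarrow> prob {\<omega> \<in> space M. J 0 \<omega> = j} = phi j"
  shows "j < d \<Longrightarrow> prob {\<omega> \<in> space M. J n \<omega> = j} = phi j"
proof (induction n arbitrary: j)
  case (Suc n)
  let ?h = "\<lambda>m j'. of_bool (j' = j) :: ennreal"
  have st: "step ?h i = ennreal (Lam_sum Lam i j)" for i
  proof -
    have "step ?h i = (\<Sum>j'\<in>{j}. \<Sum>k. ennreal (Lam (Suc k) i j') * of_bool (j' = j))"
      unfolding step_def using Suc.prems by (intro sum.mono_neutral_right) auto
    also have "\<dots> = ennreal (Lam_sum Lam i j)"
      unfolding Lam_sum_def using Lam_nonneg Lam_summable[of i j] by (simp add: suminf_ennreal2)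
    finally show ?thesis .
  qed
  have "ennreal (prob {\<omega> \<in> space M. J (Suc n) \<omega> = j}) = (\<integral>\<^sup>+\<omega>. indicator {\<omega> \<in> space M. J (Suc n) \<omega> = j} \<omega> \<partial>M)"
    by (simp add: emeasure_eq_measure)
  also have "\<dots> = (\<integral>\<^sup>+\<omega>. ?h (N (Suc n) \<omega>) (J (Suc n) \<omega>) \<partial>M)"
    by (intro nn_integral_cong) (auto simp: indicator_def)
  also have "\<dots> = (\<Sum>i<d. ennreal (prob {\<omega> \<in> space M. J n \<omega> = i}) * ennreal (Lam_sum Lam i j))"
    by (subst nn_integral_state) (simp_all add: st)
  also have "\<dots> = (\<Sum>i<d. ennreal (phi i * Lam_sum Lam i j))"
    using Suc phi_nonneg Q_nonneg by (intro sum.cong) (auto simp: ennreal_mult)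
  also have "\<dots> = ennreal (phi j)"
    using Suc.prems phi_nonneg Q_nonneg phi_stat[of j] by (subst sum_ennreal) auto
  finally show ?case using phi_nonneg[OF Suc.prems] by simp
qed (rule J0)

lemma stationary_mean:
  assumes J0: "\<And>j. j < d \<Longrightarrow> prob {\<omega> \<in> space M. J 0 \<omega> = j} = phi j" and n: "n \<ge> 1"
  shows "(\<integral>\<^sup>+\<omega>. of_nat (N n \<omega>) \<partial>M) = ennreal (arr_rate d phi Lam)"
proof -
  let ?m = "\<lambda>i j. \<Sum>k. real (Suc k) * Lam (Suc k) i j"
  have m0: "?m i j \<ge> 0" for i j
    using Lam_nonneg by (intro suminf_nonneg Lam_mean_summable) simp
  have st: "step (\<lambda>k j. of_nat k) i = ennreal (\<Sum>j<d. ?m i j)" for i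
  proof -
    have "(\<Sum>k. ennreal (Lam (Suc k) i j) * of_nat (Suc k)) = ennreal (?m i j)" for j
    proof -
      have "(\<Sum>k. ennreal (Lam (Suc k) i j) * of_nat (Suc k)) = (\<Sum>k. ennreal (real (Suc k) * Lam (Suc k) i j))"
        using Lam_nonneg by (simp add: ennreal_of_nat_eq_real_of_nat ennreal_mult mult.commute del: of_nat_Suc)
      also have "\<dots> = ennreal (?m i j)"
        using Lam_nonneg Lam_mean_summable[of i j] by (intro suminf_ennreal2) auto
      finally show ?thesis .
    qed
    then show ?thesis unfolding step_def using m0 by (simp add: sum_ennreal del: of_nat_Suc)
  qed
  have "(\<integral>\<^sup>+\<omega>. of_nat (N n \<omega>) \<partial>M) = (\<Sum>i<d. ennreal (prob {\<omega> \<in> space M. J (n - 1) \<omega> = i}) * ennreal (\<Sum>j<d. ?m i j))"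
    using nn_integral_state[OF n, of "\<lambda>k j. of_nat k"] st by simp
  also have "\<dots> = (\<Sum>i<d. ennreal (phi i * (\<Sum>j<d. ?m i j)))"
    using stationary_states[OF J0] phi_nonneg m0 by (intro sum.cong) (auto simp: ennreal_mult sum_nonneg)
  also have "\<dots> = ennreal (arr_rate d phi Lam)"
    using phi_nonneg m0 by (subst sum_ennreal) (auto simp: arr_rate_def sum_distrib_left intro!: mult_nonneg_nonneg sum_nonneg)
  finally show ?thesis .
qed

end

section \<open>Tail of the net input of an on-period\<close>

text \<open>Class \<open>C\<close> with the limits unpacked: a sufficiently small stretch of the
  argument costs at most the proportion \<open>eta\<close> of the tail, for all large
  arguments.\<close>

locale intermediate_tail =
  fixes F :: "real \<Rightarrow> real"
  assumes F_pos: "\<And>x. F x > 0" and F_anti: "antimono F"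
    and F_ratio: "\<And>eta. eta > 0 \<Longrightarrow> \<exists>v>1. eventually (\<lambda>x. (1 - eta) * F x \<le> F (v * x)) at_top"
begin

lemma F_mono: "x \<le> y \<Longrightarrow> F y \<le> F x" using F_anti by (auto simp: antimono_def)

text \<open>Iterates the ratio condition for \<open>eta = 1/2\<close>. A stretch by
  \<open>v > 1\<close> keeps the argument above the threshold, so one \<open>x0\<close> serves all
  \<open>n\<close>.\<close>

lemma doubling: obtains v x0 where "v > 1" "x0 > 0" "\<And>n x. x \<ge> x0 \<Longrightarrow> F x \<le> 2 ^ n * F (v ^ n * x)"
proof -
  obtain v where v: "v > 1" "eventually (\<lambda>x. (1 - 1 / 2) * F x \<le> F (v * x)) at_top"
    using F_ratio[of "1/2"] by auto
  then obtain x1 where "\<And>x. x \<ge> x1 \<Longrightarrow> (1 - 1 / 2) * F x \<le> F (v * x)"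
    unfolding eventually_at_top_linorder by blast
  then have x1: "F x \<le> 2 * F (v * x)" if "x \<ge> x1" for x using that by fastforce
  have "F x \<le> 2 ^ n * F (v ^ n * x)" if x: "x \<ge> max x1 1" for n x
  proof (induction n)
    case (Suc n)
    have "1 * x \<le> v ^ n * x" using v x by (intro mult_right_mono one_le_power) auto
    then have "x1 \<le> v ^ n * x" using x by linarith
    then have "F (v ^ n * x) \<le> 2 * F (v * (v ^ n * x))" by (rule x1)
    then have "2 ^ n * F (v ^ n * x) \<le> 2 ^ n * (2 * F (v * (v ^ n * x)))" by (rule mult_left_mono) simp
    also have "\<dots> = 2 ^ Suc n * F (v ^ Suc n * x)" by (simp add: ac_simps)
    finally show ?case using Suc by linarith
  qed simp
  with v show ?thesis by (intro that[of v "max x1 1"]) auto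
qed

lemma dominated: "\<exists>C>0. eventually (\<lambda>x. F x \<le> C * F (c * x)) at_top"
proof -
  obtain v x0 where v: "v > 1" "x0 > 0" "\<And>n x. x \<ge> x0 \<Longrightarrow> F x \<le> 2 ^ n * F (v ^ n * x)"
    using doubling by blast
  obtain n where n: "c < v ^ n" using real_arch_pow[OF v(1)] by blast
  have "eventually (\<lambda>x. F x \<le> 2 ^ n * F (c * x)) at_top"
    using eventually_ge_at_top[of x0]
  proof eventually_elim
    case (elim x)
    then have "c * x \<le> v ^ n * x" using n v(2) by (intro mult_right_mono) auto
    then have "2 ^ n * F (v ^ n * x) \<le> 2 ^ n * F (c * x)" by (intro mult_left_mono F_mono) auto
    with v(3)[OF elim, of n] show ?case by linarith
  qed
  then show ?thesis by (intro exI[of _ "2 ^ n"]) auto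
qed

text \<open>Along the geometric sequence \<open>v ^ n * x0\<close> the tail loses at most a factor 2
  per step, which is the decay of a power; monotonicity fills the gaps between consecutive
  points.\<close>

lemma polynomial_lower_bound:
  obtains c p where "c > 0" "p \<ge> 0" "eventually (\<lambda>x. c * x powr (- p) \<le> F x) at_top"
proof -
  obtain v x0 where v: "v > 1" "x0 > 0" "\<And>n x. x \<ge> x0 \<Longrightarrow> F x \<le> 2 ^ n * F (v ^ n * x)"
    using doubling by blast
  \<comment> \<open>The exponent for which \<open>v powr p = 2\<close>.\<close>
  define p where "p = ln 2 / ln v"
  have p: "p \<ge> 0" using v by (simp add: p_def)
  have vp: "v powr p = 2" using v by (simp add: p_def powr_def)
  define c where "c = F x0 / 2 * x0 powr p"
  have c: "c > 0" using F_pos[of x0] v by (simp add: c_def)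
  have "eventually (\<lambda>x. c * x powr (- p) \<le> F x) at_top"
    using eventually_ge_at_top[of x0]
  proof eventually_elim
    case (elim x)
    have x: "x > 0" using elim v by simp
    define n where "n = nat \<lfloor>log v (x / x0)\<rfloor>"
    have "log v (x / x0) \<ge> 0" using elim v by simp
    then have n: "real n \<le> log v (x / x0)" "log v (x / x0) \<le> real (Suc n)"
      unfolding n_def by linarith+
    have "v powr log v (x / x0) = x / x0" using v x by simp
    then have n1: "v ^ n \<le> x / x0" "x / x0 \<le> v ^ Suc n"
      using powr_mono[OF n(1), of v] powr_mono[OF n(2), of v] v powr_realpow[of v n] powr_realpow[of v "Suc n"] by auto
    have "2 ^ n = (v ^ n) powr p"
      using v by (simp add: vp[symmetric] powr_realpow[symmetric] powr_powr mult.commute)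
    also have "\<dots> \<le> (x / x0) powr p" using n1 v p by (intro powr_mono2) auto
    finally have n2: "2 ^ n \<le> x powr p / x0 powr p" using x v by (simp add: powr_divide)
    have "F x0 \<le> 2 ^ Suc n * F (v ^ Suc n * x0)" by (rule v(3)) simp
    also have "\<dots> \<le> 2 ^ Suc n * F x"
      using n1 v by (intro mult_left_mono F_mono) (auto simp: field_simps)
    also have "\<dots> = 2 * (2 ^ n * F x)" by simp
    also have "\<dots> \<le> 2 * (x powr p / x0 powr p * F x)"
      using n2 F_pos[of x] by (intro mult_left_mono mult_right_mono) auto
    finally have "F x0 * x0 powr p \<le> 2 * (x powr p * F x)" using v by (simp add: field_simps)
    then show ?case using x by (simp add: c_def powr_minus field_simps)
  qed
  with c p show ?thesis by (rule that)
qed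

lemma scale: assumes "m > 0" shows "intermediate_tail (\<lambda>x. F (x / m))"
proof
  show "antimono (\<lambda>x. F (x / m))" using assms by (auto simp: antimono_def intro!: F_mono divide_right_mono)
  fix eta :: real assume "eta > 0"
  then obtain v where v: "v > 1" "eventually (\<lambda>x. (1 - eta) * F x \<le> F (v * x)) at_top"
    using F_ratio by blast
  have "filterlim (\<lambda>x. x / m) at_top at_top" using assms by real_asymp
  from filterlim_iff[THEN iffD1, OF this, rule_format, OF v(2)] v(1)
  show "\<exists>v>1. eventually (\<lambda>x. (1 - eta) * F (x / m) \<le> F (v * x / m)) at_top" by auto
qed (rule F_pos)

end

lemma classC_intermediate_tail:
  assumes "prob_space M" and [measurable]: "X \<in> borel_measurable M" and C: "classC M X"
  shows "intermediate_tail (\<lambda>x. measure M {\<omega> \<in> space M. X \<omega> > x})"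
proof -
  interpret prob_space M by fact
  let ?F = "\<lambda>x. prob {\<omega> \<in> space M. X \<omega> > x}"
  show ?thesis
  proof
    show pos: "?F x > 0" for x using C by (auto simp: classC_def)
    show "antimono ?F" by (auto simp: antimono_def intro!: finite_measure_mono)
    fix eta :: real assume "eta > 0"
    then have "ereal (1 - eta) < 1" by (simp add: one_ereal_def)
    moreover have "((\<lambda>v. Liminf at_top (\<lambda>x::real. ereal (?F (v * x) / ?F x))) \<longlongrightarrow> (1::ereal)) (at_right 1)"
      using C by (auto simp: classC_def)
    ultimately have "eventually (\<lambda>v. ereal (1 - eta) < Liminf at_top (\<lambda>x::real. ereal (?F (v * x) / ?F x))) (at_right 1)"
      by (rule order_tendstoD(1)[rotated])
    then have "eventually (\<lambda>v. ereal (1 - eta) < Liminf at_top (\<lambda>x::real. ereal (?F (v * x) / ?F x)) \<and> 1 < v) (at_right 1)"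
      by (rule eventually_conj) (simp add: eventually_at_right_less)
    then obtain v where v: "v > 1" "ereal (1 - eta) < Liminf at_top (\<lambda>x::real. ereal (?F (v * x) / ?F x))"
      using eventually_happens'[OF trivial_limit_at_right_real] by blast
    from less_LiminfD[OF v(2)] have "eventually (\<lambda>x. (1 - eta) * ?F x \<le> ?F (v * x)) at_top"
    proof eventually_elim
      case (elim x)
      then show ?case using pos[of x] by (simp add: field_simps)
    qed
    with v(1) show "\<exists>v>1. eventually (\<lambda>x. (1 - eta) * ?F x \<le> ?F (v * x)) at_top" by blast
  qed
qed

context ergodic_bmap begin

text \<open>At a deterministic \<open>k\<close> slightly above or below \<open>x / excess\<close>
  the walk is on the expected side of \<open>x\<close>, up to deviation events that are small
  against the tail of \<open>I\<close>. As \<open>S\<close> is nondecreasing in time,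
  \<open>I\<close> larger or smaller than \<open>k\<close> then decides whether
  \<open>S (I \<omega>) \<omega>\<close> exceeds \<open>x\<close>, whatever the joint law of
  \<open>I\<close> and the walk. The shift of \<open>k\<close> costs little because the tail of
  \<open>I\<close> is of class \<open>C\<close>.\<close>

lemma tail_asymp:
  fixes I :: "'a \<Rightarrow> nat"
  assumes [measurable]: "I \<in> measurable M (count_space UNIV)" and ex: "excess > 0"
    and it: "intermediate_tail (\<lambda>x. prob {\<omega> \<in> space M. x < real (I \<omega>)})"
    and jumps: "\<And>\<delta> eta. \<delta> > 0 \<Longrightarrow> eta > 0 \<Longrightarrow> eventually (\<lambda>x. \<forall>k. real k \<le> x / excess \<longrightarrow>
        prob {\<omega> \<in> space M. \<exists>l<k. \<delta> * x < real (N l \<omega> - 1)} \<le> eta * prob {\<omega> \<in> space M. x / excess < real (I \<omega>)}) at_top"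
    and eta: "0 < eta" "eta < 1"
  shows "eventually (\<lambda>x. (1 - eta) * prob {\<omega> \<in> space M. x / excess < real (I \<omega>)} \<le> prob {\<omega> \<in> space M. x < real (S (I \<omega>) \<omega>)}
     \<and> prob {\<omega> \<in> space M. x < real (S (I \<omega>) \<omega>)} \<le> (1 + eta) * prob {\<omega> \<in> space M. x / excess < real (I \<omega>)}) at_top"
proof -
  define F where "F x = prob {\<omega> \<in> space M. x / excess < real (I \<omega>)}" for x
  interpret intermediate_tail F
    using intermediate_tail.scale[OF it ex] unfolding F_def .
  have SI[measurable]: "(\<lambda>\<omega>. S (I \<omega>) \<omega>) \<in> measurable M (count_space UNIV)"
    by (rule measurable_compose_countable[of "\<lambda>k \<omega>. S k \<omega>" M "count_space UNIV" I]) measurable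
  obtain c p where cp: "c > 0" "p \<ge> 0" "eventually (\<lambda>x. c * x powr (- p) \<le> F x) at_top"
    using polynomial_lower_bound by blast
  \<comment> \<open>A tail of class \<open>C\<close> dominates some negative power, so anything of
    smaller order than that power is negligible.\<close>
  have small: "eventually (\<lambda>x. g x \<le> e * F x) at_top" if "e > 0" "((\<lambda>x. g x / x powr (- p)) \<longlongrightarrow> 0) at_top" for g e
  proof -
    have "e * c > 0" using that cp by simp
    from order_tendstoD(2)[OF that(2) this] cp(3) eventually_gt_at_top[of 0] show ?thesis
    proof eventually_elim
      case (elim x)
      then have "g x \<le> e * (c * x powr (- p))" by (simp add: field_simps)
      also have "\<dots> \<le> e * F x" using elim that by (intro mult_left_mono) auto
      finally show ?case .
    qed
  qed
  have lower_half: "eventually (\<lambda>x. (1 - eta) * F x \<le> prob {\<omega> \<in> space M. x < real (S (I \<omega>) \<omega>)}) at_top"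
  proof -
    obtain v where v: "v > 1" "eventually (\<lambda>x. (1 - eta / 2) * F x \<le> F (v * x)) at_top"
      using F_ratio[of "eta / 2"] eta by auto
    \<comment> \<open>Half of the stretch goes into the deviation margin. The other half leaves room
      for an integer \<open>k\<close> between \<open>(1 + eps) * x / excess\<close> and
      \<open>v * x / excess\<close>.\<close>
    define eps where "eps = (v - 1) / 2"
    have eps: "eps > 0" using v by (simp add: eps_def)
    obtain b C where b: "b > 0" "\<And>x k. k \<ge> 1 \<Longrightarrow> (1 + eps) * x / excess \<le> real k \<Longrightarrow>
        prob {\<omega> \<in> space M. real (S k \<omega>) \<le> x} \<le> C * exp (- b * x)"
      by (rule lower_deviation[OF ex eps]) blast
    have "((\<lambda>x. C * exp (- b * x) / x powr (- p)) \<longlongrightarrow> 0) at_top" using b(1) by real_asymp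
    from small[OF _ this, of "eta / 2"] eta have "eventually (\<lambda>x. C * exp (- b * x) \<le> eta / 2 * F x) at_top" by simp
    then show ?thesis using v(2) eventually_ge_at_top[of 1] eventually_ge_at_top[of "excess / eps"]
    proof eventually_elim
      case (elim x)
      define k where "k = nat \<lceil>(1 + eps) * x / excess\<rceil>"
      have pos: "(1 + eps) * x / excess > 0" using eps elim(3) ex by (simp add: divide_pos_pos)
      then have k: "k \<ge> 1" "(1 + eps) * x / excess \<le> real k" "real k \<le> (1 + eps) * x / excess + 1"
        unfolding k_def by linarith+
      have "1 \<le> eps * x / excess" using elim(4) eps ex by (simp add: field_simps)
      then have "(1 + eps) * x / excess + 1 \<le> (1 + 2 * eps) * x / excess"
        by (simp add: distrib_right add_divide_distrib)
      moreover have "1 + 2 * eps = v" by (simp add: eps_def field_simps)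
      ultimately have kv: "real k \<le> v * x / excess" using k(3) by (simp only:)
      have "F (v * x) \<le> prob ({\<omega> \<in> space M. x < real (S (I \<omega>) \<omega>)} \<union> {\<omega> \<in> space M. real (S k \<omega>) \<le> x})"
        unfolding F_def
      proof (rule finite_measure_mono)
        show "{\<omega> \<in> space M. v * x / excess < real (I \<omega>)} \<subseteq> {\<omega> \<in> space M. x < real (S (I \<omega>) \<omega>)} \<union> {\<omega> \<in> space M. real (S k \<omega>) \<le> x}"
        proof -
          have "real (S k \<omega>) \<le> x" if A: "v * x / excess < real (I \<omega>)" "\<not> x < real (S (I \<omega>) \<omega>)" for \<omega>
          proof -
            have "k \<le> I \<omega>" using kv A(1) by linarith
            then have "S k \<omega> \<le> S (I \<omega>) \<omega>" by (rule S_mono)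
            then show ?thesis using A(2) by linarith
          qed
          then show ?thesis by blast
        qed
      qed measurable
      also have "\<dots> \<le> prob {\<omega> \<in> space M. x < real (S (I \<omega>) \<omega>)} + prob {\<omega> \<in> space M. real (S k \<omega>) \<le> x}"
        by (intro measure_Un_le) measurable
      also have "prob {\<omega> \<in> space M. real (S k \<omega>) \<le> x} \<le> eta / 2 * F x" using b(2)[OF k(1,2)] elim(1) by linarith
      finally have "(1 - eta / 2) * F x \<le> prob {\<omega> \<in> space M. x < real (S (I \<omega>) \<omega>)} + eta / 2 * F x" using elim(2) by linarith
      then show ?case by (simp add: algebra_simps)
    qed
  qed
  have upper_half: "eventually (\<lambda>x. prob {\<omega> \<in> space M. x < real (S (I \<omega>) \<omega>)} \<le> (1 + eta) * F x) at_top"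
  proof -
    obtain v where v: "v > 1" "eventually (\<lambda>x. (1 - eta / 4) * F x \<le> F (v * x)) at_top"
      using F_ratio[of "eta / 4"] eta by auto
    \<comment> \<open>Then \<open>(1 - eps) * x / excess\<close> is \<open>x / v / excess\<close>,
      the point at which the tail is compared with its value at \<open>x / excess\<close>.\<close>
    define eps where "eps = 1 - 1 / v"
    have eps: "0 < eps" "eps < 1" "1 - eps = 1 / v" using v by (auto simp: eps_def)
    have p1: "p + 1 \<ge> 0" using cp(2) by simp
    obtain \<delta> where \<delta>: "\<delta> > 0"
      "eventually (\<lambda>x. \<forall>k. real k \<le> (1 - eps) * x / excess \<longrightarrow> prob {\<omega> \<in> space M. x < real (S k \<omega>)}
       \<le> prob {\<omega> \<in> space M. \<exists>l<k. \<delta> * x < real (N l \<omega> - 1)} + 4 * x powr (- (p + 1))) at_top"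
      by (rule upper_deviation[OF ex eps(1,2) p1])
    have "((\<lambda>x. 4 * x powr (- (p + 1)) / x powr (- p)) \<longlongrightarrow> 0) at_top" by real_asymp
    from small[OF _ this, of "eta / 4"] eta have e1: "eventually (\<lambda>x. 4 * x powr (- (p + 1)) \<le> eta / 4 * F x) at_top" by simp
    have "eta / 4 > 0" using eta by simp
    from jumps[OF \<delta>(1) this] have e2: "eventually (\<lambda>x. \<forall>k. real k \<le> x / excess \<longrightarrow>
        prob {\<omega> \<in> space M. \<exists>l<k. \<delta> * x < real (N l \<omega> - 1)} \<le> eta / 4 * F x) at_top" unfolding F_def .
    have "filterlim (\<lambda>x. x / v) at_top at_top" using v by real_asymp
    from filterlim_iff[THEN iffD1, OF this, rule_format, OF v(2)]
    have e3: "eventually (\<lambda>x. (1 - eta / 4) * F (x / v) \<le> F x) at_top" using v by simp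
    from \<delta>(2) e1 e2 e3 eventually_gt_at_top[of 0] show ?thesis
    proof eventually_elim
      case (elim x)
      define k where "k = nat \<lfloor>x / v / excess\<rfloor>"
      have pos: "x / v / excess \<ge> 0" using v elim(5) ex by simp
      then have k: "real k \<le> x / v / excess" "x / v / excess < real k + 1" unfolding k_def by linarith+
      have k1: "real k \<le> (1 - eps) * x / excess" using k(1) by (simp add: eps)
      have "x / v \<le> x" using v elim(5) by (simp add: field_simps)
      then have k2: "real k \<le> x / excess" using k(1) ex divide_right_mono[of "x / v" x excess] by linarith
      have "prob {\<omega> \<in> space M. x < real (S (I \<omega>) \<omega>)} \<le> prob ({\<omega> \<in> space M. x / v / excess < real (I \<omega>)} \<union> {\<omega> \<in> space M. x < real (S k \<omega>)})"
      proof (rule finite_measure_mono)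
        show "{\<omega> \<in> space M. x < real (S (I \<omega>) \<omega>)} \<subseteq> {\<omega> \<in> space M. x / v / excess < real (I \<omega>)} \<union> {\<omega> \<in> space M. x < real (S k \<omega>)}"
        proof -
          have "x / v / excess < real (I \<omega>)" if A: "x < real (S (I \<omega>) \<omega>)" "\<not> x < real (S k \<omega>)" for \<omega>
          proof -
            have "\<not> I \<omega> \<le> k" using A S_mono[of "I \<omega>" k \<omega>] by linarith
            then show ?thesis using k(2) by linarith
          qed
          then show ?thesis by blast
        qed
      qed measurable
      also have "\<dots> \<le> F (x / v) + prob {\<omega> \<in> space M. x < real (S k \<omega>)}"
        unfolding F_def by (intro measure_Un_le) measurable
      also have "prob {\<omega> \<in> space M. x < real (S k \<omega>)} \<le> eta / 4 * F x + eta / 4 * F x"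
        using elim(1)[rule_format, OF k1] elim(3)[rule_format, OF k2] elim(2) by linarith
      also have "F (x / v) \<le> (1 + eta / 2) * F x"
      proof -
        have "(1 + eta / 2) * ((1 - eta / 4) * F (x / v)) \<le> (1 + eta / 2) * F x"
          using elim(4) eta by (intro mult_left_mono) auto
        moreover have "1 * F (x / v) \<le> ((1 + eta / 2) * (1 - eta / 4)) * F (x / v)"
        proof (rule mult_right_mono)
          have "eta * eta \<le> eta * 1" using eta by (intro mult_left_mono) auto
          moreover have "(1 + eta / 2) * (1 - eta / 4) = 1 + eta / 4 - eta * eta / 8" by (simp add: algebra_simps)
          ultimately show "1 \<le> (1 + eta / 2) * (1 - eta / 4)" using eta by linarith
        qed (use F_pos[of "x / v"] in simp)
        ultimately show ?thesis by (simp add: ac_simps)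
      qed
      finally show ?case by (simp add: algebra_simps)
    qed
  qed
  from eventually_conj[OF lower_half upper_half] show ?thesis unfolding F_def .
qed

end

section \<open>Integrated tails and equilibrium distributions\<close>

context prob_space begin

lemma tailsum_asymp:
  assumes X: "X \<in> measurable M (count_space UNIV)" "integrable M (\<lambda>\<omega>. real (X \<omega>))"
    and W: "W \<in> measurable M (count_space UNIV)" "integrable M (\<lambda>\<omega>. real (W \<omega>))"
    and pos: "\<And>n. tailsum (tail_prob W) n > 0"
    and ratio: "\<And>eta. 0 < eta \<Longrightarrow> eta < 1 \<Longrightarrow> eventually (\<lambda>n. (1 - eta) * tail_prob W n \<le> tail_prob X n \<and> tail_prob X n \<le> (1 + eta) * tail_prob W n) sequentially"
  shows "tailsum (tail_prob X) \<sim>[at_top] tailsum (tail_prob W)"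
proof -
  have s: "summable (\<lambda>k. tail_prob X (n + k))" "summable (\<lambda>k. tail_prob W (n + k))" for n
    using tail_prob_sums[OF X, of n] tail_prob_sums[OF W, of n] by (auto simp: summable_def)
  have b: "eventually (\<lambda>n. (1 - eta) * tailsum (tail_prob W) n \<le> tailsum (tail_prob X) n \<and>
      tailsum (tail_prob X) n \<le> (1 + eta) * tailsum (tail_prob W) n) sequentially" if "0 < eta" "eta < 1" for eta
    using eventually_all_ge_at_top[OF ratio[OF that]]
  proof eventually_elim
    case (elim n)
    then have "\<And>k. (1 - eta) * tail_prob W (n + k) \<le> tail_prob X (n + k)" "\<And>k. tail_prob X (n + k) \<le> (1 + eta) * tail_prob W (n + k)" by auto
    then show ?case unfolding tailsum_def suminf_mult[OF s(2), symmetric]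
      using s by (auto intro!: suminf_le summable_mult)
  qed
  have "(\<lambda>n. tailsum (tail_prob X) n / tailsum (tail_prob W) n) \<longlonglongrightarrow> 1"
  proof (rule tendstoI)
    fix e :: real assume e: "e > 0"
    define eta where "eta = min (e / 2) (1 / 2)"
    have eta: "0 < eta" "eta < 1" "eta < e" using e by (auto simp: eta_def)
    from b[OF eta(1,2)] show "eventually (\<lambda>n. dist (tailsum (tail_prob X) n / tailsum (tail_prob W) n) 1 < e) sequentially"
    proof eventually_elim
      case (elim n)
      then have "1 - eta \<le> tailsum (tail_prob X) n / tailsum (tail_prob W) n" "tailsum (tail_prob X) n / tailsum (tail_prob W) n \<le> 1 + eta"
        using pos[of n] by (simp_all add: field_simps)
      with eta show ?case by (simp add: dist_real_def abs_less_iff)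
    qed
  qed
  then show ?thesis by (rule asymp_equivI')
qed

text \<open>Rounding up preserves all integer tails, since \<open>n < ceiling z\<close> holds
  exactly when \<open>real n < z\<close>. It changes the integrated tail at \<open>n\<close> by at
  most \<open>tail_prob W n\<close>, which \<open>T_small_G\<close> makes negligible.\<close>

lemma tailsum_ceiling:
  fixes Z :: "'a \<Rightarrow> real"
  assumes [measurable]: "Z \<in> borel_measurable M" and Z: "\<And>\<omega>. Z \<omega> \<ge> 0" and int: "integrable M Z"
    and dt: "dominated_tail (tail_prob (\<lambda>\<omega>. nat \<lceil>Z \<omega>\<rceil>))"
  shows "(\<lambda>n. \<integral>\<omega>. max 0 (Z \<omega> - real n) \<partial>M) \<sim>[at_top] tailsum (tail_prob (\<lambda>\<omega>. nat \<lceil>Z \<omega>\<rceil>))"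
proof -
  define W where "W \<omega> = nat \<lceil>Z \<omega>\<rceil>" for \<omega>
  interpret dominated_tail "tail_prob W" using dt unfolding W_def .
  have Wm[measurable]: "W \<in> measurable M (count_space UNIV)" unfolding W_def by measurable
  have W: "Z \<omega> \<le> real (W \<omega>)" "real (W \<omega>) \<le> Z \<omega> + 1" for \<omega>
    using Z[of \<omega>] unfolding W_def by linarith+
  have Wi: "integrable M (\<lambda>\<omega>. real (W \<omega>))"
  proof (rule Bochner_Integration.integrable_bound)
    show "integrable M (\<lambda>\<omega>. Z \<omega> + 1)" using int by simp
    show "AE \<omega> in M. norm (real (W \<omega>)) \<le> norm (Z \<omega> + 1)" using W Z by (auto intro!: AE_I2)
  qed measurable
  have i1: "integrable M (\<lambda>\<omega>. max 0 (Z \<omega> - real n))" for n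
    by (rule Bochner_Integration.integrable_bound[OF int]) (use Z in \<open>auto simp: max_def intro!: AE_I2\<close>)
  have i2: "integrable M (\<lambda>\<omega>. real (W \<omega> - n))" for n
    by (rule Bochner_Integration.integrable_bound[OF Wi]) auto
  have G: "G n = (\<integral>\<omega>. real (W \<omega> - n) \<partial>M)" for n by (rule tailsum_tail_prob[OF Wm Wi])
  have u: "(\<integral>\<omega>. max 0 (Z \<omega> - real n) \<partial>M) \<le> G n" for n
    unfolding G
  proof (intro integral_mono i1 i2)
    show "max 0 (Z \<omega> - real n) \<le> real (W \<omega> - n)" for \<omega>
      using W(1)[of \<omega>] by linarith
  qed
  have l: "G n \<le> (\<integral>\<omega>. max 0 (Z \<omega> - real n) \<partial>M) + tail_prob W n" for n
  proof -
    have "G n \<le> (\<integral>\<omega>. max 0 (Z \<omega> - real n) + indicator {\<omega> \<in> space M. n < W \<omega>} \<omega> \<partial>M)"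
      unfolding G
    proof (intro integral_mono i2 Bochner_Integration.integrable_add i1)
      show "real (W \<omega> - n) \<le> max 0 (Z \<omega> - real n) + indicator {\<omega> \<in> space M. n < W \<omega>} \<omega>" if "\<omega> \<in> space M" for \<omega>
        using W[of \<omega>] that by (auto simp: indicator_def max_def of_nat_diff_real)
    qed (auto intro!: integrable_real_indicator simp: emeasure_eq_measure)
    also have "\<dots> = (\<integral>\<omega>. max 0 (Z \<omega> - real n) \<partial>M) + tail_prob W n"
      by (subst Bochner_Integration.integral_add[OF i1])
        (auto intro!: integrable_real_indicator simp: emeasure_eq_measure tail_prob_def)
    finally show ?thesis .
  qed
  have "(\<lambda>n. (\<integral>\<omega>. max 0 (Z \<omega> - real n) \<partial>M) / G n) \<longlonglongrightarrow> 1"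
  proof (rule tendstoI)
    fix e :: real assume e: "e > 0"
    then have "e / 2 > 0" by simp
    from T_small_G[OF this] show "eventually (\<lambda>n. dist ((\<integral>\<omega>. max 0 (Z \<omega> - real n) \<partial>M) / G n) 1 < e) sequentially"
    proof eventually_elim
      case (elim n)
      then have "1 - e / 2 \<le> (\<integral>\<omega>. max 0 (Z \<omega> - real n) \<partial>M) / G n" "(\<integral>\<omega>. max 0 (Z \<omega> - real n) \<partial>M) / G n \<le> 1"
        using u[of n] l[of n] G_pos[of n] by (simp_all add: field_simps)
      with e show ?case by (simp add: dist_real_def abs_less_iff)
    qed
  qed
  then show ?thesis unfolding W_def[symmetric, abs_def] by (rule asymp_equivI')
qed

text \<open>By Tonelli, the integral of \<open>P(X > y)\<close> over \<open>(0, x)\<close> is the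
  mean of \<open>min X x\<close>. Subtracting it from the mean of \<open>X\<close> leaves the mean
  of the excess over \<open>x\<close>.\<close>

lemma eq_tail_eq:
  fixes X :: "'a \<Rightarrow> real"
  assumes [measurable]: "X \<in> borel_measurable M" and X: "\<And>\<omega>. X \<omega> \<ge> 0" and int: "integrable M X"
    and x: "x \<ge> 0" and m: "(\<integral>\<omega>. X \<omega> \<partial>M) \<noteq> 0"
  shows "(\<integral>\<omega>. X \<omega> \<partial>M) * eq_tail M X x = (\<integral>\<omega>. max 0 (X \<omega> - x) \<partial>M)"
proof -
  let ?f = "\<lambda>y. prob {\<omega> \<in> space M. X \<omega> > y}"
  have i2: "integrable M (\<lambda>\<omega>. min (X \<omega>) x)"
    by (rule Bochner_Integration.integrable_bound[OF int]) (use X x in \<open>auto simp: min_def intro!: AE_I2\<close>)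
  have [measurable]: "?f \<in> borel_measurable borel"
  proof -
    have "antimono ?f" by (auto simp: antimono_def intro!: finite_measure_mono)
    then have "mono (\<lambda>y. - ?f y)" by (auto simp: mono_def antimono_def)
    then have "(\<lambda>y. - (- ?f y)) \<in> borel_measurable borel"
      by (intro borel_measurable_uminus borel_measurable_mono)
    then show ?thesis by simp
  qed
  interpret P: pair_sigma_finite lborel M ..
  have "(\<integral>\<^sup>+y. ennreal (indicator {0<..<x} y * ?f y) \<partial>lborel) =
      (\<integral>\<^sup>+y. (\<integral>\<^sup>+\<omega>. of_bool (0 < y \<and> y < x \<and> y < X \<omega>) \<partial>M) \<partial>lborel)"
  proof (rule nn_integral_cong)
    fix y :: real
    have "(\<integral>\<^sup>+\<omega>. of_bool (0 < y \<and> y < x \<and> y < X \<omega>) \<partial>M) = (\<integral>\<^sup>+\<omega>. indicator {0<..<x} y * indicator {\<omega> \<in> space M. X \<omega> > y} \<omega> \<partial>M)"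
      by (intro nn_integral_cong) (auto simp: indicator_def)
    also have "\<dots> = indicator {0<..<x} y * emeasure M {\<omega> \<in> space M. X \<omega> > y}"
      by (rule nn_integral_cmult_indicator) measurable
    finally show "ennreal (indicator {0<..<x} y * ?f y) = (\<integral>\<^sup>+\<omega>. of_bool (0 < y \<and> y < x \<and> y < X \<omega>) \<partial>M)"
      by (simp add: emeasure_eq_measure indicator_def)
  qed
  also have "\<dots> = (\<integral>\<^sup>+\<omega>. (\<integral>\<^sup>+y. of_bool (0 < y \<and> y < x \<and> y < X \<omega>) \<partial>lborel) \<partial>M)"
    by (rule P.Fubini'[symmetric]) measurable
  also have "\<dots> = (\<integral>\<^sup>+\<omega>. ennreal (min (X \<omega>) x) \<partial>M)"
  proof (rule nn_integral_cong)
    fix \<omega>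
    have "(\<integral>\<^sup>+y. of_bool (0 < y \<and> y < x \<and> y < X \<omega>) \<partial>lborel) = (\<integral>\<^sup>+y. indicator {0<..<min (X \<omega>) x} y \<partial>lborel)"
      by (intro nn_integral_cong) (auto simp: indicator_def)
    also have "\<dots> = ennreal (min (X \<omega>) x)" using X[of \<omega>] x by simp
    finally show "(\<integral>\<^sup>+y. of_bool (0 < y \<and> y < x \<and> y < X \<omega>) \<partial>lborel) = ennreal (min (X \<omega>) x)" .
  qed
  also have "\<dots> = ennreal (\<integral>\<omega>. min (X \<omega>) x \<partial>M)"
    using X x by (intro nn_integral_eq_integral i2) (auto intro!: AE_I2)
  finally have *: "(\<integral>\<^sup>+y. ennreal (indicator {0<..<x} y * ?f y) \<partial>lborel) = ennreal (\<integral>\<omega>. min (X \<omega>) x \<partial>M)" .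
  have "(LBINT y=0..x. ?f y) = (\<integral>y. indicator {0<..<x} y * ?f y \<partial>lborel)"
    using x by (simp add: interval_lebesgue_integral_def zero_ereal_def einterval_eq set_lebesgue_integral_def)
  also have "\<dots> = (\<integral>\<omega>. min (X \<omega>) x \<partial>M)"
    using X x by (subst integral_eq_nn_integral) (auto simp: * intro!: integral_nonneg_AE AE_I2)
  finally have L: "(LBINT y=0..x. ?f y) = (\<integral>\<omega>. min (X \<omega>) x \<partial>M)" .
  have "(\<integral>\<omega>. X \<omega> \<partial>M) * eq_tail M X x = (\<integral>\<omega>. X \<omega> \<partial>M) - (\<integral>\<omega>. min (X \<omega>) x \<partial>M)"
    using m by (simp add: eq_tail_def L field_simps)
  also have "\<dots> = (\<integral>\<omega>. X \<omega> - min (X \<omega>) x \<partial>M)" using int i2 by simp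
  also have "\<dots> = (\<integral>\<omega>. max 0 (X \<omega> - x) \<partial>M)" by (intro Bochner_Integration.integral_cong) (auto simp: min_def max_def)
  finally show ?thesis .
qed

end

text \<open>Summation by parts: the square of \<open>k\<close> is replaced by its increments, which
  are of order \<open>k\<close> and are weighted by the tails.\<close>

lemma summable_square_by_tails:
  fixes a t :: "nat \<Rightarrow> real"
  assumes a: "\<And>k. a k \<ge> 0" "summable a" and t: "\<And>k. t k = (\<Sum>l. a (l + k))" and s: "summable (\<lambda>k. real k * t k)"
  shows "summable (\<lambda>k. (real k)\<^sup>2 * a k)"
proof -
  have t0: "t k \<ge> 0" for k
    unfolding t using a by (intro suminf_nonneg summable_ignore_initial_segment) auto
  have ta: "t k = a k + t (Suc k)" for k
    unfolding t using suminf_split_head[OF summable_ignore_initial_segment[OF a(2), of k]] by simp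
  \<comment> \<open>The boundary term is kept on the left so that the induction closes; it is
    nonnegative and is dropped afterwards.\<close>
  have *: "(\<Sum>k<n. (real k)\<^sup>2 * a k) + (real n)\<^sup>2 * t n \<le> (\<Sum>k<Suc n. 2 * (real k * t k))" for n
  proof (induction n)
    case (Suc n)
    have "(\<Sum>k<Suc n. (real k)\<^sup>2 * a k) + (real (Suc n))\<^sup>2 * t (Suc n)
      = (\<Sum>k<n. (real k)\<^sup>2 * a k) + (real n)\<^sup>2 * t n + (2 * real n + 1) * t (Suc n)"
      using ta[of n] by (simp add: power2_eq_square algebra_simps)
    also have "\<dots> \<le> (\<Sum>k<Suc n. 2 * (real k * t k)) + 2 * (real (Suc n) * t (Suc n))"
      using Suc.IH t0[of "Suc n"] by (simp add: algebra_simps)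
    finally show ?case by simp
  qed simp
  show ?thesis
  proof (rule summableI_nonneg_bounded[where x = "\<Sum>k. 2 * (real k * t k)"])
    fix n
    have "(\<Sum>k<n. (real k)\<^sup>2 * a k) \<le> (\<Sum>k<Suc n. 2 * (real k * t k))"
      using *[of n] t0[of n] by (smt (verit) mult_nonneg_nonneg zero_le_power2)
    also have "\<dots> \<le> (\<Sum>k. 2 * (real k * t k))"
      using t0 by (intro sum_le_suminf summable_mult s) auto
    finally show "(\<Sum>k<n. (real k)\<^sup>2 * a k) \<le> (\<Sum>k. 2 * (real k * t k))" .
  qed (simp add: a)
qed

section \<open>The initial slot and the mean of a random sum\<close>

context bmap begin

lemma nn_integral_pair:
  "(\<integral>\<^sup>+\<omega>. h (N n \<omega>) (J n \<omega>) \<partial>M)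
    = (\<Sum>j<d. \<Sum>k. ennreal (prob {\<omega> \<in> space M. N n \<omega> = Suc k \<and> J n \<omega> = j}) * h (Suc k) j)"
proof -
  let ?p = "\<lambda>k j. ennreal (prob {\<omega> \<in> space M. N n \<omega> = k \<and> J n \<omega> = j})"
  have "(\<integral>\<^sup>+\<omega>. h (N n \<omega>) (J n \<omega>) \<partial>M) = (\<integral>\<^sup>+kj. ?p (fst kj) (snd kj) * h (fst kj) (snd kj) \<partial>count_space UNIV)"
    using nn_integral_pair_indicator[of "\<lambda>_. True" h n] by (simp add: emeasure_eq_measure prod_eq_iff mult.commute)
  also have "\<dots> = (\<integral>\<^sup>+j. (\<integral>\<^sup>+k. ?p k j * h k j \<partial>count_space UNIV) \<partial>count_space UNIV)"
    by (subst nn_integral_snd_count_space[symmetric]) simp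
  also have "\<dots> = (\<integral>\<^sup>+j. (\<Sum>k. ?p (Suc k) j * h (Suc k) j) \<partial>count_space UNIV)"
  proof (intro nn_integral_cong)
    fix j
    have "N n \<omega> \<noteq> 0" for \<omega> using N_pos[of n \<omega>] by simp
    then have "{\<omega> \<in> space M. N n \<omega> = 0 \<and> J n \<omega> = j} = {}" by blast
    then have z: "?p 0 j = 0" by (simp only: measure_empty ennreal_0)
    have "(\<integral>\<^sup>+k. ?p k j * h k j \<partial>count_space UNIV) = (\<Sum>k. ?p k j * h k j)"
      by (rule nn_integral_count_space_nat)
    also have "\<dots> = (\<Sum>k. ?p (Suc k) j * h (Suc k) j)"
      using suminf_offset[of "\<lambda>k. ?p k j * h k j" 1] z by simp
    finally show "(\<integral>\<^sup>+k. ?p k j * h k j \<partial>count_space UNIV) = (\<Sum>k. ?p (Suc k) j * h (Suc k) j)" .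
  qed
  also have "\<dots> = (\<Sum>j. \<Sum>k. ?p (Suc k) j * h (Suc k) j)"
    by (rule nn_integral_count_space_nat)
  also have "\<dots> = (\<Sum>j<d. \<Sum>k. ?p (Suc k) j * h (Suc k) j)"
  proof (rule suminf_finite)
    fix j assume "j \<notin> {..<d}"
    then have "{\<omega> \<in> space M. N n \<omega> = Suc k \<and> J n \<omega> = j} = {}" for k using J_range[of n] by auto
    then show "(\<Sum>k. ?p (Suc k) j * h (Suc k) j) = 0" by (simp only: measure_empty ennreal_0 mult_zero_left suminf_zero)
  qed simp
  finally show ?thesis .
qed

lemma N_tail_0:
  assumes a: "\<And>k i. k \<ge> 1 \<Longrightarrow> i < d \<Longrightarrow> prob {\<omega> \<in> space M. N 0 \<omega> = k \<and> J 0 \<omega> = i} = alpha k i"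
    and s: "\<And>i. summable (\<lambda>k. alpha (Suc k) i)" and nn: "\<And>k i. alpha k i \<ge> 0"
  shows "prob {\<omega> \<in> space M. k < N 0 \<omega>} = (\<Sum>j<d. \<Sum>l. alpha (l + k + 1) j)"
proof -
  have "ennreal (prob {\<omega> \<in> space M. k < N 0 \<omega>}) = (\<integral>\<^sup>+\<omega>. indicator {\<omega> \<in> space M. k < N 0 \<omega>} \<omega> \<partial>M)"
    by (simp add: emeasure_eq_measure)
  also have "\<dots> = (\<integral>\<^sup>+\<omega>. of_bool (k < N 0 \<omega>) \<partial>M)"
    by (intro nn_integral_cong) (auto simp: indicator_def)
  also have "\<dots> = (\<Sum>j<d. \<Sum>m. ennreal (alpha (Suc m) j) * of_bool (k < Suc m))"
    by (subst nn_integral_pair[where h = "\<lambda>m j. of_bool (k < m)"]) (simp add: a)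
  also have "\<dots> = ennreal (\<Sum>j<d. \<Sum>l. alpha (l + k + 1) j)"
    unfolding suminf_tail_of_bool(1)[where f = "\<lambda>k. alpha k _", OF nn s]
    by (intro sum_ennreal suminf_tail_of_bool(2) nn s)
  finally show ?thesis
    by (subst (asm) ennreal_inj) (auto intro!: sum_nonneg suminf_tail_of_bool(2)[simplified] nn s)
qed

text \<open>Wald's identity: writing the sum as a series of \<open>N n\<close> restricted to
  \<open>n < I\<close>, each term needs only the independence of the event
  \<open>n + 1 \<le> I\<close> from \<open>N n\<close> in the same slot.\<close>

lemma random_sum_mean:
  fixes I :: "'a \<Rightarrow> nat"
  assumes [measurable]: "I \<in> measurable M (count_space UNIV)"
    and ind: "\<And>n k. prob {\<omega> \<in> space M. n + 1 \<le> I \<omega> \<and> N n \<omega> = k} = prob {\<omega> \<in> space M. n + 1 \<le> I \<omega>} * prob {\<omega> \<in> space M. N n \<omega> = k}"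
    and mean: "\<And>n. (\<integral>\<^sup>+\<omega>. of_nat (N n \<omega>) \<partial>M) = ennreal c"
  shows "(\<integral>\<^sup>+\<omega>. of_nat (\<Sum>n<I \<omega>. N n \<omega>) \<partial>M) = ennreal c * (\<integral>\<^sup>+\<omega>. of_nat (I \<omega>) \<partial>M)"
proof -
  have one: "(\<integral>\<^sup>+\<omega>. of_nat (N n \<omega>) * of_bool (n < I \<omega>) \<partial>M) = ennreal c * emeasure M {\<omega> \<in> space M. n < I \<omega>}" for n
  proof -
    have P: "(\<integral>\<^sup>+\<omega>. of_nat (N n \<omega>) * of_bool (Q \<omega>) \<partial>M) = (\<integral>\<^sup>+k. of_nat k * emeasure M {\<omega> \<in> space M. Q \<omega> \<and> N n \<omega> = k} \<partial>count_space UNIV)"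
      if [measurable]: "Measurable.pred M Q" for Q
    proof -
      have "(\<integral>\<^sup>+\<omega>. of_nat (N n \<omega>) * of_bool (Q \<omega>) \<partial>M) = (\<integral>\<^sup>+k. (\<integral>\<^sup>+\<omega>. of_nat (N n \<omega>) * of_bool (Q \<omega>) * indicator {\<omega>. N n \<omega> = k} \<omega> \<partial>M) \<partial>count_space UNIV)"
        by (rule nn_integral_partition) measurable
      also have "\<dots> = (\<integral>\<^sup>+k. (\<integral>\<^sup>+\<omega>. of_nat k * indicator {\<omega> \<in> space M. Q \<omega> \<and> N n \<omega> = k} \<omega> \<partial>M) \<partial>count_space UNIV)"
        by (intro nn_integral_cong) (auto simp: indicator_def)
      also have "\<dots> = (\<integral>\<^sup>+k. of_nat k * emeasure M {\<omega> \<in> space M. Q \<omega> \<and> N n \<omega> = k} \<partial>count_space UNIV)"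
        by (intro nn_integral_cong nn_integral_cmult_indicator) measurable
      finally show ?thesis .
    qed
    have "(\<integral>\<^sup>+\<omega>. of_nat (N n \<omega>) * of_bool (n < I \<omega>) \<partial>M)
      = (\<integral>\<^sup>+k. of_nat k * emeasure M {\<omega> \<in> space M. n < I \<omega> \<and> N n \<omega> = k} \<partial>count_space UNIV)"
      by (rule P) measurable
    also have "\<dots> = (\<integral>\<^sup>+k. emeasure M {\<omega> \<in> space M. n < I \<omega>} * (of_nat k * emeasure M {\<omega> \<in> space M. True \<and> N n \<omega> = k}) \<partial>count_space UNIV)"
      using ind[of n] by (simp add: emeasure_eq_measure ennreal_mult Suc_le_eq ac_simps)
    also have "\<dots> = emeasure M {\<omega> \<in> space M. n < I \<omega>} * (\<integral>\<^sup>+k. of_nat k * emeasure M {\<omega> \<in> space M. True \<and> N n \<omega> = k} \<partial>count_space UNIV)"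
      by (rule nn_integral_cmult) simp
    also have "(\<integral>\<^sup>+k. of_nat k * emeasure M {\<omega> \<in> space M. True \<and> N n \<omega> = k} \<partial>count_space UNIV) = ennreal c"
      using P[of "\<lambda>_. True"] mean[of n] by simp
    finally show ?thesis by (simp add: mult.commute)
  qed
  have "(\<integral>\<^sup>+\<omega>. of_nat (\<Sum>n<I \<omega>. N n \<omega>) \<partial>M) = (\<integral>\<^sup>+\<omega>. (\<Sum>n. of_nat (N n \<omega>) * of_bool (n < I \<omega>)) \<partial>M)"
  proof (rule nn_integral_cong)
    fix \<omega>
    have "(\<Sum>n. of_nat (N n \<omega>) * of_bool (n < I \<omega>) :: ennreal) = (\<Sum>n<I \<omega>. of_nat (N n \<omega>) * of_bool (n < I \<omega>))"
      by (rule suminf_finite) auto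
    then show "of_nat (\<Sum>n<I \<omega>. N n \<omega>) = (\<Sum>n. of_nat (N n \<omega>) * of_bool (n < I \<omega>) :: ennreal)" by simp
  qed
  also have "\<dots> = (\<Sum>n. \<integral>\<^sup>+\<omega>. of_nat (N n \<omega>) * of_bool (n < I \<omega>) \<partial>M)"
    by (rule nn_integral_suminf) measurable
  also have "\<dots> = ennreal c * (\<Sum>n. emeasure M {\<omega> \<in> space M. n < I \<omega>})" by (simp add: one)
  also have "(\<Sum>n. emeasure M {\<omega> \<in> space M. n < I \<omega>}) = (\<integral>\<^sup>+\<omega>. of_nat (I \<omega>) \<partial>M)"
    by (rule nn_integral_nat_function[symmetric]) measurable
  finally show ?thesis .
qed

end

section \<open>Loss probability\<close>

theorem theorem4p2:
  fixes M :: "'a measure"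
    and d :: nat
    and alpha :: "nat \<Rightarrow> nat \<Rightarrow> real"            (* alpha k i = alpha_i(k) *)
    and Lam :: "nat \<Rightarrow> nat \<Rightarrow> nat \<Rightarrow> real"        (* Lam k i j = Lambda_{i,j}(k) *)
    and phi :: "nat \<Rightarrow> real"
    and N J :: "int \<Rightarrow> nat \<Rightarrow> 'a \<Rightarrow> nat"
    and Ion Ioff :: "int \<Rightarrow> 'a \<Rightarrow> nat"
    and Y :: "real measure"                         (* law of Y *)
    and piK :: "nat \<Rightarrow> nat \<Rightarrow> real"                (* piK K = stationary law of L^(K) *)
  assumes M: "prob_space M"
    (* measurability and state spaces *)
    and meas_N: "\<And>m n. N m n \<in> measurable M (count_space UNIV)"
    and meas_J: "\<And>m n. J m n \<in> measurable M (count_space UNIV)"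
    and meas_Ion: "\<And>m. Ion m \<in> measurable M (count_space UNIV)"
    and meas_Ioff: "\<And>m. Ioff m \<in> measurable M (count_space UNIV)"
    and J_range: "\<And>m n \<omega>. J m n \<omega> < d"
    and N_pos: "\<And>m n \<omega>. N m n \<omega> \<ge> 1"
    and Ion_pos: "\<And>m \<omega>. Ion m \<omega> \<ge> 1"
    (* BMAP parameters *)
    and alpha_nonneg: "\<And>k i. alpha k i \<ge> 0"
    and alpha_summable: "\<And>i. summable (\<lambda>k. alpha (Suc k) i)"
    and alpha_prob: "prob_vector d (\<lambda>i. \<Sum>k. alpha (Suc k) i)"
    and Lam_nonneg: "\<And>k i j. Lam k i j \<ge> 0"
    and Lam_summable: "\<And>i j. summable (\<lambda>k. Lam (Suc k) i j)"
    and Lam_stoch: "stochastic_mat d (Lam_sum Lam)"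
    and Lam_irr: "irreducible_mat d (Lam_sum Lam)"
    and phi_prob: "prob_vector d phi"
    and phi_stat: "\<And>j. j < d \<Longrightarrow> phi j = (\<Sum>i<d. phi i * Lam_sum Lam i j)"
    and Lam_mean_summable: "\<And>i j. summable (\<lambda>k. real (Suc k) * Lam (Suc k) i j)"
    (* BMAP distribution within the m-th on-period *)
    and N0J0: "\<And>m k i. k \<ge> 1 \<Longrightarrow> i < d \<Longrightarrow>
        measure M {\<omega> \<in> space M. N m 0 \<omega> = k \<and> J m 0 \<omega> = i} = alpha k i"
    and NJ_step: "\<And>m n ks js k j. n \<ge> 1 \<Longrightarrow> k \<ge> 1 \<Longrightarrow> j < d \<Longrightarrow> js (n - 1) < d \<Longrightarrow>
        measure M {\<omega> \<in> space M. (\<forall>l<n. N m l \<omega> = ks l \<and> J m l \<omega> = js l) \<and> N m n \<omega> = k \<and> J m n \<omega> = j}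
        = Lam k (js (n - 1)) j * measure M {\<omega> \<in> space M. \<forall>l<n. N m l \<omega> = ks l \<and> J m l \<omega> = js l}"
    (* i.i.d. on-period tuples, i.i.d. off-periods, independent of each other *)
    and on_indep: "prob_space.indep_vars M (\<lambda>_. on_space) (on_data N J Ion) UNIV"
    and on_ident: "\<And>m. distr M on_space (on_data N J Ion m) = distr M on_space (on_data N J Ion 0)"
    and off_indep: "prob_space.indep_vars M (\<lambda>_. count_space UNIV) Ioff UNIV"
    and off_ident: "\<And>m. distr M (count_space UNIV) (Ioff m) = distr M (count_space UNIV) (Ioff 0)"
    and on_off_indep: "prob_space.indep_set M
        (sigma_sets (space M) {(\<lambda>\<omega> m. on_data N J Ion m \<omega>) -` A \<inter> space M | A. A \<in> sets (\<Pi>\<^sub>M m\<in>(UNIV::int set). on_space)})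
        (sigma_sets (space M) {(\<lambda>\<omega> m. Ioff m \<omega>) -` B \<inter> space M | B. B \<in> sets (\<Pi>\<^sub>M m\<in>(UNIV::int set). (count_space UNIV :: nat measure))})"
    (* stationary regime of the queue with capacity K *)
    and pi_stat: "\<And>K. stat_dist (qtrans M (Aon N Ion 0) (Ioff 0) K) K (piK K)"
    (* main hypotheses *)
    and lam_gt1: "arr_rate d phi Lam > 1"
    and Y_law: "prob_space Y" "sets Y = sets borel" "emeasure Y {..<0} = 0"
    and Y_S: "subexp_law Y"
    and alpha_tail: "\<And>i. i < d \<Longrightarrow>
        (\<lambda>k::nat. \<Sum>l. alpha (l + k + 1) i) \<in> O(\<lambda>k. measure Y {real k<..})"
    and Lam_tail: "\<And>i j. i < d \<Longrightarrow> j < d \<Longrightarrow>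
        (\<lambda>k::nat. \<Sum>l. Lam (l + k + 1) i j) \<in> O(\<lambda>k. measure Y {real k<..})"
    and EA_lt_EIoff: "(\<integral>\<^sup>+\<omega>. ennreal (real_of_int (Aon N Ion 0 \<omega>)) \<partial>M)
                       < (\<integral>\<^sup>+\<omega>. ennreal (real (Ioff 0 \<omega>)) \<partial>M)"
    and Ion_C: "classC M (\<lambda>\<omega>. real (Ion 0 \<omega>))"
    and Ion_mean: "integrable M (\<lambda>\<omega>. real (Ion 0 \<omega>))"
    and Y_Ion: "(\<lambda>x::real. x * measure Y {x<..}) \<in> o(\<lambda>x. measure M {\<omega> \<in> space M. real (Ion 0 \<omega>) > x})"
  shows "(\<lambda>K. ploss M (Aon N Ion 0) (Ion 0) K (piK K)) \<sim>[at_top]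
           (\<lambda>K. (arr_rate d phi Lam - 1) * (\<integral>\<omega>. real (Ion 0 \<omega>) \<partial>M)
                 / ((\<integral>\<omega>. real_of_int (Aon N Ion 0 \<omega>) \<partial>M) + (\<integral>\<omega>. real (Ion 0 \<omega>) \<partial>M))
                 * eq_tail M (\<lambda>\<omega>. real (Ion 0 \<omega>)) (real K / (arr_rate d phi Lam - 1)))
       \<and> ((\<forall>m n k. measure M {\<omega> \<in> space M. Ion m \<omega> \<ge> n + 1 \<and> N m n \<omega> = k}
                 = measure M {\<omega> \<in> space M. Ion m \<omega> \<ge> n + 1} * measure M {\<omega> \<in> space M. N m n \<omega> = k})
          \<and> (\<forall>k\<ge>1. \<forall>j<d. alpha k j = (\<Sum>i<d. phi i * Lam k i j))
          \<longrightarrow> (\<lambda>K. ploss M (Aon N Ion 0) (Ion 0) K (piK K)) \<sim>[at_top]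
               (\<lambda>K. (arr_rate d phi Lam - 1) / arr_rate d phi Lam
                     * eq_tail M (\<lambda>\<omega>. real (Ion 0 \<omega>)) (real K / (arr_rate d phi Lam - 1))))"
proof -
  interpret prob_space M by (rule M)
  note [measurable] = meas_N[of 0] meas_J[of 0] meas_Ion[of 0] meas_Ioff[of 0]
  define F where "F x = prob {\<omega> \<in> space M. x < real (Ion 0 \<omega>)}" for x
  define Yt where "Yt x = measure Y {x<..}" for x :: real
  interpret Ytail: prob_space Y by (rule Y_law)
  have Yt_mono: "x \<le> y \<Longrightarrow> Yt y \<le> Yt x" for x y
    unfolding Yt_def by (intro Ytail.finite_measure_mono) (auto simp: Y_law)
  have Yt_nonneg: "Yt x \<ge> 0" for x by (simp add: Yt_def)
  interpret Ftail: intermediate_tail F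
    using classC_intermediate_tail[OF M _ Ion_C] unfolding F_def by measurable
  have F_tail_prob: "F (real k) = tail_prob (Ion 0) k" for k by (simp add: F_def tail_prob_def)
  have F_summable: "summable (\<lambda>k. F (real k))"
    using sums_summable[OF tail_prob_sums[OF meas_Ion[of 0] Ion_mean, of 0]] by (simp add: F_tail_prob)
  have Y_small: "eventually (\<lambda>x. x * Yt x \<le> e * F x) at_top" if "e > 0" for e
    using landau_o.smallD[OF Y_Ion that] eventually_gt_at_top[of 0]
  proof eventually_elim
    case (elim x)
    then show ?case using Yt_nonneg[of x] by (simp add: Yt_def F_def)
  qed
  \<comment> \<open>Up to a constant, \<open>k\<close> times the jump tail is eventually at most the
    tail of the on-period, whose sum is the finite mean. Thus the jumps have a finite second
    moment.\<close>
  have Lam_sq: "summable (\<lambda>k. (real k)\<^sup>2 * Lam (Suc k) i j)" if ij: "i < d" "j < d" for i j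
  proof (rule summable_square_by_tails[where t = "\<lambda>k. \<Sum>l. Lam (l + k + 1) i j"])
    obtain c where c: "c > 0" "eventually (\<lambda>k. norm (\<Sum>l. Lam (l + k + 1) i j) \<le> c * norm (measure Y {real k<..})) sequentially"
      using landau_o.bigE[OF Lam_tail[OF ij]] by blast
    have "eventually (\<lambda>k. real k * Yt (real k) \<le> 1 * F (real k)) sequentially"
      by (rule eventually_compose_filterlim[OF Y_small filterlim_real_sequentially]) simp
    with c(2) have "eventually (\<lambda>k. norm (real k * (\<Sum>l. Lam (l + k + 1) i j)) \<le> c * F (real k)) sequentially"
    proof eventually_elim
      case (elim k)
      have "norm (real k * (\<Sum>l. Lam (l + k + 1) i j)) = real k * norm (\<Sum>l. Lam (l + k + 1) i j)"
        by (simp add: abs_mult)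
      also have "\<dots> \<le> real k * (c * Yt (real k))"
        using elim(1) by (intro mult_left_mono) (auto simp: Yt_def)
      also have "\<dots> = c * (real k * Yt (real k))" by simp
      also have "\<dots> \<le> c * F (real k)" using elim(2) c(1) by (intro mult_left_mono) auto
      finally show ?case .
    qed
    then show "summable (\<lambda>k. real k * (\<Sum>l. Lam (l + k + 1) i j))"
      by (rule summable_comparison_test_ev) (intro summable_mult F_summable)
  qed (auto simp: Lam_nonneg Lam_summable)
  interpret ergodic_bmap M d Lam "N 0" "J 0" phi
    by unfold_locales (fact meas_N meas_J J_range N_pos Lam_nonneg NJ_step Lam_stoch Lam_irr phi_prob phi_stat
      Lam_summable Lam_mean_summable Lam_sq | assumption)+
  have ex: "excess > 0" using lam_gt1 by (simp add: excess_def)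
  obtain C k0 where C: "C > 0" and N_bound: "\<And>k n. k \<ge> k0 \<Longrightarrow> prob {\<omega> \<in> space M. k < N 0 n \<omega>} \<le> C * Yt (real k)"
  proof -
    \<comment> \<open>The initial law and all rows are added up, which gives one constant and one
      threshold valid for every slot and every previous state.\<close>
    define t where "t k = (\<Sum>i<d. \<Sum>l. alpha (l + k + 1) i) + (\<Sum>i<d. \<Sum>j<d. \<Sum>l. Lam (l + k + 1) i j)" for k
    have "t \<in> O(\<lambda>k. measure Y {real k<..})"
      unfolding t_def by (intro sum_in_bigo big_sum_in_bigo alpha_tail Lam_tail) auto
    then obtain C where C: "C > 0" "eventually (\<lambda>k. norm (t k) \<le> C * norm (measure Y {real k<..})) sequentially"
      using landau_o.bigE by blast
    then obtain k0 where k0: "\<And>k. k \<ge> k0 \<Longrightarrow> norm (t k) \<le> C * norm (measure Y {real k<..})"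
      unfolding eventually_sequentially by blast
    have a0: "(\<Sum>i<d. \<Sum>l. alpha (l + k + 1) i) \<ge> 0" for k
      using summable_ignore_initial_segment[OF alpha_summable, of k] alpha_nonneg by (auto intro!: sum_nonneg suminf_nonneg)
    have l0: "(\<Sum>j<d. \<Sum>l. Lam (l + k + 1) i j) \<ge> 0" for k i
      using summable_ignore_initial_segment[OF Lam_summable, of k] Lam_nonneg by (auto intro!: sum_nonneg suminf_nonneg)
    have "prob {\<omega> \<in> space M. k < N 0 n \<omega>} \<le> C * Yt (real k)" if k: "k \<ge> k0" for k n
    proof -
      have "prob {\<omega> \<in> space M. k < N 0 n \<omega>} \<le> t k"
      proof (cases "n = 0")
        case True
        then show ?thesis using N_tail_0[OF N0J0 alpha_summable alpha_nonneg, of k] l0[of k]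
          by (simp add: t_def sum_nonneg)
      next
        case False
        show ?thesis
        proof (rule N_tail)
          fix i assume "i < d"
          then have "(\<Sum>j<d. \<Sum>l. Lam (l + k + 1) i j) \<le> (\<Sum>i<d. \<Sum>j<d. \<Sum>l. Lam (l + k + 1) i j)"
            using l0 by (intro member_le_sum[of i "{..<d}" "\<lambda>i. \<Sum>j<d. \<Sum>l. Lam (l + k + 1) i j"]) auto
          then show "(\<Sum>j<d. \<Sum>l. Lam (l + k + 1) i j) \<le> t k" using a0[of k] by (simp add: t_def)
        next
          show "t k \<ge> 0" unfolding t_def by (rule add_nonneg_nonneg[OF a0]) (rule sum_nonneg, rule l0)
        qed (use False in simp)
      qed
      also have "\<dots> \<le> C * Yt (real k)" using k0[OF k] Yt_nonneg[of "real k"] by (simp add: Yt_def)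
      finally show ?thesis .
    qed
    with C(1) show ?thesis by (rule that)
  qed
  \<comment> \<open>A union bound over at most \<open>x / excess\<close> slots costs a multiple of
    \<open>x * Yt (\<delta> * x)\<close>. This is of smaller order than
    \<open>F (\<delta> * x)\<close>, and dominated variation brings the argument back to
    \<open>x / excess\<close>.\<close>
  have jumps: "eventually (\<lambda>x. \<forall>k. real k \<le> x / excess \<longrightarrow>
        prob {\<omega> \<in> space M. \<exists>l<k. \<delta> * x < real (N 0 l \<omega> - 1)} \<le> eta * prob {\<omega> \<in> space M. x / excess < real (Ion 0 \<omega>)}) at_top"
    if \<delta>: "\<delta> > 0" and eta: "eta > 0" for \<delta> eta
  proof -
    obtain C1 where C1: "C1 > 0" "eventually (\<lambda>x. F x \<le> C1 * F (1 / (excess * \<delta>) * x)) at_top"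
      using Ftail.dominated by blast
    \<comment> \<open>Solves \<open>C / (excess * \<delta>) * e * C1 = eta\<close>, the product of
      all constants met in the chain of estimates below.\<close>
    define e where "e = eta * excess * \<delta> / (C * C1)"
    have e: "e > 0" using eta ex \<delta> C C1 by (simp add: e_def)
    have lim: "filterlim (\<lambda>x. \<delta> * x) at_top at_top" using \<delta> by real_asymp
    note ev = eventually_compose_filterlim[OF _ lim]
    from ev[OF C1(2)] ev[OF Y_small[OF e]] ev[OF eventually_ge_at_top[of "real k0"]] eventually_gt_at_top[of 0]
    show ?thesis
    proof eventually_elim
      case (elim x)
      \<comment> \<open>The bounds on \<open>N\<close> are stated at integers. From
        \<open>\<delta> * x < N - 1\<close> one gets \<open>m < N\<close>, because
        \<open>m \<le> \<delta> * x + 1\<close>.\<close>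
      define m where "m = nat \<lceil>\<delta> * x\<rceil>"
      have "\<delta> * x > 0" using \<delta> elim(4) by simp
      then have m: "\<delta> * x \<le> real m" "real m \<le> \<delta> * x + 1" unfolding m_def by linarith+
      have "m \<ge> k0" using m(1) elim(3) by linarith
      then have one: "prob {\<omega> \<in> space M. \<delta> * x < real (N 0 l \<omega> - 1)} \<le> C * Yt (\<delta> * x)" for l
      proof -
        have "m < N 0 l \<omega>" if "\<delta> * x < real (N 0 l \<omega> - 1)" for \<omega>
          using that m(2) N_pos[of l \<omega>] by linarith
        then have "{\<omega> \<in> space M. \<delta> * x < real (N 0 l \<omega> - 1)} \<subseteq> {\<omega> \<in> space M. m < N 0 l \<omega>}" by blast
        then have "prob {\<omega> \<in> space M. \<delta> * x < real (N 0 l \<omega> - 1)} \<le> prob {\<omega> \<in> space M. m < N 0 l \<omega>}"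
          by (rule finite_measure_mono) measurable
        also have "\<dots> \<le> C * Yt (real m)" by (rule N_bound) fact
        also have "\<dots> \<le> C * Yt (\<delta> * x)" using C m(1) by (intro mult_left_mono Yt_mono) auto
        finally show ?thesis .
      qed
      show ?case
      proof (intro allI impI)
        fix k assume k: "real k \<le> x / excess"
        have "{\<omega> \<in> space M. \<exists>l<k. \<delta> * x < real (N 0 l \<omega> - 1)} = (\<Union>l<k. {\<omega> \<in> space M. \<delta> * x < real (N 0 l \<omega> - 1)})" by auto
        also have "prob \<dots> \<le> (\<Sum>l<k. prob {\<omega> \<in> space M. \<delta> * x < real (N 0 l \<omega> - 1)})"
          by (rule measure_UNION_le) auto
        also have "\<dots> \<le> (\<Sum>l<k. C * Yt (\<delta> * x))" by (intro sum_mono one)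
        also have "\<dots> = real k * (C * Yt (\<delta> * x))" by simp
        also have "\<dots> \<le> x / excess * (C * Yt (\<delta> * x))"
          using k C Yt_nonneg by (intro mult_right_mono) auto
        also have "\<dots> = C / (excess * \<delta>) * (\<delta> * x * Yt (\<delta> * x))" using \<delta> ex by simp
        also have "\<dots> \<le> C / (excess * \<delta>) * (e * F (\<delta> * x))"
          using elim(2) C \<delta> ex by (intro mult_left_mono) auto
        also have "\<dots> \<le> C / (excess * \<delta>) * (e * (C1 * F (1 / (excess * \<delta>) * (\<delta> * x))))"
          using elim(1) C \<delta> ex e by (intro mult_left_mono) auto
        also have "\<dots> = eta * F (x / excess)" using C C1 \<delta> ex by (simp add: e_def)
        finally show "prob {\<omega> \<in> space M. \<exists>l<k. \<delta> * x < real (N 0 l \<omega> - 1)} \<le> eta * prob {\<omega> \<in> space M. x / excess < real (Ion 0 \<omega>)}"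
          by (simp add: F_def)
      qed
    qed
  qed
  define X where "X \<omega> = S (Ion 0 \<omega>) \<omega>" for \<omega>
  have X_meas[measurable]: "X \<in> measurable M (count_space UNIV)"
    unfolding X_def by (rule measurable_compose_countable[of "\<lambda>k \<omega>. S k \<omega>" M "count_space UNIV" "Ion 0"]) measurable
  \<comment> \<open>At least one arrival per on-slot makes the net input nonnegative, so the
    natural-number subtraction in \<open>S\<close> is exact.\<close>
  have Aon_eq: "Aon N Ion 0 = (\<lambda>\<omega>. int (X \<omega>))"
    using N_pos by (auto simp: Aon_def X_def S_def of_nat_diff)
  \<comment> \<open>An integer comparison variable: the net input that an on-period would produce at
    constant speed \<open>excess\<close>, rounded up.\<close>
  define W where "W \<omega> = nat \<lceil>excess * real (Ion 0 \<omega>)\<rceil>" for \<omega>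
  have W_meas[measurable]: "W \<in> measurable M (count_space UNIV)" unfolding W_def by measurable
  have tail_prob_W: "tail_prob W n = F (real n / excess)" for n
  proof -
    have "n < W \<omega> \<longleftrightarrow> real n / excess < real (Ion 0 \<omega>)" for \<omega>
    proof -
      have "n < W \<omega> \<longleftrightarrow> real n < excess * real (Ion 0 \<omega>)" unfolding W_def by linarith
      also have "\<dots> \<longleftrightarrow> real n / excess < real (Ion 0 \<omega>)" using ex by (simp add: field_simps)
      finally show ?thesis .
    qed
    then show ?thesis by (simp add: tail_prob_def F_def)
  qed
  have tails: "eventually (\<lambda>n. (1 - eta) * tail_prob W n \<le> tail_prob X n \<and> tail_prob X n \<le> (1 + eta) * tail_prob W n) sequentially"
    if "0 < eta" "eta < 1" for eta
    using eventually_compose_filterlim[OF tail_asymp[OF meas_Ion[of 0] ex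
          Ftail.intermediate_tail_axioms[unfolded F_def] jumps that] filterlim_real_sequentially]
    by (simp add: tail_prob_W[unfolded F_def] tail_prob_def[of X] X_def)
  have EI: "(\<integral>\<omega>. real (Ion 0 \<omega>) \<partial>M) \<ge> 1"
  proof -
    have "(\<integral>\<omega>. 1 \<partial>M) \<le> (\<integral>\<omega>. real (Ion 0 \<omega>) \<partial>M)"
      using Ion_pos[of 0] Ion_mean by (intro integral_mono) (auto simp: Suc_le_eq)
    then show ?thesis by (simp add: prob_space)
  qed
  \<comment> \<open>Finiteness of the mean input comes from the strict inequality with the mean
    off-period, which excludes the value infinity on the left.\<close>
  have X_int: "integrable M (\<lambda>\<omega>. real (X \<omega>))"
  proof (rule integrableI_nonneg)
    show "(\<integral>\<^sup>+\<omega>. ennreal (real (X \<omega>)) \<partial>M) < \<infinity>"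
      using EA_lt_EIoff by (simp add: Aon_eq order_less_le_trans)
  qed auto
  have Z_int: "integrable M (\<lambda>\<omega>. excess * real (Ion 0 \<omega>))" using Ion_mean by simp
  have W_int: "integrable M (\<lambda>\<omega>. real (W \<omega>))"
  proof (rule Bochner_Integration.integrable_bound)
    show "integrable M (\<lambda>\<omega>. excess * real (Ion 0 \<omega>) + 1)" using Z_int by simp
    have "real (W \<omega>) \<le> excess * real (Ion 0 \<omega>) + 1" for \<omega>
    proof -
      have "excess * real (Ion 0 \<omega>) \<ge> 0" using ex by simp
      then show ?thesis unfolding W_def by linarith
    qed
    then show "AE \<omega> in M. norm (real (W \<omega>)) \<le> norm (excess * real (Ion 0 \<omega>) + 1)"
      by (intro AE_I2) (auto intro: order_trans[OF _ abs_ge_self])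
  qed measurable
  interpret Fm: intermediate_tail "\<lambda>x. F (x / excess)" by (rule Ftail.scale[OF ex])
  obtain C2 where C2: "C2 > 0" "eventually (\<lambda>n. tail_prob W n \<le> C2 * tail_prob W (2 * n)) sequentially"
  proof -
    obtain C2 where "C2 > 0" "eventually (\<lambda>x. F (x / excess) \<le> C2 * F (2 * x / excess)) at_top"
      using Fm.dominated[of 2] by blast
    then show ?thesis
      using eventually_compose_filterlim[OF _ filterlim_real_sequentially] that[of C2]
      by (fastforce simp: tail_prob_W)
  qed
  have W_dom: "dominated_tail (tail_prob W)"
  proof
    show "tail_prob W n > 0" for n by (simp add: tail_prob_W Ftail.F_pos)
    show "antimono (tail_prob W)" by (simp add: antimono_def tail_prob_antimono W_meas)
    show "summable (tail_prob W)" using sums_summable[OF tail_prob_sums[OF W_meas W_int, of 0]] by simp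
    show "\<exists>C. eventually (\<lambda>n. tail_prob W n \<le> C * tail_prob W (2 * n)) sequentially" using C2 by blast
  qed
  interpret WT: dominated_tail "tail_prob W" by (rule W_dom)
  \<comment> \<open>Tail equivalence transfers positivity and dominated variation from
    \<open>W\<close> to \<open>X\<close>; any fixed constant would do, and 2 is convenient.\<close>
  have half: "eventually (\<lambda>n. tail_prob W n \<le> 2 * tail_prob X n \<and> tail_prob X n \<le> 2 * tail_prob W n) sequentially"
  proof -
    have "eventually (\<lambda>n. (1 - 1 / 2) * tail_prob W n \<le> tail_prob X n \<and> tail_prob X n \<le> (1 + 1 / 2) * tail_prob W n) sequentially"
      by (rule tails) simp_all
    then show ?thesis
    proof eventually_elim
      case (elim n)
      then show ?case using WT.T_pos[of n] by simp
    qed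
  qed
  have X_pos: "tail_prob X n > 0" for n
  proof -
    from half obtain n1 where "\<And>n. n \<ge> n1 \<Longrightarrow> tail_prob W n \<le> 2 * tail_prob X n" by (auto simp: eventually_sequentially)
    then have "0 < tail_prob X (max n n1)" using WT.T_pos[of "max n n1"] by (smt (verit) max.cobounded2)
    also have "\<dots> \<le> tail_prob X n" by (rule tail_prob_antimono) auto
    finally show ?thesis .
  qed
  have "filterlim (\<lambda>n::nat. 2 * n) at_top at_top" by (rule mult_nat_left_at_top) simp
  from eventually_compose_filterlim[OF half this] half C2(2)
  have "eventually (\<lambda>n. tail_prob X n \<le> 4 * C2 * tail_prob X (2 * n)) sequentially"
  proof eventually_elim
    case (elim n)
    have "C2 * tail_prob W (2 * n) \<le> C2 * (2 * tail_prob X (2 * n))" using elim C2 by (intro mult_left_mono) auto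
    with elim show ?case by linarith
  qed
  then have X_dom: "\<exists>C. eventually (\<lambda>n. tail_prob X n \<le> C * tail_prob X (2 * n)) sequentially" by blast
  have less: "(\<integral>\<^sup>+\<omega>. ennreal (real (X \<omega>)) \<partial>M) < (\<integral>\<^sup>+\<omega>. ennreal (real (Ioff 0 \<omega>)) \<partial>M)"
    using EA_lt_EIoff by (simp add: Aon_eq)
  have num: "(\<lambda>K. \<Sum>l\<le>K. piK K l * tailsum (tail_prob X) (K - l)) \<sim>[at_top] tailsum (tail_prob X)"
    by (rule overflow_asymp[OF X_meas meas_Ioff[of 0] X_int less pi_stat[unfolded Aon_eq] X_pos X_dom])
  have XW: "tailsum (tail_prob X) \<sim>[at_top] tailsum (tail_prob W)"
    by (rule tailsum_asymp[OF X_meas X_int W_meas W_int WT.G_pos tails])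
  have WZ: "tailsum (tail_prob W) \<sim>[at_top] (\<lambda>n. \<integral>\<omega>. max 0 (excess * real (Ion 0 \<omega>) - real n) \<partial>M)"
    using tailsum_ceiling[OF _ _ Z_int W_dom[unfolded W_def]] ex unfolding W_def[symmetric, abs_def]
    by (simp add: asymp_equiv_sym)
  have Z_eq: "(\<lambda>n. \<integral>\<omega>. max 0 (excess * real (Ion 0 \<omega>) - real n) \<partial>M) =
      (\<lambda>n. excess * (\<integral>\<omega>. real (Ion 0 \<omega>) \<partial>M) * eq_tail M (\<lambda>\<omega>. real (Ion 0 \<omega>)) (real n / excess))"
  proof
    fix n :: nat
    have "max 0 (excess * real (Ion 0 \<omega>) - real n) = excess * max 0 (real (Ion 0 \<omega>) - real n / excess)" for \<omega>
      using ex by (simp add: max_def field_simps)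
    then have "(\<integral>\<omega>. max 0 (excess * real (Ion 0 \<omega>) - real n) \<partial>M) = excess * (\<integral>\<omega>. max 0 (real (Ion 0 \<omega>) - real n / excess) \<partial>M)"
      by simp
    also have "(\<integral>\<omega>. max 0 (real (Ion 0 \<omega>) - real n / excess) \<partial>M) = (\<integral>\<omega>. real (Ion 0 \<omega>) \<partial>M) * eq_tail M (\<lambda>\<omega>. real (Ion 0 \<omega>)) (real n / excess)"
      using EI ex Ion_mean by (intro eq_tail_eq[symmetric]) auto
    finally show "(\<integral>\<omega>. max 0 (excess * real (Ion 0 \<omega>) - real n) \<partial>M) = excess * (\<integral>\<omega>. real (Ion 0 \<omega>) \<partial>M) * eq_tail M (\<lambda>\<omega>. real (Ion 0 \<omega>)) (real n / excess)"
      by simp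
  qed
  have main: "(\<lambda>K. \<Sum>l\<le>K. piK K l * tailsum (tail_prob X) (K - l)) \<sim>[at_top]
      (\<lambda>n. excess * (\<integral>\<omega>. real (Ion 0 \<omega>) \<partial>M) * eq_tail M (\<lambda>\<omega>. real (Ion 0 \<omega>)) (real n / excess))"
    using asymp_equiv_trans[OF num asymp_equiv_trans[OF XW WZ]] unfolding Z_eq .
  define EA where "EA = (\<integral>\<omega>. real (X \<omega>) \<partial>M)"
  define EI where "EI = (\<integral>\<omega>. real (Ion 0 \<omega>) \<partial>M)"
  have ploss_eq: "ploss M (Aon N Ion 0) (Ion 0) K (piK K) = (\<Sum>l\<le>K. piK K l * tailsum (tail_prob X) (K - l)) / (EA + EI)" for K
  proof -
    have "(\<integral>\<omega>. real (nat (int l + int (X \<omega>) - int K)) \<partial>M) = tailsum (tail_prob X) (K - l)" if "l \<le> K" for l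
    proof -
      have "nat (int l + int (X \<omega>) - int K) = X \<omega> - (K - l)" for \<omega> using that by auto
      then show ?thesis by (simp add: tailsum_tail_prob[OF X_meas X_int])
    qed
    moreover have "(\<integral>\<omega>. real_of_int (int (X \<omega>)) + real (Ion 0 \<omega>) \<partial>M) = EA + EI"
      using X_int Ion_mean by (simp add: EA_def EI_def)
    ultimately show ?thesis by (simp add: ploss_def Aon_eq)
  qed
  have first: "(\<lambda>K. ploss M (Aon N Ion 0) (Ion 0) K (piK K)) \<sim>[at_top]
      (\<lambda>K. excess * EI / (EA + EI) * eq_tail M (\<lambda>\<omega>. real (Ion 0 \<omega>)) (real K / excess))"
  proof -
    have "(\<lambda>K. (\<Sum>l\<le>K. piK K l * tailsum (tail_prob X) (K - l)) / (EA + EI)) \<sim>[at_top]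
      (\<lambda>K. excess * EI * eq_tail M (\<lambda>\<omega>. real (Ion 0 \<omega>)) (real K / excess) / (EA + EI))"
      using main unfolding EI_def by (intro asymp_equiv_divide asymp_equiv_refl)
    then show ?thesis by (simp add: ploss_eq)
  qed
  have EA_eq: "(\<integral>\<omega>. real_of_int (Aon N Ion 0 \<omega>) \<partial>M) = EA" by (simp add: Aon_eq EA_def)
  \<comment> \<open>\<open>EA + EI\<close> is the mean total number of arrivals per period, since
    \<open>A\<close> counts one arrival less in each of its slots.\<close>
  have second: "EA + EI = arr_rate d phi Lam * EI"
    if indep: "\<forall>m n k. measure M {\<omega> \<in> space M. Ion m \<omega> \<ge> n + 1 \<and> N m n \<omega> = k}
                 = measure M {\<omega> \<in> space M. Ion m \<omega> \<ge> n + 1} * measure M {\<omega> \<in> space M. N m n \<omega> = k}"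
      and al: "\<forall>k\<ge>1. \<forall>j<d. alpha k j = (\<Sum>i<d. phi i * Lam k i j)"
  proof -
    have pair: "(\<integral>\<^sup>+\<omega>. h (N 0 0 \<omega>) (J 0 0 \<omega>) \<partial>M) = (\<Sum>j<d. \<Sum>k. ennreal (alpha (Suc k) j) * h (Suc k) j)" for h
      by (subst nn_integral_pair) (simp add: N0J0)
    have al_sums: "(\<lambda>k. f k * alpha (Suc k) j) sums (\<Sum>i<d. phi i * (\<Sum>k. f k * Lam (Suc k) i j))"
      if "j < d" "\<And>i. summable (\<lambda>k. f k * Lam (Suc k) i j)" for j and f :: "nat \<Rightarrow> real"
    proof -
      have "(\<lambda>k. \<Sum>i<d. phi i * (f k * Lam (Suc k) i j)) sums (\<Sum>i<d. phi i * (\<Sum>k. f k * Lam (Suc k) i j))"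
        by (intro sums_sum sums_mult summable_sums that)
      moreover have "(\<Sum>i<d. phi i * (f k * Lam (Suc k) i j)) = f k * alpha (Suc k) j" for k
        using al that(1) by (simp add: sum_distrib_left ac_simps)
      ultimately show ?thesis by simp
    qed
    have J0: "prob {\<omega> \<in> space M. J 0 0 \<omega> = j} = phi j" if j: "j < d" for j
    proof -
      have "ennreal (prob {\<omega> \<in> space M. J 0 0 \<omega> = j}) = (\<integral>\<^sup>+\<omega>. indicator {\<omega> \<in> space M. J 0 0 \<omega> = j} \<omega> \<partial>M)"
        by (simp add: emeasure_eq_measure)
      also have "\<dots> = (\<integral>\<^sup>+\<omega>. of_bool (J 0 0 \<omega> = j) \<partial>M)"
        by (intro nn_integral_cong) (auto simp: indicator_def)
      also have "\<dots> = (\<Sum>j'<d. \<Sum>k. ennreal (alpha (Suc k) j') * of_bool (j' = j))"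
        by (rule pair[of "\<lambda>k j'. of_bool (j' = j)"])
      also have "\<dots> = (\<Sum>j'\<in>{j}. \<Sum>k. ennreal (alpha (Suc k) j') * of_bool (j' = j))"
        using j by (intro sum.mono_neutral_right) auto
      also have "\<dots> = ennreal (\<Sum>k. alpha (Suc k) j)"
        using alpha_nonneg alpha_summable[of j] by (simp add: suminf_ennreal2)
      also have "(\<Sum>k. alpha (Suc k) j) = phi j"
        using al_sums[of j "\<lambda>_. 1"] j Lam_summable phi_stat[OF j] by (simp add: sums_iff Lam_sum_def)
      finally show ?thesis using phi_nonneg[OF j] by simp
    qed
    \<comment> \<open>With the initial law \<open>phi\<close> times the kernel, slot 0 looks like a
      slot of the stationary process. It is computed separately because its law is given by
      \<open>alpha\<close>, whereas the Markov step covers only later slots.\<close>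
    have mean: "(\<integral>\<^sup>+\<omega>. of_nat (N 0 n \<omega>) \<partial>M) = ennreal (arr_rate d phi Lam)" for n
    proof (cases "n = 0")
      case True
      let ?m = "\<lambda>j. \<Sum>i<d. phi i * (\<Sum>k. real (Suc k) * Lam (Suc k) i j)"
      have s: "(\<lambda>k. real (Suc k) * alpha (Suc k) j) sums ?m j" if "j < d" for j
        using that Lam_mean_summable by (rule al_sums)
      have "(\<integral>\<^sup>+\<omega>. of_nat (N 0 n \<omega>) \<partial>M) = (\<Sum>j<d. \<Sum>k. ennreal (alpha (Suc k) j) * of_nat (Suc k))"
        unfolding True by (rule pair[of "\<lambda>k j. of_nat k"])
      also have "\<dots> = (\<Sum>j<d. ennreal (?m j))"
      proof (rule sum.cong[OF refl])
        fix j assume "j \<in> {..<d}"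
        have "(\<Sum>k. ennreal (alpha (Suc k) j) * of_nat (Suc k)) = (\<Sum>k. ennreal (real (Suc k) * alpha (Suc k) j))"
          using alpha_nonneg by (simp add: ennreal_of_nat_eq_real_of_nat ennreal_mult mult.commute del: of_nat_Suc)
        also have "\<dots> = ennreal (?m j)"
          using alpha_nonneg s[of j] \<open>j \<in> {..<d}\<close> by (subst suminf_ennreal2) (auto simp: sums_iff)
        finally show "(\<Sum>k. ennreal (alpha (Suc k) j) * of_nat (Suc k)) = ennreal (?m j)" .
      qed
      also have "\<dots> = ennreal (\<Sum>j<d. ?m j)"
        using phi_nonneg Lam_nonneg Lam_mean_summable
        by (intro sum_ennreal sum_nonneg mult_nonneg_nonneg suminf_nonneg) auto
      also have "(\<Sum>j<d. ?m j) = arr_rate d phi Lam" unfolding arr_rate_def by (rule sum.swap)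
      finally show ?thesis .
    qed (simp add: stationary_mean[OF J0])
    have "real (\<Sum>n<Ion 0 \<omega>. N 0 n \<omega>) = real (X \<omega>) + real (Ion 0 \<omega>)" for \<omega>
    proof -
      have "(\<Sum>n<Ion 0 \<omega>. N 0 n \<omega>) = (\<Sum>n<Ion 0 \<omega>. (N 0 n \<omega> - 1) + 1)"
        using N_pos by (intro sum.cong) (auto simp: Suc_le_eq)
      also have "\<dots> = X \<omega> + Ion 0 \<omega>" unfolding X_def S_def by (subst sum.distrib) simp
      finally show ?thesis by simp
    qed
    then have "ennreal (EA + EI) = (\<integral>\<^sup>+\<omega>. of_nat (\<Sum>n<Ion 0 \<omega>. N 0 n \<omega>) \<partial>M)"
      unfolding ennreal_of_nat_eq_real_of_nat EA_def EI_def
      using nn_integral_eq_integral[OF Bochner_Integration.integrable_add[OF X_int Ion_mean]] X_int Ion_mean by simp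
    also have "\<dots> = ennreal (arr_rate d phi Lam) * (\<integral>\<^sup>+\<omega>. of_nat (Ion 0 \<omega>) \<partial>M)"
      using indep mean by (intro random_sum_mean) auto
    also have "(\<integral>\<^sup>+\<omega>. of_nat (Ion 0 \<omega>) \<partial>M) = ennreal EI"
      unfolding ennreal_of_nat_eq_real_of_nat EI_def using nn_integral_eq_integral[OF Ion_mean] by simp
    finally have "ennreal (EA + EI) = ennreal (arr_rate d phi Lam * EI)"
      using lam_gt1 by (simp add: ennreal_mult' EI_def)
    then show ?thesis
      using lam_gt1 by (subst (asm) ennreal_inj) (auto simp: EA_def EI_def intro!: add_nonneg_nonneg mult_nonneg_nonneg)
  qed
  have "EI \<noteq> 0" using EI unfolding EI_def by simp
  show ?thesis
  proof (intro conjI impI, goal_cases)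
    case 1
    show ?case using first unfolding EA_eq EI_def excess_def .
  next
    case 2
    have "excess * EI / (EA + EI) = (arr_rate d phi Lam - 1) / arr_rate d phi Lam"
      using second[OF conjunct1[OF 2] conjunct2[OF 2]] \<open>EI \<noteq> 0\<close> by (simp add: excess_def)
    with first show ?case
      unfolding excess_def by simp
  qed
qed

end
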